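(* Let $F^{n}=(M^{n},L)$ be a Finsler space, let $b_i(x,y)$ be an $h$-vector in $F^n$, and let ${}^{*}F^{n}=(M^{n},{}^{*}L)$ be the Finsler space obtained by the Kropina change with $h$-vector ${}^{*}L(x,y)=L^2(x,y)/(b_i(x,y)y^i)$. Let $F^{n-1}$ and ${}^{*}F^{n-1}$ be the Finslerian hypersurfaces of $F^n$ and ${}^{*}F^n$, respectively, with the same underlying hypersurface $M^{n-1}$ of $M^n$. Suppose that the vector $b_i$ is parallel with respect to the Cartan connection of $F^n$ and is tangent to the hypersurface $F^{n-1}$. Then ${}^{*}F^{n-1}$ is a hyperplane of the second kind if and only if $F^{n-1}$ is a hyperplane of the second kind; and ${}^{*}F^{n-1}$ is a hyperplane of the third kind if and only if $F^{n-1}$ is a hyperplane of the third kind.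
   Context: Notation: $\partial_i=\partial/\partial x^i$, $\dot\partial_i=\partial/\partial y^i$; the summation convention is used. Latin indices run over $1,\dots,n$, Greek indices over $1,\dots,n-1$. Finsler space: $F^n=(M^n,L)$ is an $n$-dimensional smooth manifold with Finsler metric function $L(x,y)$. Set $l_i=\dot\partial_iL$, $g_{ij}=\tfrac12\dot\partial_i\dot\partial_jL^2$, $h_{ij}=L\,\dot\partial_i\dot\partial_jL$, $C_{ijk}=\tfrac12\dot\partial_kg_{ij}$, $C^{h}_{ij}=g^{hk}C_{ijk}$. Cartan connection $C\Gamma=(F^i_{jk},G^i_j,C^i_{jk})$ of $F^n$: $G^i=\tfrac14g^{ir}(y^j\dot\partial_r\partial_jL^2-\partial_rL^2)$, $G^i_j=\dot\partial_jG^i$, and with $\delta_k=\partial_k-G^h_k\dot\partial_h$, $F^i_{jk}=\tfrac12g^{ir}(\delta_kg_{rj}+\delta_jg_{rk}-\delta_rg_{jk})$. For a covariant vector field $X_i(x,y)$ the $h$- and $v$-covariant derivatives are $X_{i|j}=\partial_jX_i-(\dot\partial_hX_i)G^h_j-F^r_{ij}X_r$ and $X_i|_j=\dot\partial_jX_i-C^r_{ij}X_r$. $h$-vector: $b_i(x,y)$ is an $h$-vector in $F^n$ if (i) $b_i|_k=0$ and (ii) $L\,C^h_{ij}b_h=\rho\,h_{ij}$ for a scalar function $\rho\neq0$. (By a known result of Izumi, $\rho$ is independent of $y$.) It is parallel with respect to the Cartan connection of $F^n$ if $b_{i|j}=0$ (the $v$-covariant derivative $b_i|_j$ vanishes already by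 (i)). Kropina change: put $\beta=b_iy^i$ (nonzero where ${}^{*}L$ is considered). ${}^{*}F^n=(M^n,{}^{*}L)$ is assumed to be a Finsler space; quantities marked with an asterisk are those formed from ${}^{*}L$ in the same way. Hypersurface: $M^{n-1}$ is given by $x^i=x^i(u^\alpha)$, with $B^i_\alpha=\partial x^i/\partial u^\alpha$ of rank $n-1$; the supporting element is tangent to $M^{n-1}$: $y^i=B^i_\alpha(u)v^\alpha$. $F^{n-1}=(M^{n-1},\underline L)$ with $\underline L(u,v)=L(x(u),y(u,v))$, and ${}^{*}F^{n-1}=(M^{n-1},{}^{*}\underline L)$ with ${}^{*}\underline L(u,v)={}^{*}L(x(u),y(u,v))$. Ambient quantities are evaluated at $(x(u),y(u,v))$. The unit normal $N^i(u,v)$ of $F^{n-1}$ is defined by $g_{ij}B^i_\alpha N^j=0$, $g_{ij}N^iN^j=1$, and $N_i=g_{ij}N^j$; similarly ${}^{*}N^i$ for ${}^{*}F^{n-1}$ using ${}^{*}g_{ij}$, and ${}^{*}N_i={}^{*}g_{ij}{}^{*}N^j$. The vector $b_i$ is tangent to $F^{n-1}$ if $b_iN^i=0$ along $F^{n-1}$. Fundamental tensors of $F^{n-1}$: with $B^i_{\alpha\beta}=\partial^2x^i/\partial u^\alpha\partial u^\beta$ and $B^i_{0\alpha}=B^i_{\beta\alpha}v^\beta$, put $M_\alpha=C_{ijk}B^i_\alpha N^jN^k$, $H_\alpha=N_i(B^i_{0\alpha}+G^i_jB^j_\alpha)$ (normal curvature vector), $H_{\alpha\beta}=N_i(B^i_{\alpha\beta}+F^i_{jk}B^j_\alpha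 B^k_\beta)+M_\alpha H_\beta$ (second fundamental $h$-tensor), $M_{\alpha\beta}=C_{ijk}B^i_\alpha B^j_\beta N^k$ (second fundamental $v$-tensor). For ${}^{*}F^{n-1}$ the tensors ${}^{*}M_\alpha,{}^{*}H_\alpha,{}^{*}H_{\alpha\beta},{}^{*}M_{\alpha\beta}$ are given by the same formulas with ${}^{*}N,{}^{*}G,{}^{*}F,{}^{*}C$ and the same $B^i_\alpha$. Hyperplanes (Matsumoto's characterizations, to be taken as definitions): $F^{n-1}$ is a hyperplane of the second kind if and only if $H_{\alpha\beta}=0$, and a hyperplane of the third kind if and only if $H_{\alpha\beta}=0=M_{\alpha\beta}$; likewise for ${}^{*}F^{n-1}$ with the starred tensors. *)

theory Defs
  imports "HOL-Analysis.Analysis"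
begin

section \<open>Smooth functions and smooth manifolds\<close>

text \<open>The derivatives below are two-sided, so \<open>smooth_on S\<close> is only used for open \<open>S\<close>.\<close>

primrec Ck_on :: "nat \<Rightarrow> 'a::euclidean_space set \<Rightarrow> ('a \<Rightarrow> 'b::real_normed_vector) \<Rightarrow> bool" where
  "Ck_on 0 S f \<longleftrightarrow> continuous_on S f"
| "Ck_on (Suc k) S f \<longleftrightarrow> (\<forall>p\<in>S. f differentiable (at p)) \<and>
      (\<forall>v. Ck_on k S (\<lambda>p. frechet_derivative f (at p) v))"

definition smooth_on :: "'a::euclidean_space set \<Rightarrow> ('a \<Rightarrow> 'b::real_normed_vector) \<Rightarrow> bool" where
  "smooth_on S f \<longleftrightarrow> (\<forall>k. Ck_on k S f)"

text \<open>A chart is a pair of its domain and its coordinate map; the coordinate map is only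
  relevant on the domain. The manifold is the whole (Hausdorff, second countable) type.\<close>

type_synonym ('a, 'n) chart = "'a set \<times> ('a \<Rightarrow> real ^ 'n)"

definition chart_image :: "('a, 'n) chart \<Rightarrow> (real ^ 'n) set" where
  "chart_image c = snd c ` fst c"

definition chart_inv :: "('a, 'n) chart \<Rightarrow> real ^ 'n \<Rightarrow> 'a" where
  "chart_inv c = inv_into (fst c) (snd c)"

definition overlap :: "('a, 'n) chart \<Rightarrow> ('a, 'n) chart \<Rightarrow> (real ^ 'n) set" where
  "overlap c d = snd c ` (fst c \<inter> fst d)"

definition transition :: "('a, 'n) chart \<Rightarrow> ('a, 'n) chart \<Rightarrow> real ^ 'n \<Rightarrow> real ^ 'n" where
  "transition c d = snd d \<circ> chart_inv c"

definition smooth_atlas ::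
    "('a::{t2_space,second_countable_topology}, 'n::finite) chart set \<Rightarrow> bool" where
  "smooth_atlas \<A> \<longleftrightarrow>
     (\<Union>c\<in>\<A>. fst c) = UNIV \<and>
     (\<forall>c\<in>\<A>. open (fst c) \<and> open (chart_image c) \<and>
        homeomorphism (fst c) (chart_image c) (snd c) (chart_inv c)) \<and>
     (\<forall>c\<in>\<A>. \<forall>d\<in>\<A>. smooth_on (overlap c d) (transition c d))"

definition tangent_transition ::
    "('a, 'n::finite) chart \<Rightarrow> ('a, 'n) chart \<Rightarrow> real ^ 'n \<Rightarrow> real ^ 'n \<Rightarrow> real ^ 'n" where
  "tangent_transition c d x y = frechet_derivative (transition c d) (at x) y"


section \<open>Finsler geometry in one coordinate system\<close>

text \<open>Here \<open>L x y\<close> is the metric function in the canonical coordinates \<open>(x, y)\<close> of the tangent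
  bundle; \<open>dx i\<close> and \<open>dy i\<close> are the partial derivatives with respect to \<open>x\<^sup>i\<close> and \<open>y\<^sup>i\<close>.
  Indices are the leading arguments.\<close>

type_synonym 'n tfun = "real ^ 'n \<Rightarrow> real ^ 'n \<Rightarrow> real"

definition dx :: "'n::finite \<Rightarrow> 'n tfun \<Rightarrow> 'n tfun" where
  "dx i f x y = frechet_derivative (\<lambda>z. f z y) (at x) (axis i 1)"

definition dy :: "'n::finite \<Rightarrow> 'n tfun \<Rightarrow> 'n tfun" where
  "dy i f x y = frechet_derivative (\<lambda>z. f x z) (at y) (axis i 1)"

definition metric :: "'n::finite tfun \<Rightarrow> 'n \<Rightarrow> 'n \<Rightarrow> 'n tfun" where
  "metric L i j x y = 1/2 * dy i (dy j (\<lambda>x y. (L x y)\<^sup>2)) x y"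

definition metric_inv :: "'n::finite tfun \<Rightarrow> 'n \<Rightarrow> 'n \<Rightarrow> 'n tfun" where
  "metric_inv L i j x y = matrix_inv (\<chi> a b. metric L a b x y) $ i $ j"

definition angular_metric :: "'n::finite tfun \<Rightarrow> 'n \<Rightarrow> 'n \<Rightarrow> 'n tfun" where
  "angular_metric L i j x y = L x y * dy i (dy j L) x y"

definition cartan_C :: "'n::finite tfun \<Rightarrow> 'n \<Rightarrow> 'n \<Rightarrow> 'n \<Rightarrow> 'n tfun" where
  "cartan_C L i j k x y = 1/2 * dy k (metric L i j) x y"

text \<open>\<open>cartan_C_up L h i j\<close> is $C^h_{ij}$ and \<open>cartan_F L i j k\<close> is $F^i_{jk}$.\<close>

definition cartan_C_up :: "'n::finite tfun \<Rightarrow> 'n \<Rightarrow> 'n \<Rightarrow> 'n \<Rightarrow> 'n tfun" where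
  "cartan_C_up L h i j x y = (\<Sum>k\<in>UNIV. metric_inv L h k x y * cartan_C L i j k x y)"

definition spray_G :: "'n::finite tfun \<Rightarrow> 'n \<Rightarrow> 'n tfun" where
  "spray_G L i x y = 1/4 * (\<Sum>r\<in>UNIV. metric_inv L i r x y *
     ((\<Sum>j\<in>UNIV. y $ j * dy r (dx j (\<lambda>x y. (L x y)\<^sup>2)) x y) - dx r (\<lambda>x y. (L x y)\<^sup>2) x y))"

definition nonlinear_G :: "'n::finite tfun \<Rightarrow> 'n \<Rightarrow> 'n \<Rightarrow> 'n tfun" where
  "nonlinear_G L i j = dy j (spray_G L i)"

definition delta :: "'n::finite tfun \<Rightarrow> 'n \<Rightarrow> 'n tfun \<Rightarrow> 'n tfun" where
  "delta L k f x y = dx k f x y - (\<Sum>h\<in>UNIV. nonlinear_G L h k x y * dy h f x y)"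

definition cartan_F :: "'n::finite tfun \<Rightarrow> 'n \<Rightarrow> 'n \<Rightarrow> 'n \<Rightarrow> 'n tfun" where
  "cartan_F L i j k x y = 1/2 * (\<Sum>r\<in>UNIV. metric_inv L i r x y *
     (delta L k (metric L r j) x y + delta L j (metric L r k) x y - delta L r (metric L j k) x y))"

definition h_cov ::
    "'n::finite tfun \<Rightarrow> (real ^ 'n \<Rightarrow> real ^ 'n \<Rightarrow> real ^ 'n) \<Rightarrow> 'n \<Rightarrow> 'n \<Rightarrow> 'n tfun" where
  "h_cov L X i j x y = dx j (\<lambda>x y. X x y $ i) x y
     - (\<Sum>h\<in>UNIV. dy h (\<lambda>x y. X x y $ i) x y * nonlinear_G L h j x y)
     - (\<Sum>r\<in>UNIV. cartan_F L r i j x y * X x y $ r)"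

definition v_cov ::
    "'n::finite tfun \<Rightarrow> (real ^ 'n \<Rightarrow> real ^ 'n \<Rightarrow> real ^ 'n) \<Rightarrow> 'n \<Rightarrow> 'n \<Rightarrow> 'n tfun" where
  "v_cov L X i j x y = dy j (\<lambda>x y. X x y $ i) x y
     - (\<Sum>r\<in>UNIV. cartan_C_up L r i j x y * X x y $ r)"


section \<open>Hypersurfaces in one coordinate system\<close>

text \<open>\<open>X\<close> is the parametrization $x^i = x^i(u^\alpha)$. For the tensors below, \<open>L\<close>, \<open>X\<close>, the
  point \<open>(u, v)\<close> and a unit normal \<open>N\<close> at that point are given.\<close>

definition Bcoef :: "(real ^ 'm \<Rightarrow> real ^ 'n) \<Rightarrow> 'n::finite \<Rightarrow> 'm::finite \<Rightarrow> real ^ 'm \<Rightarrow> real" where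
  "Bcoef X i \<alpha> u = frechet_derivative (\<lambda>w. X w $ i) (at u) (axis \<alpha> 1)"

definition B2coef ::
    "(real ^ 'm \<Rightarrow> real ^ 'n) \<Rightarrow> 'n::finite \<Rightarrow> 'm::finite \<Rightarrow> 'm \<Rightarrow> real ^ 'm \<Rightarrow> real" where
  "B2coef X i \<alpha> \<beta> u = frechet_derivative (Bcoef X i \<alpha>) (at u) (axis \<beta> 1)"

definition support :: "(real ^ 'm \<Rightarrow> real ^ 'n::finite) \<Rightarrow> real ^ 'm::finite \<Rightarrow> real ^ 'm \<Rightarrow> real ^ 'n" where
  "support X u v = (\<chi> i. \<Sum>\<alpha>\<in>UNIV. Bcoef X i \<alpha> u * v $ \<alpha>)"

definition unit_normal ::
    "'n::finite tfun \<Rightarrow> (real ^ 'm::finite \<Rightarrow> real ^ 'n) \<Rightarrow> real ^ 'm \<Rightarrow> real ^ 'm \<Rightarrow> real ^ 'n \<Rightarrow> bool" where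
  "unit_normal L X u v N \<longleftrightarrow>
     (\<forall>\<alpha>. (\<Sum>i\<in>UNIV. \<Sum>j\<in>UNIV. metric L i j (X u) (support X u v) * Bcoef X i \<alpha> u * N $ j) = 0) \<and>
     (\<Sum>i\<in>UNIV. \<Sum>j\<in>UNIV. metric L i j (X u) (support X u v) * N $ i * N $ j) = 1"

definition normal_cov ::
    "'n::finite tfun \<Rightarrow> (real ^ 'm::finite \<Rightarrow> real ^ 'n) \<Rightarrow> real ^ 'm \<Rightarrow> real ^ 'm \<Rightarrow> real ^ 'n \<Rightarrow>
     'n \<Rightarrow> real" where
  "normal_cov L X u v N i = (\<Sum>j\<in>UNIV. metric L i j (X u) (support X u v) * N $ j)"

definition M_vec ::
    "'n::finite tfun \<Rightarrow> (real ^ 'm::finite \<Rightarrow> real ^ 'n) \<Rightarrow> real ^ 'm \<Rightarrow> real ^ 'm \<Rightarrow> real ^ 'n \<Rightarrow>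
     'm \<Rightarrow> real" where
  "M_vec L X u v N \<alpha> = (\<Sum>i\<in>UNIV. \<Sum>j\<in>UNIV. \<Sum>k\<in>UNIV.
     cartan_C L i j k (X u) (support X u v) * Bcoef X i \<alpha> u * N $ j * N $ k)"

definition H_vec ::
    "'n::finite tfun \<Rightarrow> (real ^ 'm::finite \<Rightarrow> real ^ 'n) \<Rightarrow> real ^ 'm \<Rightarrow> real ^ 'm \<Rightarrow> real ^ 'n \<Rightarrow>
     'm \<Rightarrow> real" where
  "H_vec L X u v N \<alpha> = (\<Sum>i\<in>UNIV. normal_cov L X u v N i *
     ((\<Sum>\<beta>\<in>UNIV. B2coef X i \<beta> \<alpha> u * v $ \<beta>) +
      (\<Sum>j\<in>UNIV. nonlinear_G L i j (X u) (support X u v) * Bcoef X j \<alpha> u)))"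

definition H_tensor ::
    "'n::finite tfun \<Rightarrow> (real ^ 'm::finite \<Rightarrow> real ^ 'n) \<Rightarrow> real ^ 'm \<Rightarrow> real ^ 'm \<Rightarrow> real ^ 'n \<Rightarrow>
     'm \<Rightarrow> 'm \<Rightarrow> real" where
  "H_tensor L X u v N \<alpha> \<beta> = (\<Sum>i\<in>UNIV. normal_cov L X u v N i *
     (B2coef X i \<alpha> \<beta> u +
      (\<Sum>j\<in>UNIV. \<Sum>k\<in>UNIV.
         cartan_F L i j k (X u) (support X u v) * Bcoef X j \<alpha> u * Bcoef X k \<beta> u)))
     + M_vec L X u v N \<alpha> * H_vec L X u v N \<beta>"

definition M_tensor ::
    "'n::finite tfun \<Rightarrow> (real ^ 'm::finite \<Rightarrow> real ^ 'n) \<Rightarrow> real ^ 'm \<Rightarrow> real ^ 'm \<Rightarrow> real ^ 'n \<Rightarrow>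
     'm \<Rightarrow> 'm \<Rightarrow> real" where
  "M_tensor L X u v N \<alpha> \<beta> = (\<Sum>i\<in>UNIV. \<Sum>j\<in>UNIV. \<Sum>k\<in>UNIV.
     cartan_C L i j k (X u) (support X u v) * Bcoef X i \<alpha> u * Bcoef X j \<beta> u * N $ k)"


section \<open>Finsler spaces on a manifold\<close>

text \<open>Objects on the tangent bundle are families of their coordinate expressions, indexed by the
  charts of the atlas and related by the usual transformation laws. A Finsler metric is defined on
  an open conic subset \<open>D\<close> of the slit tangent bundle (possibly all of it). Positivity of \<open>L\<close>
  itself is not demanded, because a Kropina metric $L^2/\beta$ is negative where $\beta < 0$; positive
  definiteness of $g_{ij}$ implies $L \neq 0$.\<close>

definition conic_domain ::
    "('a, 'n::finite) chart set \<Rightarrow> (('a, 'n) chart \<Rightarrow> ((real ^ 'n) \<times> (real ^ 'n)) set) \<Rightarrow> bool" where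
  "conic_domain \<A> D \<longleftrightarrow>
     (\<forall>c\<in>\<A>. open (D c) \<and>
        (\<forall>(x, y)\<in>D c. x \<in> chart_image c \<and> y \<noteq> 0 \<and> (\<forall>t>0. (x, t *\<^sub>R y) \<in> D c))) \<and>
     (\<forall>c\<in>\<A>. \<forall>d\<in>\<A>. \<forall>(x, y)\<in>D c. x \<in> overlap c d \<longrightarrow>
        (transition c d x, tangent_transition c d x y) \<in> D d)"

definition finsler_space ::
    "('a, 'n::finite) chart set \<Rightarrow> (('a, 'n) chart \<Rightarrow> ((real ^ 'n) \<times> (real ^ 'n)) set) \<Rightarrow>
     (('a, 'n) chart \<Rightarrow> 'n tfun) \<Rightarrow> bool" where
  "finsler_space \<A> D L \<longleftrightarrow> conic_domain \<A> D \<and>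
     (\<forall>c\<in>\<A>. smooth_on (D c) (\<lambda>(x, y). L c x y) \<and>
        (\<forall>(x, y)\<in>D c. (\<forall>t>0. L c x (t *\<^sub>R y) = t * L c x y) \<and>
           (\<forall>w. w \<noteq> 0 \<longrightarrow> (\<Sum>i\<in>UNIV. \<Sum>j\<in>UNIV. metric (L c) i j x y * w $ i * w $ j) > 0))) \<and>
     (\<forall>c\<in>\<A>. \<forall>d\<in>\<A>. \<forall>(x, y)\<in>D c. x \<in> overlap c d \<longrightarrow>
        L d (transition c d x) (tangent_transition c d x y) = L c x y)"

definition covector_field ::
    "('a, 'n::finite) chart set \<Rightarrow> (('a, 'n) chart \<Rightarrow> ((real ^ 'n) \<times> (real ^ 'n)) set) \<Rightarrow>
     (('a, 'n) chart \<Rightarrow> real ^ 'n \<Rightarrow> real ^ 'n \<Rightarrow> real ^ 'n) \<Rightarrow> bool" where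
  "covector_field \<A> D b \<longleftrightarrow>
     (\<forall>c\<in>\<A>. smooth_on (D c) (\<lambda>(x, y). b c x y)) \<and>
     (\<forall>c\<in>\<A>. \<forall>d\<in>\<A>. \<forall>(x, y)\<in>D c. x \<in> overlap c d \<longrightarrow>
        (\<forall>w. b d (transition c d x) (tangent_transition c d x y) \<bullet> tangent_transition c d x w
             = b c x y \<bullet> w))"

definition scalar_field ::
    "('a, 'n::finite) chart set \<Rightarrow> (('a, 'n) chart \<Rightarrow> ((real ^ 'n) \<times> (real ^ 'n)) set) \<Rightarrow>
     (('a, 'n) chart \<Rightarrow> 'n tfun) \<Rightarrow> bool" where
  "scalar_field \<A> D \<rho> \<longleftrightarrow>
     (\<forall>c\<in>\<A>. \<forall>d\<in>\<A>. \<forall>(x, y)\<in>D c. x \<in> overlap c d \<longrightarrow>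
        \<rho> d (transition c d x) (tangent_transition c d x y) = \<rho> c x y)"

definition h_vector ::
    "('a, 'n::finite) chart set \<Rightarrow> (('a, 'n) chart \<Rightarrow> ((real ^ 'n) \<times> (real ^ 'n)) set) \<Rightarrow>
     (('a, 'n) chart \<Rightarrow> 'n tfun) \<Rightarrow> (('a, 'n) chart \<Rightarrow> real ^ 'n \<Rightarrow> real ^ 'n \<Rightarrow> real ^ 'n) \<Rightarrow> bool" where
  "h_vector \<A> D L b \<longleftrightarrow> covector_field \<A> D b \<and>
     (\<forall>c\<in>\<A>. \<forall>(x, y)\<in>D c. \<forall>i k. v_cov (L c) (b c) i k x y = 0) \<and>
     (\<exists>\<rho>. scalar_field \<A> D \<rho> \<and>
        (\<forall>c\<in>\<A>. \<forall>(x, y)\<in>D c. \<rho> c x y \<noteq> 0 \<and>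
           (\<forall>i j. L c x y * (\<Sum>h\<in>UNIV. cartan_C_up (L c) h i j x y * b c x y $ h)
              = \<rho> c x y * angular_metric (L c) i j x y)))"

definition h_parallel ::
    "('a, 'n::finite) chart set \<Rightarrow> (('a, 'n) chart \<Rightarrow> ((real ^ 'n) \<times> (real ^ 'n)) set) \<Rightarrow>
     (('a, 'n) chart \<Rightarrow> 'n tfun) \<Rightarrow> (('a, 'n) chart \<Rightarrow> real ^ 'n \<Rightarrow> real ^ 'n \<Rightarrow> real ^ 'n) \<Rightarrow> bool" where
  "h_parallel \<A> D L b \<longleftrightarrow> (\<forall>c\<in>\<A>. \<forall>(x, y)\<in>D c. \<forall>i j. h_cov (L c) (b c) i j x y = 0)"

definition beta ::
    "(('a, 'n::finite) chart \<Rightarrow> real ^ 'n \<Rightarrow> real ^ 'n \<Rightarrow> real ^ 'n) \<Rightarrow> ('a, 'n) chart \<Rightarrow> 'n tfun" where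
  "beta b c x y = (\<Sum>i\<in>UNIV. b c x y $ i * y $ i)"

definition kropina ::
    "(('a, 'n::finite) chart \<Rightarrow> 'n tfun) \<Rightarrow> (('a, 'n) chart \<Rightarrow> real ^ 'n \<Rightarrow> real ^ 'n \<Rightarrow> real ^ 'n) \<Rightarrow>
     ('a, 'n) chart \<Rightarrow> 'n tfun" where
  "kropina L b c x y = (L c x y)\<^sup>2 / beta b c x y"

definition kropina_domain ::
    "(('a, 'n::finite) chart \<Rightarrow> ((real ^ 'n) \<times> (real ^ 'n)) set) \<Rightarrow>
     (('a, 'n) chart \<Rightarrow> real ^ 'n \<Rightarrow> real ^ 'n \<Rightarrow> real ^ 'n) \<Rightarrow>
     ('a, 'n) chart \<Rightarrow> ((real ^ 'n) \<times> (real ^ 'n)) set" where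
  "kropina_domain D b c = {(x, y) \<in> D c. beta b c x y \<noteq> 0}"


section \<open>Finslerian hypersurfaces\<close>

text \<open>The hypersurface is an immersion \<open>f\<close> of an (n-1)-dimensional manifold with atlas \<open>\<B>\<close>;
  \<open>param c d f\<close>, defined on the open set \<open>param_domain c d f\<close>, is its coordinate expression
  $x^i = x^i(u^\alpha)$ in a chart \<open>c\<close> of the ambient manifold and a chart \<open>d\<close> of the hypersurface.\<close>

definition param :: "('a, 'n) chart \<Rightarrow> ('b, 'm) chart \<Rightarrow> ('b \<Rightarrow> 'a) \<Rightarrow> real ^ 'm \<Rightarrow> real ^ 'n" where
  "param c d f = snd c \<circ> f \<circ> chart_inv d"

definition param_domain :: "('a, 'n) chart \<Rightarrow> ('b, 'm) chart \<Rightarrow> ('b \<Rightarrow> 'a) \<Rightarrow> (real ^ 'm) set" where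
  "param_domain c d f = snd d ` (fst d \<inter> f -` fst c)"

definition hypersurface ::
    "('a::{t2_space,second_countable_topology}, 'n::finite) chart set \<Rightarrow>
     ('b::{t2_space,second_countable_topology}, 'm::finite) chart set \<Rightarrow> ('b \<Rightarrow> 'a) \<Rightarrow> bool" where
  "hypersurface \<A> \<B> f \<longleftrightarrow> CARD('n) = CARD('m) + 1 \<and> continuous_on UNIV f \<and>
     (\<forall>c\<in>\<A>. \<forall>d\<in>\<B>. smooth_on (param_domain c d f) (param c d f) \<and>
        (\<forall>u\<in>param_domain c d f.
           rank ((\<chi> i \<alpha>. Bcoef (param c d f) i \<alpha> u) :: real ^ 'm ^ 'n) = CARD('m)))"

definition hyp_domain ::
    "(('a, 'n::finite) chart \<Rightarrow> ((real ^ 'n) \<times> (real ^ 'n)) set) \<Rightarrow>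
     ('a, 'n) chart \<Rightarrow> ('b, 'm::finite) chart \<Rightarrow> ('b \<Rightarrow> 'a) \<Rightarrow> ((real ^ 'm) \<times> (real ^ 'm)) set" where
  "hyp_domain D c d f =
     {(u, v). u \<in> param_domain c d f \<and> (param c d f u, support (param c d f) u v) \<in> D c}"

text \<open>Since $g_{ij}$ is positive definite, there are exactly two unit normals \<open>N\<close> and \<open>-N\<close> at each
  \<open>(u, v)\<close>, and the conditions below do not depend on the choice between them.\<close>

definition tangent_to_hypersurface ::
    "('a, 'n::finite) chart set \<Rightarrow> ('b, 'm::finite) chart set \<Rightarrow> ('b \<Rightarrow> 'a) \<Rightarrow>
     (('a, 'n) chart \<Rightarrow> ((real ^ 'n) \<times> (real ^ 'n)) set) \<Rightarrow> (('a, 'n) chart \<Rightarrow> 'n tfun) \<Rightarrow>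
     (('a, 'n) chart \<Rightarrow> real ^ 'n \<Rightarrow> real ^ 'n \<Rightarrow> real ^ 'n) \<Rightarrow> bool" where
  "tangent_to_hypersurface \<A> \<B> f D L b \<longleftrightarrow>
     (\<forall>c\<in>\<A>. \<forall>d\<in>\<B>. \<forall>(u, v)\<in>hyp_domain D c d f. \<forall>N. unit_normal (L c) (param c d f) u v N \<longrightarrow>
        (\<Sum>i\<in>UNIV. b c (param c d f u) (support (param c d f) u v) $ i * N $ i) = 0)"

definition hyperplane_second_kind ::
    "('a, 'n::finite) chart set \<Rightarrow> ('b, 'm::finite) chart set \<Rightarrow> ('b \<Rightarrow> 'a) \<Rightarrow>
     (('a, 'n) chart \<Rightarrow> ((real ^ 'n) \<times> (real ^ 'n)) set) \<Rightarrow> (('a, 'n) chart \<Rightarrow> 'n tfun) \<Rightarrow> bool" where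
  "hyperplane_second_kind \<A> \<B> f D L \<longleftrightarrow>
     (\<forall>c\<in>\<A>. \<forall>d\<in>\<B>. \<forall>(u, v)\<in>hyp_domain D c d f. \<forall>N. unit_normal (L c) (param c d f) u v N \<longrightarrow>
        (\<forall>\<alpha> \<beta>. H_tensor (L c) (param c d f) u v N \<alpha> \<beta> = 0))"

definition hyperplane_third_kind ::
    "('a, 'n::finite) chart set \<Rightarrow> ('b, 'm::finite) chart set \<Rightarrow> ('b \<Rightarrow> 'a) \<Rightarrow>
     (('a, 'n) chart \<Rightarrow> ((real ^ 'n) \<times> (real ^ 'n)) set) \<Rightarrow> (('a, 'n) chart \<Rightarrow> 'n tfun) \<Rightarrow> bool" where
  "hyperplane_third_kind \<A> \<B> f D L \<longleftrightarrow>
     (\<forall>c\<in>\<A>. \<forall>d\<in>\<B>. \<forall>(u, v)\<in>hyp_domain D c d f. \<forall>N. unit_normal (L c) (param c d f) u v N \<longrightarrow>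
        (\<forall>\<alpha> \<beta>. H_tensor (L c) (param c d f) u v N \<alpha> \<beta> = 0 \<and>
               M_tensor (L c) (param c d f) u v N \<alpha> \<beta> = 0))"

end

theory Submission
  imports Defs
begin

text \<open>Writing \<open>l\<^sub>i\<close> for the \<open>y\<close>-derivative of \<open>L\<close>, one has \<open>dy i \<beta> = b\<^sub>i\<close> and \<open>dy j b\<^sub>i = \<rho> dy j l\<^sub>i\<close>.
  If \<open>b\<close> is parallel, then \<open>L\<close>, \<open>\<beta>\<close> and, for \<open>n \<ge> 3\<close>, also \<open>\<rho>\<close> are annihilated by the horizontal
  derivations of \<open>L\<close>. Hence so is \<open>L\<^sup>2/\<beta>\<close>, which gives both metrics the same spray; and the new
  metric tensor, being a combination of \<open>g\<^sub>i\<^sub>j\<close>, \<open>l\<^sub>i\<close>, \<open>b\<^sub>i\<close> with coefficients depending on \<open>L\<close>, \<open>\<beta>\<close>,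
  \<open>\<rho>\<close>, is parallel for the old connection, so both metrics have the same \<open>F\<^sup>i\<^sub>j\<^sub>k\<close>.

  The hypersurface is of the second kind iff \<open>p\<^sub>i (B\<^sup>i\<^sub>\<alpha>\<^sub>\<beta> + F\<^sup>i\<^sub>j\<^sub>k B\<^sup>j\<^sub>\<alpha> B\<^sup>k\<^sub>\<beta>) = 0\<close> for every covector \<open>p\<close> that
  annihilates the tangent vectors \<open>B\<^sub>\<alpha>\<close>. This condition only involves \<open>F\<close>. Similarly, \<open>M\<^sub>\<alpha>\<^sub>\<beta> = 0\<close>
  is expressed through such covectors; on tangent vectors and a normal on which \<open>b\<close> vanishes the change of
  \<open>C\<^sub>i\<^sub>j\<^sub>k\<close> is conformal, with the same factor as that of \<open>g\<^sub>i\<^sub>j\<close>.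

  Points with \<open>\<beta> = 0\<close>, which belong only to the old space, are reached by continuity: \<open>b\<close> is tangent
  and nonzero, so moving \<open>y\<close> in a suitable tangent direction makes \<open>\<beta>\<close> nonzero. For \<open>n = 2\<close>
  there are no points at all, since tangency makes \<open>b\<^sub>i\<close> proportional to \<open>l\<^sub>i\<close>, hence \<open>\<rho> = 0\<close>.\<close>

section \<open>Calculus of smooth functions\<close>

text \<open>The derivatives in \<open>Ck_on\<close> are two-sided; since S is open they only see the
  values on S. The closure lemmas below use this to replace a Frechet derivative by its explicit
  formula.\<close>

lemma Ck_on_cong:
  assumes "open S" "\<And>p. p \<in> S \<Longrightarrow> f p = g p" "Ck_on k S f"
  shows "Ck_on k S g"
  using assms(2,3)
proof (induction k arbitrary: f g)
  case 0
  then show ?case by (metis Ck_on.simps(1) continuous_on_cong)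
next
  case (Suc k)
  have "g differentiable (at p) \<and> frechet_derivative f (at p) = frechet_derivative g (at p)" if "p \<in> S" for p
  proof
    have d: "f differentiable (at p)" using Suc.prems that by simp
    then have "(f has_derivative frechet_derivative f (at p)) (at p)"
      by (rule frechet_derivative_works[THEN iffD1])
    then have "(g has_derivative frechet_derivative f (at p)) (at p)"
      by (rule has_derivative_transform_within_open[OF _ assms(1) that]) (use Suc.prems in auto)
    then show "g differentiable (at p)" "frechet_derivative f (at p) = frechet_derivative g (at p)"
      by (auto simp: differentiable_def frechet_derivative_at)
  qed
  then show ?case
    using Suc.prems Suc.IH[of "\<lambda>p. frechet_derivative f (at p) v" "\<lambda>p. frechet_derivative g (at p) v" for v]
    by auto
qed

lemma Ck_on_SucD: "Ck_on (Suc k) S f \<Longrightarrow> Ck_on k S f"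
proof (induction k arbitrary: f)
  case 0
  then show ?case
    by (auto intro!: continuous_at_imp_continuous_on differentiable_imp_continuous_within)
next
  case (Suc k)
  then show ?case by (metis Ck_on.simps(2))
qed

lemma Ck_on_subset: "Ck_on k S f \<Longrightarrow> T \<subseteq> S \<Longrightarrow> Ck_on k T f"
  by (induction k arbitrary: f) (auto intro: continuous_on_subset)

lemma Ck_on_const: "Ck_on k S (\<lambda>p. c)"
  by (induction k arbitrary: c) (auto simp: frechet_derivative_const)

lemma Ck_on_linear:
  assumes "bounded_linear h"
  shows "Ck_on k S h"
proof -
  have "frechet_derivative h (at p) = h" for p
    by (metis assms frechet_derivative_at bounded_linear_imp_has_derivative)
  moreover have "h differentiable (at p)" for p
    by (simp add: assms bounded_linear_imp_differentiable)
  ultimately show ?thesis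
    by (cases k) (auto simp: Ck_on_const assms linear_continuous_on)
qed

lemma Ck_on_compose_linear:
  assumes S: "open S" and h: "bounded_linear h" and "Ck_on k S f"
  shows "Ck_on k S (\<lambda>p. h (f p))"
  using assms(3)
proof (induction k arbitrary: f)
  case 0
  then show ?case
    by (simp add: continuous_on_compose2[OF linear_continuous_on[OF h, of UNIV]])
next
  case (Suc k)
  have d: "((\<lambda>p. h (f p)) has_derivative (\<lambda>v. h (frechet_derivative f (at p) v))) (at p)" if "p \<in> S" for p
    using Suc.prems that
    by (intro bounded_linear.has_derivative[OF h] frechet_derivative_works[THEN iffD1]) auto
  have e: "frechet_derivative (\<lambda>p. h (f p)) (at p) = (\<lambda>v. h (frechet_derivative f (at p) v))" if "p \<in> S" for p
    by (rule frechet_derivative_at[OF d, symmetric, OF that])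
  have "Ck_on k S (\<lambda>p. frechet_derivative (\<lambda>p. h (f p)) (at p) v)" for v
    by (rule Ck_on_cong[OF S, where f="\<lambda>p. h (frechet_derivative f (at p) v)"]) (use e Suc in auto)
  then show ?case using d by (auto simp: differentiable_def)
qed

lemma Ck_on_add:
  assumes S: "open S" and "Ck_on k S f" "Ck_on k S g"
  shows "Ck_on k S (\<lambda>p. f p + g p)"
  using assms(2,3)
proof (induction k arbitrary: f g)
  case 0
  then show ?case by (simp add: continuous_on_add)
next
  case (Suc k)
  have d: "((\<lambda>p. f p + g p) has_derivative (\<lambda>v. frechet_derivative f (at p) v + frechet_derivative g (at p) v)) (at p)"
    if "p \<in> S" for p
    using Suc.prems that by (intro has_derivative_add frechet_derivative_works[THEN iffD1]) auto
  have e: "frechet_derivative (\<lambda>p. f p + g p) (at p) = (\<lambda>v. frechet_derivative f (at p) v + frechet_derivative g (at p) v)"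
    if "p \<in> S" for p
    by (rule frechet_derivative_at[OF d, symmetric, OF that])
  have "Ck_on k S (\<lambda>p. frechet_derivative (\<lambda>p. f p + g p) (at p) v)" for v
    by (rule Ck_on_cong[OF S, where f="\<lambda>p. frechet_derivative f (at p) v + frechet_derivative g (at p) v"])
       (use e Suc in auto)
  then show ?case using d by (auto simp: differentiable_def)
qed

text \<open>The Leibniz rule pairs each factor with the derivative of the other, so both factors are
  also needed at order k, which \<open>Ck_on_SucD\<close> supplies.\<close>

lemma Ck_on_mult:
  fixes f g :: "'a::euclidean_space \<Rightarrow> real"
  assumes S: "open S" and "Ck_on k S f" "Ck_on k S g"
  shows "Ck_on k S (\<lambda>p. f p * g p)"
  using assms(2,3)
proof (induction k arbitrary: f g)
  case 0
  then show ?case by (simp add: continuous_on_mult)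
next
  case (Suc k)
  have d: "((\<lambda>p. f p * g p) has_derivative (\<lambda>v. f p * frechet_derivative g (at p) v + frechet_derivative f (at p) v * g p)) (at p)"
    if "p \<in> S" for p
    using Suc.prems that by (intro has_derivative_mult frechet_derivative_works[THEN iffD1]) auto
  have e: "frechet_derivative (\<lambda>p. f p * g p) (at p) = (\<lambda>v. f p * frechet_derivative g (at p) v + frechet_derivative f (at p) v * g p)"
    if "p \<in> S" for p
    by (rule frechet_derivative_at[OF d, symmetric, OF that])
  have "Ck_on k S (\<lambda>p. f p * frechet_derivative g (at p) v + frechet_derivative f (at p) v * g p)" for v
    using Suc.prems Ck_on_SucD[OF Suc.prems(1)] Ck_on_SucD[OF Suc.prems(2)]
    by (intro Ck_on_add[OF S] Suc.IH) auto
  then have "Ck_on k S (\<lambda>p. frechet_derivative (\<lambda>p. f p * g p) (at p) v)" for v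
    by (rule Ck_on_cong[OF S, rotated]) (use e in auto)
  then show ?case using d by (auto simp: differentiable_def)
qed

text \<open>The derivative of 1/f is -(1/f) f' (1/f), so order k for the same function already gives
  order k + 1; the induction keeps f fixed.\<close>

lemma Ck_on_inverse:
  fixes f :: "'a::euclidean_space \<Rightarrow> real"
  assumes S: "open S" and nz: "\<And>p. p \<in> S \<Longrightarrow> f p \<noteq> 0" and "Ck_on k S f"
  shows "Ck_on k S (\<lambda>p. inverse (f p))"
  using assms(3)
proof (induction k)
  case 0
  then show ?case by (simp add: continuous_on_inverse nz)
next
  case (Suc k)
  have d: "((\<lambda>p. inverse (f p)) has_derivative (\<lambda>v. - (inverse (f p) * frechet_derivative f (at p) v * inverse (f p)))) (at p)"
    if "p \<in> S" for p
    using Suc.prems that nz by (intro Deriv.has_derivative_inverse frechet_derivative_works[THEN iffD1]) auto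
  have e: "frechet_derivative (\<lambda>p. inverse (f p)) (at p) = (\<lambda>v. - (inverse (f p) * frechet_derivative f (at p) v * inverse (f p)))"
    if "p \<in> S" for p
    by (rule frechet_derivative_at[OF d, symmetric, OF that])
  have "Ck_on k S (\<lambda>p. - (inverse (f p) * frechet_derivative f (at p) v * inverse (f p)))" for v
    using Suc.prems Suc.IH Ck_on_SucD[OF Suc.prems]
    by (intro Ck_on_compose_linear[OF S, where h=uminus] Ck_on_mult[OF S] bounded_linear_minus bounded_linear_ident) auto
  then have "Ck_on k S (\<lambda>p. frechet_derivative (\<lambda>p. inverse (f p)) (at p) v)" for v
    by (rule Ck_on_cong[OF S, rotated]) (use e in auto)
  then show ?case using d by (auto simp: differentiable_def)
qed

lemma smooth_on_cong:
  assumes "open S" "\<And>p. p \<in> S \<Longrightarrow> f p = g p" "smooth_on S f"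
  shows "smooth_on S g"
  using assms Ck_on_cong unfolding smooth_on_def by blast

lemma smooth_on_subset: "smooth_on S f \<Longrightarrow> T \<subseteq> S \<Longrightarrow> smooth_on T f"
  using Ck_on_subset unfolding smooth_on_def by blast

lemma smooth_on_const: "smooth_on S (\<lambda>p. c)"
  by (simp add: smooth_on_def Ck_on_const)

lemma smooth_on_linear: "bounded_linear h \<Longrightarrow> smooth_on S h"
  by (simp add: smooth_on_def Ck_on_linear)

lemma smooth_on_compose_linear:
  "open S \<Longrightarrow> bounded_linear h \<Longrightarrow> smooth_on S f \<Longrightarrow> smooth_on S (\<lambda>p. h (f p))"
  by (simp add: smooth_on_def Ck_on_compose_linear)

lemma smooth_on_add:
  "open S \<Longrightarrow> smooth_on S f \<Longrightarrow> smooth_on S g \<Longrightarrow> smooth_on S (\<lambda>p. f p + g p)"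
  by (simp add: smooth_on_def Ck_on_add)

lemma smooth_on_mult:
  fixes f g :: "'a::euclidean_space \<Rightarrow> real"
  shows "open S \<Longrightarrow> smooth_on S f \<Longrightarrow> smooth_on S g \<Longrightarrow> smooth_on S (\<lambda>p. f p * g p)"
  by (simp add: smooth_on_def Ck_on_mult)

lemma smooth_on_inverse:
  fixes f :: "'a::euclidean_space \<Rightarrow> real"
  shows "open S \<Longrightarrow> (\<And>p. p \<in> S \<Longrightarrow> f p \<noteq> 0) \<Longrightarrow> smooth_on S f \<Longrightarrow> smooth_on S (\<lambda>p. inverse (f p))"
  by (simp add: smooth_on_def Ck_on_inverse)

lemma smooth_on_imp_differentiable: "smooth_on S f \<Longrightarrow> p \<in> S \<Longrightarrow> f differentiable (at p)"
  unfolding smooth_on_def by (metis Ck_on.simps(2))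

lemma smooth_on_imp_continuous: "smooth_on S f \<Longrightarrow> continuous_on S f"
  unfolding smooth_on_def by (metis Ck_on.simps(1))

lemma smooth_on_derivative: "smooth_on S f \<Longrightarrow> smooth_on S (\<lambda>p. frechet_derivative f (at p) v)"
  unfolding smooth_on_def by (metis Ck_on.simps(2))

text \<open>Two applications of the mean value theorem express the second difference
  \<open>F (p + h v + h w) - F (p + h v) - F (p + h w) + F p\<close> through either mixed derivative.\<close>

lemma second_difference_mvt:
  fixes F :: "'a::euclidean_space \<Rightarrow> real"
  assumes F: "smooth_on S F" and h: "0 < h"
    and box: "\<And>s t. 0 \<le> s \<Longrightarrow> s \<le> h \<Longrightarrow> 0 \<le> t \<Longrightarrow> t \<le> h \<Longrightarrow> p + s *\<^sub>R v + t *\<^sub>R w \<in> S"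
  obtains s t where "0 \<le> s" "s \<le> h" "0 \<le> t" "t \<le> h"
    "F (p + h *\<^sub>R v + h *\<^sub>R w) - F (p + h *\<^sub>R v) - F (p + h *\<^sub>R w) + F p
      = h * h * frechet_derivative (\<lambda>q. frechet_derivative F (at q) v) (at (p + s *\<^sub>R v + t *\<^sub>R w)) w"
proof -
  have line: "((\<lambda>s. K (a + s *\<^sub>R e)) has_real_derivative frechet_derivative K (at (a + s *\<^sub>R e)) e) (at s)"
    if "K differentiable (at (a + s *\<^sub>R e))" for K :: "'a \<Rightarrow> real" and a e s
  proof -
    have "((\<lambda>s. a + s *\<^sub>R e) has_derivative (\<lambda>r. r *\<^sub>R e)) (at s)"
      by (auto intro!: derivative_eq_intros)
    from has_derivative_compose[OF this, of K "frechet_derivative K (at (a + s *\<^sub>R e))"]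
    have "((\<lambda>s. K (a + s *\<^sub>R e)) has_derivative (\<lambda>r. frechet_derivative K (at (a + s *\<^sub>R e)) (r *\<^sub>R e))) (at s)"
      using that frechet_derivative_works by blast
    moreover have "frechet_derivative K (at (a + s *\<^sub>R e)) (r *\<^sub>R e) = r * frechet_derivative K (at (a + s *\<^sub>R e)) e" for r
      using linear_frechet_derivative[OF that] by (simp add: linear_cmul)
    ultimately show ?thesis by (simp add: has_field_derivative_def mult_commute_abs)
  qed
  let ?D = "\<lambda>q. frechet_derivative F (at q) v"
  \<comment> \<open>The first application runs in direction v, on the difference of F along two
    segments that lie h w apart; the second runs in direction w on the v-derivative.\<close>
  have 1: "((\<lambda>s. F ((p + h *\<^sub>R w) + s *\<^sub>R v) - F (p + s *\<^sub>R v)) has_real_derivative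
      ?D ((p + h *\<^sub>R w) + s *\<^sub>R v) - ?D (p + s *\<^sub>R v)) (at s)" if "0 \<le> s" "s \<le> h" for s
    using box[of s h] box[of s 0] that h smooth_on_imp_differentiable[OF F]
    by (intro DERIV_diff line) (simp_all add: algebra_simps)
  obtain s where s: "0 < s" "s < h"
    "(F ((p + h *\<^sub>R w) + h *\<^sub>R v) - F (p + h *\<^sub>R v)) - (F ((p + h *\<^sub>R w) + 0 *\<^sub>R v) - F (p + 0 *\<^sub>R v))
      = (h - 0) * (?D ((p + h *\<^sub>R w) + s *\<^sub>R v) - ?D (p + s *\<^sub>R v))"
    using MVT2[OF h 1] by blast
  have 2: "((\<lambda>t. ?D ((p + s *\<^sub>R v) + t *\<^sub>R w)) has_real_derivative
      frechet_derivative ?D (at ((p + s *\<^sub>R v) + t *\<^sub>R w)) w) (at t)" if "0 \<le> t" "t \<le> h" for t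
    using box[of s t] that s smooth_on_imp_differentiable[OF smooth_on_derivative[OF F]]
    by (intro line) simp
  obtain t where t: "0 < t" "t < h"
    "?D ((p + s *\<^sub>R v) + h *\<^sub>R w) - ?D ((p + s *\<^sub>R v) + 0 *\<^sub>R w)
      = (h - 0) * frechet_derivative ?D (at ((p + s *\<^sub>R v) + t *\<^sub>R w)) w"
    using MVT2[OF h 2] by blast
  have "?D ((p + h *\<^sub>R w) + s *\<^sub>R v) - ?D (p + s *\<^sub>R v) = h * frechet_derivative ?D (at ((p + s *\<^sub>R v) + t *\<^sub>R w)) w"
    using t(3) by (simp add: add.assoc add.commute[of "h *\<^sub>R w"])
  then have "F (p + h *\<^sub>R v + h *\<^sub>R w) - F (p + h *\<^sub>R v) - F (p + h *\<^sub>R w) + F p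
      = h * (h * frechet_derivative ?D (at (p + s *\<^sub>R v + t *\<^sub>R w)) w)"
    using s(3) by (simp add: add.assoc add.commute[of "h *\<^sub>R w"])
  then show ?thesis using that[of s t] s t by simp
qed

text \<open>The second difference is symmetric in v and w. It equals h^2 times either mixed
  derivative at some point near p, and both mixed derivatives are continuous.\<close>

lemma second_derivative_commute:
  fixes F :: "'a::euclidean_space \<Rightarrow> real"
  assumes S: "open S" and F: "smooth_on S F" and p: "p \<in> S"
  shows "frechet_derivative (\<lambda>q. frechet_derivative F (at q) v) (at p) w
       = frechet_derivative (\<lambda>q. frechet_derivative F (at q) w) (at p) v"
proof -
  define P where "P q = frechet_derivative (\<lambda>q. frechet_derivative F (at q) v) (at q) w" for q
  define Q where "Q q = frechet_derivative (\<lambda>q. frechet_derivative F (at q) w) (at q) v" for q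
  have "isCont P p" "isCont Q p"
    unfolding P_def Q_def
    using smooth_on_imp_continuous[OF smooth_on_derivative[OF smooth_on_derivative[OF F]]] S p
    by (auto simp: continuous_on_eq_continuous_at)
  have "\<bar>P p - Q p\<bar> \<le> e" if "e > 0" for e
  proof -
    have "\<forall>\<^sub>F q in nhds p. q \<in> S \<and> dist (P q) (P p) < e/2 \<and> dist (Q q) (Q p) < e/2"
      using \<open>isCont P p\<close> \<open>isCont Q p\<close> S p that
      by (intro eventually_conj eventually_nhds_in_open)
         (auto simp: isCont_def tendsto_at_iff_tendsto_nhds dest!: tendstoD[where e="e/2"])
    then obtain r where r: "r > 0" "\<And>q. dist q p < r \<Longrightarrow> q \<in> S \<and> dist (P q) (P p) < e/2 \<and> dist (Q q) (Q p) < e/2"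
      unfolding eventually_nhds_metric by blast
    \<comment> \<open>With this h the parallelogram spanned by h v and h w stays within r/2 of p;
      the summand 1 covers v = w = 0.\<close>
    define h where "h = r / (2 * (norm v + norm w + 1))"
    have nn: "norm v + norm w + 1 > 0" by (smt (verit) norm_ge_zero)
    have h: "h > 0" using r nn by (simp add: h_def)
    have near: "dist (p + s *\<^sub>R v + t *\<^sub>R w) p < r" if "0 \<le> s" "s \<le> h" "0 \<le> t" "t \<le> h" for s t
    proof -
      have "dist (p + s *\<^sub>R v + t *\<^sub>R w) p = norm (s *\<^sub>R v + t *\<^sub>R w)"
        by (simp add: dist_norm add.assoc)
      also have "\<dots> \<le> s * norm v + t * norm w"
        using norm_triangle_ineq[of "s *\<^sub>R v" "t *\<^sub>R w"] that by simp
      also have "\<dots> \<le> h * norm v + h * norm w"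
        using that by (intro add_mono mult_right_mono) auto
      also have "\<dots> \<le> h * (norm v + norm w + 1)" using h by (simp add: algebra_simps)
      also have "\<dots> = r / 2" using nn by (simp add: h_def field_simps)
      finally show ?thesis using r by simp
    qed
    obtain s t where st: "0 \<le> s" "s \<le> h" "0 \<le> t" "t \<le> h"
      "F (p + h *\<^sub>R v + h *\<^sub>R w) - F (p + h *\<^sub>R v) - F (p + h *\<^sub>R w) + F p = h * h * P (p + s *\<^sub>R v + t *\<^sub>R w)"
      unfolding P_def by (rule second_difference_mvt[OF F h, of p v w]) (use near r in auto)
    obtain s' t' where st': "0 \<le> s'" "s' \<le> h" "0 \<le> t'" "t' \<le> h"
      "F (p + h *\<^sub>R w + h *\<^sub>R v) - F (p + h *\<^sub>R w) - F (p + h *\<^sub>R v) + F p = h * h * Q (p + s' *\<^sub>R w + t' *\<^sub>R v)"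
      unfolding Q_def
    proof (rule second_difference_mvt[OF F h, of p w v])
      fix s t assume "0 \<le> s" "s \<le> h" "0 \<le> t" "t \<le> h"
      then have "p + t *\<^sub>R v + s *\<^sub>R w \<in> S" using near r by blast
      then show "p + s *\<^sub>R w + t *\<^sub>R v \<in> S" by (simp add: algebra_simps)
    qed
    have "P (p + s *\<^sub>R v + t *\<^sub>R w) = Q (p + t' *\<^sub>R v + s' *\<^sub>R w)"
      using st(5) st'(5) h by (simp add: algebra_simps)
    moreover have "dist (P (p + s *\<^sub>R v + t *\<^sub>R w)) (P p) < e/2" "dist (Q (p + t' *\<^sub>R v + s' *\<^sub>R w)) (Q p) < e/2"
      using near r st st' by auto
    ultimately show ?thesis unfolding dist_real_def by linarith
  qed
  then have "P p = Q p" by (metis abs_le_zero_iff eq_iff_diff_eq_0 field_le_epsilon add_0)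
  then show ?thesis by (simp add: P_def Q_def)
qed

section \<open>Derivations of functions on the tangent bundle\<close>

definition tsmooth :: "((real ^ 'n) \<times> (real ^ 'n)) set \<Rightarrow> 'n::finite tfun \<Rightarrow> bool" where
  "tsmooth S F \<longleftrightarrow> smooth_on S (\<lambda>p. F (fst p) (snd p))"

text \<open>Differentiation on the total space in an arbitrary direction. On smooth functions
  \<open>dx\<close>, \<open>dy\<close> and \<open>delta\<close> are all instances, so their rules
  are derived from those of \<open>dd\<close>.\<close>

definition dd :: "(real ^ 'n) \<times> (real ^ 'n) \<Rightarrow> 'n::finite tfun \<Rightarrow> 'n tfun" where
  "dd w F x y = frechet_derivative (\<lambda>p. F (fst p) (snd p)) (at (x, y)) w"

locale tangent_domain =
  fixes D :: "((real ^ 'n::finite) \<times> (real ^ 'n)) set"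
  assumes open_D: "open D"
begin

lemma tsmooth_has_derivative:
  assumes "tsmooth D F" "(x, y) \<in> D"
  shows "((\<lambda>p. F (fst p) (snd p)) has_derivative (\<lambda>w. dd w F x y)) (at (x, y))"
  unfolding dd_def using assms
  by (auto simp: tsmooth_def intro!: frechet_derivative_works[THEN iffD1] smooth_on_imp_differentiable[where S=D])

lemma dd_eqI:
  "((\<lambda>p. F (fst p) (snd p)) has_derivative f') (at (x, y)) \<Longrightarrow> dd w F x y = f' w"
  unfolding dd_def by (drule frechet_derivative_at) simp

lemma tsmooth_cong:
  "tsmooth D F \<Longrightarrow> (\<And>x y. (x, y) \<in> D \<Longrightarrow> F x y = G x y) \<Longrightarrow> tsmooth D G"
  unfolding tsmooth_def by (erule smooth_on_cong[OF open_D, rotated]) auto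

lemma tsmooth_const [simp]: "tsmooth D (\<lambda>x y. c)"
  by (simp add: tsmooth_def smooth_on_const)

lemma tsmooth_y [simp]: "tsmooth D (\<lambda>x y. y $ k)"
  unfolding tsmooth_def
  by (intro smooth_on_linear bounded_linear_compose[OF bounded_linear_vec_nth bounded_linear_snd])

lemma tsmooth_add [simp]:
  "tsmooth D F \<Longrightarrow> tsmooth D G \<Longrightarrow> tsmooth D (\<lambda>x y. F x y + G x y)"
  by (simp add: tsmooth_def smooth_on_add open_D)

lemma tsmooth_mult [simp]:
  "tsmooth D F \<Longrightarrow> tsmooth D G \<Longrightarrow> tsmooth D (\<lambda>x y. F x y * G x y)"
  by (simp add: tsmooth_def smooth_on_mult open_D)

lemma tsmooth_minus [simp]: "tsmooth D F \<Longrightarrow> tsmooth D (\<lambda>x y. - F x y)"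
  using tsmooth_mult[of "\<lambda>x y. -1" F] by simp

lemma tsmooth_diff [simp]:
  "tsmooth D F \<Longrightarrow> tsmooth D G \<Longrightarrow> tsmooth D (\<lambda>x y. F x y - G x y)"
  using tsmooth_add[of F "\<lambda>x y. - G x y"] by simp

lemma tsmooth_power [simp]: "tsmooth D F \<Longrightarrow> tsmooth D (\<lambda>x y. F x y ^ k)"
  by (induction k) auto

lemma tsmooth_sum [simp]:
  "(\<And>i. i \<in> I \<Longrightarrow> tsmooth D (F i)) \<Longrightarrow> tsmooth D (\<lambda>x y. \<Sum>i\<in>I. F i x y)"
  by (induction I rule: infinite_finite_induct) auto

lemma tsmooth_prod [simp]:
  "(\<And>i. i \<in> I \<Longrightarrow> tsmooth D (F i)) \<Longrightarrow> tsmooth D (\<lambda>x y. \<Prod>i\<in>I. F i x y)"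
  by (induction I rule: infinite_finite_induct) auto

lemma tsmooth_divide [simp]:
  "tsmooth D F \<Longrightarrow> tsmooth D G \<Longrightarrow> (\<And>x y. (x, y) \<in> D \<Longrightarrow> G x y \<noteq> 0) \<Longrightarrow> tsmooth D (\<lambda>x y. F x y / G x y)"
  using tsmooth_mult[of F "\<lambda>x y. inverse (G x y)"]
  by (auto simp: tsmooth_def divide_inverse smooth_on_inverse open_D)

lemma tsmooth_dd [simp]: "tsmooth D F \<Longrightarrow> tsmooth D (dd w F)"
  unfolding tsmooth_def dd_def using smooth_on_derivative by auto

lemma dd_const: "dd w (\<lambda>x y. c) x y = 0"
  by (rule dd_eqI) simp

lemma dd_add:
  assumes "tsmooth D F" "tsmooth D G" "(x, y) \<in> D"
  shows "dd w (\<lambda>x y. F x y + G x y) x y = dd w F x y + dd w G x y"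
  by (rule dd_eqI) (use assms in \<open>intro has_derivative_add tsmooth_has_derivative\<close>)

lemma dd_mult:
  assumes "tsmooth D F" "tsmooth D G" "(x, y) \<in> D"
  shows "dd w (\<lambda>x y. F x y * G x y) x y = dd w F x y * G x y + F x y * dd w G x y"
proof -
  have "dd w (\<lambda>x y. F x y * G x y) x y = F x y * dd w G x y + dd w F x y * G x y"
    using has_derivative_mult[OF tsmooth_has_derivative[OF assms(1,3)] tsmooth_has_derivative[OF assms(2,3)]]
    by (intro dd_eqI) simp
  then show ?thesis by simp
qed

lemma dd_minus:
  assumes "tsmooth D F" "(x, y) \<in> D"
  shows "dd w (\<lambda>x y. - F x y) x y = - dd w F x y"
  using dd_mult[of "\<lambda>x y. -1" F] assms by (simp add: dd_const)

lemma dd_diff: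
  assumes "tsmooth D F" "tsmooth D G" "(x, y) \<in> D"
  shows "dd w (\<lambda>x y. F x y - G x y) x y = dd w F x y - dd w G x y"
  using dd_add[of F "\<lambda>x y. - G x y"] assms by (simp add: dd_minus)

lemma dd_sum:
  assumes "\<And>i. i \<in> I \<Longrightarrow> tsmooth D (F i)" "(x, y) \<in> D"
  shows "dd w (\<lambda>x y. \<Sum>i\<in>I. F i x y) x y = (\<Sum>i\<in>I. dd w (F i) x y)"
  by (rule dd_eqI) (use assms in \<open>intro has_derivative_sum tsmooth_has_derivative\<close>)

lemma dd_cong:
  assumes "tsmooth D F" "\<And>x y. (x, y) \<in> D \<Longrightarrow> F x y = G x y" "(x, y) \<in> D"
  shows "dd w F x y = dd w G x y"
proof -
  have "((\<lambda>p. G (fst p) (snd p)) has_derivative (\<lambda>w. dd w F x y)) (at (x, y))"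
    by (rule has_derivative_transform_within_open[OF tsmooth_has_derivative open_D]) (use assms in auto)
  then show ?thesis by (rule dd_eqI[symmetric])
qed

lemma dd_divide:
  assumes "tsmooth D F" "tsmooth D G" "\<And>x y. (x, y) \<in> D \<Longrightarrow> G x y \<noteq> 0" "(x, y) \<in> D"
  shows "dd w (\<lambda>x y. F x y / G x y) x y = (dd w F x y * G x y - F x y * dd w G x y) / (G x y)\<^sup>2"
proof -
  have "dd w F x y = dd w (\<lambda>x y. (F x y / G x y) * G x y) x y"
    by (rule dd_cong) (use assms in auto)
  also have "\<dots> = dd w (\<lambda>x y. F x y / G x y) x y * G x y + F x y / G x y * dd w G x y"
    by (rule dd_mult) (use assms in auto)
  finally show ?thesis using assms(3)[OF assms(4)] by (simp add: field_simps power2_eq_square)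
qed

lemma dd_commute:
  assumes "tsmooth D F" "(x, y) \<in> D"
  shows "dd v (dd w F) x y = dd w (dd v F) x y"
  using second_derivative_commute[OF open_D, of "\<lambda>p. F (fst p) (snd p)" "(x, y)" w v] assms
  by (simp add: dd_def tsmooth_def)

lemma linear_dd:
  assumes "tsmooth D F" "(x, y) \<in> D"
  shows "linear (\<lambda>w. dd w F x y)"
  using tsmooth_has_derivative[OF assms] by (simp add: has_derivative_linear)

lemma dx_dd:
  assumes "tsmooth D F" "(x, y) \<in> D"
  shows "dx i F x y = dd (axis i 1, 0) F x y"
proof -
  have "((\<lambda>z. (z, y)) has_derivative (\<lambda>v. (v, 0))) (at x)"
    by (auto intro!: derivative_eq_intros)
  from has_derivative_compose[OF this tsmooth_has_derivative[OF assms]]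
  show ?thesis unfolding dx_def by (simp add: frechet_derivative_at[symmetric])
qed

lemma dy_dd:
  assumes "tsmooth D F" "(x, y) \<in> D"
  shows "dy i F x y = dd (0, axis i 1) F x y"
proof -
  have "((\<lambda>z. (x, z)) has_derivative (\<lambda>v. (0, v))) (at y)"
    by (auto intro!: derivative_eq_intros)
  from has_derivative_compose[OF this tsmooth_has_derivative[OF assms]]
  show ?thesis unfolding dy_def by (simp add: frechet_derivative_at[symmetric])
qed

lemma tsmooth_dx [simp]: "tsmooth D F \<Longrightarrow> tsmooth D (dx i F)"
  by (rule tsmooth_cong[OF tsmooth_dd]) (auto simp: dx_dd)

lemma tsmooth_dy [simp]: "tsmooth D F \<Longrightarrow> tsmooth D (dy i F)"
  by (rule tsmooth_cong[OF tsmooth_dd]) (auto simp: dy_dd)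

text \<open>The direction is the horizontal lift of the k-th coordinate vector. Only its value at
  the given point enters.\<close>

lemma delta_dd:
  assumes "tsmooth D F" "(x, y) \<in> D"
  shows "delta L k F x y = dd (axis k 1, - (\<chi> h. nonlinear_G L h k x y)) F x y"
proof -
  let ?c = "\<chi> h. nonlinear_G L h k x y"
  have "?c = (\<Sum>h\<in>UNIV. (?c $ h) *\<^sub>R axis h 1)"
    by (metis (no_types, lifting) basis_expansion scalar_mult_eq_scaleR sum.cong)
  then have "(axis k 1 :: real ^ 'n, - ?c) = (axis k 1, 0) - (\<Sum>h\<in>UNIV. nonlinear_G L h k x y *\<^sub>R (0, axis h 1))"
    by (simp add: prod_eq_iff fst_sum snd_sum)
  then have "dd (axis k 1, - ?c) F x y
      = dd ((axis k 1, 0) - (\<Sum>h\<in>UNIV. nonlinear_G L h k x y *\<^sub>R (0, axis h 1))) F x y" by (simp only:)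
  also have "\<dots> = dd (axis k 1, 0) F x y - (\<Sum>h\<in>UNIV. nonlinear_G L h k x y * dd (0, axis h 1) F x y)"
    unfolding linear_diff[OF linear_dd[OF assms]] linear_sum[OF linear_dd[OF assms]]
      linear_cmul[OF linear_dd[OF assms]] by simp
  finally show ?thesis using assms by (simp add: delta_def dx_dd dy_dd)
qed

section \<open>Rules for \<open>dx\<close>, \<open>dy\<close> and \<open>delta\<close>\<close>

lemma dx_const: "dx k (\<lambda>x y. c) x y = 0" and dy_const: "dy k (\<lambda>x y. c) x y = 0"
  and delta_const: "delta L k (\<lambda>x y. c) x y = 0"
  by (simp_all add: dx_def dy_def delta_def frechet_derivative_const)

lemma dx_y: "dx k (\<lambda>x y. y $ i) x y = 0"
  by (simp add: dx_def frechet_derivative_const)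

lemma dy_y: "dy k (\<lambda>x y. y $ i) x y = (if i = k then 1 else 0)"
proof -
  have "((\<lambda>z. z $ i) has_derivative (\<lambda>v. v $ i)) (at y)"
    by (intro bounded_linear_imp_has_derivative bounded_linear_vec_nth)
  then show ?thesis by (simp add: dy_def frechet_derivative_at[symmetric] axis_def)
qed

lemma delta_y: "delta L k (\<lambda>x y. y $ i) x y = - nonlinear_G L i k x y"
  by (simp add: delta_def dx_y dy_y if_distrib cong: if_cong)

lemma
  assumes "tsmooth D F" "tsmooth D G" "(x, y) \<in> D"
  shows dy_diff: "dy k (\<lambda>x y. F x y - G x y) x y = dy k F x y - dy k G x y"
    and delta_diff: "delta L k (\<lambda>x y. F x y - G x y) x y = delta L k F x y - delta L k G x y"
    and dx_mult: "dx k (\<lambda>x y. F x y * G x y) x y = dx k F x y * G x y + F x y * dx k G x y"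
    and dy_mult: "dy k (\<lambda>x y. F x y * G x y) x y = dy k F x y * G x y + F x y * dy k G x y"
    and delta_mult: "delta L k (\<lambda>x y. F x y * G x y) x y = delta L k F x y * G x y + F x y * delta L k G x y"
  using assms by (simp_all add: dx_dd dy_dd delta_dd dd_diff dd_mult)

lemma
  assumes "tsmooth D F" "(x, y) \<in> D"
  shows dy_power2: "dy k (\<lambda>x y. (F x y)\<^sup>2) x y = 2 * F x y * dy k F x y"
    and delta_power2: "delta L k (\<lambda>x y. (F x y)\<^sup>2) x y = 2 * F x y * delta L k F x y"
  using assms by (simp_all add: power2_eq_square dy_mult delta_mult)

lemma
  assumes "tsmooth D F" "tsmooth D G" "\<And>x y. (x, y) \<in> D \<Longrightarrow> G x y \<noteq> 0" "(x, y) \<in> D"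
  shows dy_divide: "dy k (\<lambda>x y. F x y / G x y) x y = (dy k F x y * G x y - F x y * dy k G x y) / (G x y)\<^sup>2"
    and delta_divide: "delta L k (\<lambda>x y. F x y / G x y) x y = (delta L k F x y * G x y - F x y * delta L k G x y) / (G x y)\<^sup>2"
  using assms by (simp_all add: dy_dd delta_dd dd_divide)

lemma
  assumes "\<And>i. i \<in> I \<Longrightarrow> tsmooth D (F i)" "(x, y) \<in> D"
  shows dx_sum: "dx k (\<lambda>x y. \<Sum>i\<in>I. F i x y) x y = (\<Sum>i\<in>I. dx k (F i) x y)"
    and dy_sum: "dy k (\<lambda>x y. \<Sum>i\<in>I. F i x y) x y = (\<Sum>i\<in>I. dy k (F i) x y)"
    and delta_sum: "delta L k (\<lambda>x y. \<Sum>i\<in>I. F i x y) x y = (\<Sum>i\<in>I. delta L k (F i) x y)"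
  using assms by (simp_all add: dx_dd dy_dd delta_dd dd_sum)

lemma
  assumes "tsmooth D F" "\<And>x y. (x, y) \<in> D \<Longrightarrow> F x y = G x y" "(x, y) \<in> D"
  shows dx_cong: "dx k F x y = dx k G x y"
    and dy_cong: "dy k F x y = dy k G x y"
    and delta_cong: "delta L k F x y = delta L k G x y"
  using assms tsmooth_cong[OF assms(1,2)] by (simp_all add: dx_dd dy_dd delta_dd dd_cong[OF assms])

lemma dd_dx: "tsmooth D F \<Longrightarrow> (x, y) \<in> D \<Longrightarrow> dd w (dx i F) x y = dd w (dd (axis i 1, 0) F) x y"
  and dd_dy: "tsmooth D F \<Longrightarrow> (x, y) \<in> D \<Longrightarrow> dd w (dy i F) x y = dd w (dd (0, axis i 1) F) x y"
  by (rule dd_cong; simp add: dx_dd dy_dd)+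

lemma
  assumes "tsmooth D F" "(x, y) \<in> D"
  shows dy_commute: "dy i (dy j F) x y = dy j (dy i F) x y"
    and dy_dx_commute: "dy i (dx j F) x y = dx j (dy i F) x y"
  using assms dd_commute[OF assms] by (simp_all add: dx_dd[of "dy _ _"] dy_dd[of "dx _ _"] dy_dd[of "dy _ _"] dd_dx dd_dy)

text \<open>Euler's theorem: the derivative of F x (t y) at t = 1 is computed by the chain rule and
  by homogeneity.\<close>

lemma euler_degree_one:
  assumes "tsmooth D F" "(x, y) \<in> D" "\<And>t. t > 0 \<Longrightarrow> F x (t *\<^sub>R y) = t * F x y"
  shows "(\<Sum>i\<in>UNIV. y $ i * dy i F x y) = F x y"
proof -
  have y: "(\<Sum>i\<in>UNIV. (y $ i) *\<^sub>R (0, axis i 1)) = (0 :: real ^ 'n, y)"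
    using basis_expansion[of y] by (simp add: prod_eq_iff fst_sum snd_sum scalar_mult_eq_scaleR)
  have "((\<lambda>t. (x, t *\<^sub>R y)) has_derivative (\<lambda>t. (0, t *\<^sub>R y))) (at 1)"
    by (auto intro!: derivative_eq_intros)
  from has_derivative_compose[OF this, of "\<lambda>p. F (fst p) (snd p)"] tsmooth_has_derivative[OF assms(1,2)]
  have "((\<lambda>t. F x (t *\<^sub>R y)) has_derivative (\<lambda>t. dd (0, t *\<^sub>R y) F x y)) (at 1)" by simp
  \<comment> \<open>Homogeneity is only known for positive t, so the two functions of t are compared
    on an open half-line around 1.\<close>
  then have 1: "((\<lambda>t. t * F x y) has_derivative (\<lambda>t. dd (0, t *\<^sub>R y) F x y)) (at 1)"
    by (rule has_derivative_transform_within_open[of _ _ _ _ "{0<..}"]) (use assms(3) in auto)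
  moreover have "((\<lambda>t. t * F x y) has_derivative (\<lambda>t. t * F x y)) (at 1)"
    by (auto intro!: derivative_eq_intros)
  ultimately have "(\<lambda>t. dd (0, t *\<^sub>R y) F x y) = (\<lambda>t. t * F x y)"
    by (rule has_derivative_unique)
  then have "dd (0, y) F x y = F x y" by (metis mult_1 scaleR_one)
  then show ?thesis
    unfolding y[symmetric] linear_sum[OF linear_dd[OF assms(1,2)]] linear_cmul[OF linear_dd[OF assms(1,2)]]
    using assms by (simp add: dy_dd)
qed

end

section \<open>Inverse matrices\<close>

lemma matrix_inv_mult:
  fixes A :: "real ^ 'n::finite ^ 'n"
  assumes "invertible A"
  shows "A ** matrix_inv A = mat 1" "matrix_inv A ** A = mat 1"
  using someI_ex[OF assms[unfolded invertible_def]] by (simp_all add: matrix_inv_def)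

text \<open>Cramer's rule for the j-th column of the inverse. It presents the entries as quotients
  of polynomials in the entries of A, which makes the inverse metric smooth.\<close>

lemma matrix_inv_entry:
  fixes A :: "real ^ 'n::finite ^ 'n"
  assumes "invertible A"
  shows "matrix_inv A $ i $ j = det (\<chi> a c. if c = i then axis j 1 $ a else A $ a $ c) / det A"
proof -
  have "A *v (matrix_inv A *v axis j 1) = axis j 1"
    using matrix_inv_mult[OF assms] by (simp add: matrix_vector_mul_assoc)
  then have "matrix_inv A *v axis j 1 = (\<chi> k. det (\<chi> a c. if c = k then axis j 1 $ a else A $ a $ c) / det A)"
    using cramer[of A] assms invertible_det_nz by blast
  moreover have "(matrix_inv A *v axis j 1) $ i = matrix_inv A $ i $ j"
    by (simp add: matrix_vector_mult_def axis_def if_distrib cong: if_cong)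
  ultimately show ?thesis by simp
qed

lemma (in tangent_domain) tsmooth_matrix_inv:
  assumes "\<And>a c. tsmooth D (\<lambda>x y. A x y $ a $ c)" "\<And>x y. (x, y) \<in> D \<Longrightarrow> invertible (A x y :: real ^ 'n ^ 'n)"
  shows "tsmooth D (\<lambda>x y. matrix_inv (A x y) $ i $ j)"
proof -
  have det: "tsmooth D (\<lambda>x y. det (B x y))" if "\<And>a c. tsmooth D (\<lambda>x y. B x y $ a $ c)" for B :: "real ^ 'n \<Rightarrow> real ^ 'n \<Rightarrow> real ^ 'n ^ 'n"
    unfolding det_def using that by simp
  have "tsmooth D (\<lambda>x y. det (\<chi> a c. if c = i then axis j 1 $ a else A x y $ a $ c) / det (A x y))"
  proof (intro tsmooth_divide det)
    show "tsmooth D (\<lambda>x y. (\<chi> a c. if c = i then axis j 1 $ a else A x y $ a $ c) $ a $ c)" for a c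
      using assms(1) by (cases "c = i") simp_all
  qed (use assms in \<open>auto simp: invertible_det_nz\<close>)
  then show ?thesis by (rule tsmooth_cong) (simp add: matrix_inv_entry assms)
qed

section \<open>The Cartan connection in one chart\<close>

text \<open>Naming L^2 gives the rewrite rules a constant to match in place of the abstraction used
  in the definitions.\<close>

definition energy :: "'n::finite tfun \<Rightarrow> 'n tfun" where
  "energy L x y = (L x y)\<^sup>2"

lemma energy_fun: "(\<lambda>x y. (L x y)\<^sup>2) = energy L"
  by (simp add: fun_eq_iff energy_def)

lemma sum_delta_mult [simp]:
  fixes P :: "'n::finite \<Rightarrow> real"
  shows "(\<Sum>j\<in>UNIV. P j * (if j = i then 1 else 0)) = P i"
    and "(\<Sum>j\<in>UNIV. P j * (if i = j then 1 else 0)) = P i"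
    and "(\<Sum>j\<in>UNIV. (if j = i then 1 else 0) * P j) = P i"
    and "(\<Sum>j\<in>UNIV. (if i = j then 1 else 0) * P j) = P i"
  by (simp_all add: if_distrib[of "\<lambda>c. _ * c"] if_distrib[of "\<lambda>c. c * _"] cong: if_cong)

text \<open>A Finsler space seen in one chart. Homogeneity enters the later computations only
  through \<open>euler_L\<close> and its consequences.\<close>

locale finsler_chart = tangent_domain D
  for D :: "((real ^ 'n::finite) \<times> (real ^ 'n)) set" +
  fixes L :: "'n tfun"
  assumes smooth_L [simp]: "tsmooth D L"
    and y_nonzero: "(x, y) \<in> D \<Longrightarrow> y \<noteq> 0"
    and L_scale: "(x, y) \<in> D \<Longrightarrow> t > 0 \<Longrightarrow> L x (t *\<^sub>R y) = t * L x y"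
    and metric_pos: "(x, y) \<in> D \<Longrightarrow> w \<noteq> 0 \<Longrightarrow> (\<Sum>i\<in>UNIV. \<Sum>j\<in>UNIV. metric L i j x y * w $ i * w $ j) > 0"
begin

abbreviation "E \<equiv> energy L"
abbreviation "g \<equiv> metric L"
abbreviation "G \<equiv> spray_G L"
abbreviation "N \<equiv> nonlinear_G L"
abbreviation "F \<equiv> cartan_F L"

lemma smooth_E [simp]: "tsmooth D E"
  unfolding energy_fun[symmetric] by simp

lemma metric_E: "g i j x y = 1/2 * dy i (dy j E) x y"
  by (simp add: metric_def energy_fun)

lemma metric_E_fun: "g i j = (\<lambda>x y. 1/2 * dy i (dy j E) x y)"
  by (simp add: fun_eq_iff metric_E)

lemma smooth_g [simp]: "tsmooth D (g i j)"
  unfolding metric_E_fun by simp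

lemma dy_E: "(x, y) \<in> D \<Longrightarrow> dy i E x y = 2 * L x y * dy i L x y"
  unfolding energy_fun[symmetric] by (simp add: dy_power2)

lemma metric_commute: "(x, y) \<in> D \<Longrightarrow> g i j x y = g j i x y"
  by (simp add: metric_E dy_commute[of E])

lemma dy_metric: "(x, y) \<in> D \<Longrightarrow> dy k (g i j) x y = 1/2 * dy k (dy i (dy j E)) x y"
  unfolding metric_E_fun by (subst dy_mult) (auto simp: dy_const)

lemma dx_metric: "(x, y) \<in> D \<Longrightarrow> dx k (g i j) x y = 1/2 * dx k (dy i (dy j E)) x y"
  unfolding metric_E_fun by (subst dx_mult) (auto simp: dx_const)

section \<open>Euler relations\<close>

lemma euler_L: "(x, y) \<in> D \<Longrightarrow> (\<Sum>i\<in>UNIV. y $ i * dy i L x y) = L x y"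
  by (rule euler_degree_one) (auto simp: L_scale)

text \<open>Differentiate Euler's relation in y^i: the terms in which y^j is differentiated
  reproduce the left-hand side. The relations for E arise in the same way.\<close>

lemma euler_L1:
  assumes "(x, y) \<in> D"
  shows "(\<Sum>j\<in>UNIV. y $ j * dy i (dy j L) x y) = 0"
proof -
  have "dy i L x y = dy i (\<lambda>x y. \<Sum>j\<in>UNIV. y $ j * dy j L x y) x y"
    by (rule dy_cong) (use assms in \<open>auto simp: euler_L\<close>)
  also have "\<dots> = dy i L x y + (\<Sum>j\<in>UNIV. y $ j * dy i (dy j L) x y)"
    using assms by (simp add: dy_sum dy_mult dy_y sum.distrib)
  finally show ?thesis by simp
qed

lemma euler_E: "(x, y) \<in> D \<Longrightarrow> (\<Sum>i\<in>UNIV. y $ i * dy i E x y) = 2 * E x y"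
proof -
  assume p: "(x, y) \<in> D"
  have "(\<Sum>i\<in>UNIV. y $ i * dy i E x y) = 2 * L x y * (\<Sum>i\<in>UNIV. y $ i * dy i L x y)"
    by (simp add: dy_E p sum_distrib_left mult_ac)
  then show ?thesis by (simp add: euler_L p energy_def power2_eq_square)
qed

lemma euler_E1:
  assumes "(x, y) \<in> D"
  shows "(\<Sum>j\<in>UNIV. y $ j * dy i (dy j E) x y) = dy i E x y"
proof -
  have "2 * dy i E x y = dy i (\<lambda>x y. 2 * E x y) x y"
    using assms by (simp add: dy_mult dy_const)
  also have "\<dots> = dy i (\<lambda>x y. \<Sum>j\<in>UNIV. y $ j * dy j E x y) x y"
    by (rule dy_cong) (use assms in \<open>auto simp: euler_E\<close>)
  also have "\<dots> = dy i E x y + (\<Sum>j\<in>UNIV. y $ j * dy i (dy j E) x y)"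
    using assms by (simp add: dy_sum dy_mult dy_y sum.distrib)
  finally show ?thesis by simp
qed

text \<open>Up to a constant factor this says that the Cartan tensor vanishes on the supporting
  element.\<close>

lemma euler_E2:
  assumes "(x, y) \<in> D"
  shows "(\<Sum>j\<in>UNIV. y $ j * dy k (dy i (dy j E)) x y) = 0"
proof -
  have "dy k (dy i E) x y = dy k (\<lambda>x y. \<Sum>j\<in>UNIV. y $ j * dy i (dy j E) x y) x y"
    by (rule dy_cong) (use assms in \<open>auto simp: euler_E1\<close>)
  also have "\<dots> = dy i (dy k E) x y + (\<Sum>j\<in>UNIV. y $ j * dy k (dy i (dy j E)) x y)"
    using assms by (simp add: dy_sum dy_mult dy_y sum.distrib)
  finally show ?thesis using assms by (simp add: dy_commute[of E])
qed

lemma metric_y: "(x, y) \<in> D \<Longrightarrow> (\<Sum>j\<in>UNIV. g i j x y * y $ j) = 1/2 * dy i E x y"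
  using euler_E1[of x y i] by (simp add: metric_E mult.commute[of _ "y $ _"] sum_distrib_left[symmetric] sum_divide_distrib[symmetric])

lemma metric_yy: "(x, y) \<in> D \<Longrightarrow> (\<Sum>i\<in>UNIV. \<Sum>j\<in>UNIV. g i j x y * y $ i * y $ j) = E x y"
proof -
  assume p: "(x, y) \<in> D"
  have "(\<Sum>i\<in>UNIV. \<Sum>j\<in>UNIV. g i j x y * y $ i * y $ j) = (\<Sum>i\<in>UNIV. y $ i * (\<Sum>j\<in>UNIV. g i j x y * y $ j))"
    by (simp add: sum_distrib_left mult_ac)
  also have "\<dots> = 1/2 * (\<Sum>i\<in>UNIV. y $ i * dy i E x y)"
    by (simp add: metric_y p sum_distrib_left)
  finally show ?thesis by (simp add: euler_E p)
qed

text \<open>L itself may be negative, but positive definiteness applied to y gives g(y,y) = L^2 >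
  0.\<close>

lemma E_pos: "(x, y) \<in> D \<Longrightarrow> E x y > 0"
  using metric_pos[of x y y] y_nonzero by (simp add: metric_yy)

lemma L_nonzero: "(x, y) \<in> D \<Longrightarrow> L x y \<noteq> 0"
  using E_pos[of x y] by (auto simp: energy_def)

lemma metric_nondegenerate:
  assumes p: "(x, y) \<in> D" and z: "\<And>i. (\<Sum>j\<in>UNIV. g i j x y * w j) = 0"
  shows "w j = 0"
proof (rule ccontr)
  assume "w j \<noteq> 0"
  then have "(\<chi> j. w j) \<noteq> 0" by (metis vec_lambda_beta zero_index)
  from metric_pos[OF p this] have "(\<Sum>i\<in>UNIV. w i * (\<Sum>j\<in>UNIV. g i j x y * w j)) > 0"
    by (simp add: sum_distrib_left mult_ac)
  then show False by (simp add: z)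
qed

text \<open>Sprays and connection coefficients are compared below with their upper index lowered, so
  that the inverse metric never has to be differentiated.\<close>

lemma metric_cancel:
  assumes p: "(x, y) \<in> D" and z: "\<And>i. (\<Sum>j\<in>UNIV. g i j x y * v j) = (\<Sum>j\<in>UNIV. g i j x y * w j)"
  shows "v j = w j"
  using metric_nondegenerate[OF p, of "\<lambda>j. v j - w j" j] z
  by (simp add: algebra_simps sum_subtractf)

lemma metric_invertible:
  assumes p: "(x, y) \<in> D"
  shows "invertible (\<chi> a c. g a c x y)"
proof -
  have "w = 0" if "(\<chi> a c. g a c x y) *v w = 0" for w
  proof -
    have "(\<Sum>j\<in>UNIV. g i j x y * w $ j) = 0" for i
      using arg_cong[OF that, of "\<lambda>v. v $ i"] by (simp add: matrix_vector_mult_def)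
    then show ?thesis using metric_nondegenerate[OF p, of "\<lambda>j. w $ j"] by (simp add: vec_eq_iff)
  qed
  then show ?thesis
    by (metis invertible_left_inverse matrix_left_invertible_ker)
qed

lemma smooth_metric_inv [simp]: "tsmooth D (metric_inv L i j)"
proof -
  have "tsmooth D (\<lambda>x y. matrix_inv (\<chi> a c. g a c x y) $ i $ j)"
    by (rule tsmooth_matrix_inv) (simp_all add: metric_invertible)
  then show ?thesis by (simp add: metric_inv_def[abs_def])
qed

lemma metric_inv_right:
  assumes p: "(x, y) \<in> D"
  shows "(\<Sum>j\<in>UNIV. g i j x y * metric_inv L j k x y) = (if i = k then 1 else 0)"
  using arg_cong[OF matrix_inv_mult(1)[OF metric_invertible[OF p]], of "\<lambda>A. A $ i $ k"]
  by (simp add: matrix_matrix_mult_def metric_inv_def mat_def)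

lemma metric_inv_left:
  assumes p: "(x, y) \<in> D"
  shows "(\<Sum>j\<in>UNIV. metric_inv L i j x y * g j k x y) = (if i = k then 1 else 0)"
  using arg_cong[OF matrix_inv_mult(2)[OF metric_invertible[OF p]], of "\<lambda>A. A $ i $ k"]
  by (simp add: matrix_matrix_mult_def metric_inv_def mat_def)

lemma metric_metric_inv:
  assumes p: "(x, y) \<in> D"
  shows "(\<Sum>i\<in>UNIV. g s i x y * (\<Sum>r\<in>UNIV. metric_inv L i r x y * P r)) = P s"
proof -
  have "(\<Sum>i\<in>UNIV. g s i x y * (\<Sum>r\<in>UNIV. metric_inv L i r x y * P r))
      = (\<Sum>r\<in>UNIV. \<Sum>i\<in>UNIV. (g s i x y * metric_inv L i r x y) * P r)"
    by (subst sum.swap) (simp add: sum_distrib_left mult_ac)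
  then show ?thesis by (simp add: sum_distrib_right[symmetric] metric_inv_right[OF p])
qed

lemma metric_inv_metric:
  assumes p: "(x, y) \<in> D"
  shows "(\<Sum>r\<in>UNIV. metric_inv L i r x y * (\<Sum>s\<in>UNIV. g r s x y * P s)) = P i"
proof -
  have "(\<Sum>r\<in>UNIV. metric_inv L i r x y * (\<Sum>s\<in>UNIV. g r s x y * P s))
      = (\<Sum>s\<in>UNIV. \<Sum>r\<in>UNIV. (metric_inv L i r x y * g r s x y) * P s)"
    by (subst sum.swap) (simp add: sum_distrib_left mult_ac)
  then show ?thesis by (simp add: sum_distrib_right[symmetric] metric_inv_left[OF p])
qed

section \<open>The spray and the nonlinear connection\<close>

lemma smooth_G [simp]: "tsmooth D (G i)"
  unfolding spray_G_def energy_fun by simp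

lemma smooth_N [simp]: "tsmooth D (N i j)"
  unfolding nonlinear_G_def by simp

lemma smooth_delta [simp]: "tsmooth D P \<Longrightarrow> tsmooth D (delta L k P)"
  unfolding delta_def by simp

lemma smooth_F [simp]: "tsmooth D (F i j k)"
  unfolding cartan_F_def by simp

text \<open>Multiplying the definition of G by the metric removes the inverse metric; the factor 2
  comes from the Hessian of E being 2 g.\<close>

lemma spray_lower:
  assumes p: "(x, y) \<in> D"
  shows "2 * (\<Sum>h\<in>UNIV. dy r (dy h E) x y * G h x y) = (\<Sum>j\<in>UNIV. y $ j * dx j (dy r E) x y) - dx r E x y"
proof -
  define R where "R r = (\<Sum>j\<in>UNIV. y $ j * dx j (dy r E) x y) - dx r E x y" for r
  have "G h x y = (\<Sum>r\<in>UNIV. metric_inv L h r x y * (1/4 * R r))" for h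
    by (simp add: spray_G_def energy_fun R_def dy_dx_commute p sum_distrib_left mult.left_commute)
  then have "(\<Sum>h\<in>UNIV. g r h x y * G h x y) = 1/4 * R r"
    by (simp only: metric_metric_inv[OF p])
  then show ?thesis
    by (simp add: metric_E R_def sum_distrib_left[symmetric] mult.assoc sum_divide_distrib[symmetric])
qed

lemma dx_euler_E:
  assumes p: "(x, y) \<in> D"
  shows "(\<Sum>k\<in>UNIV. y $ k * dx j (dy k E) x y) = 2 * dx j E x y"
proof -
  have "2 * dx j E x y = dx j (\<lambda>x y. 2 * E x y) x y"
    using p by (simp add: dx_mult dx_const)
  also have "\<dots> = dx j (\<lambda>x y. \<Sum>k\<in>UNIV. y $ k * dy k E x y) x y"
    by (rule dx_cong) (use p in \<open>auto simp: euler_E\<close>)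
  also have "\<dots> = (\<Sum>k\<in>UNIV. y $ k * dx j (dy k E) x y)"
    using p by (simp add: dx_sum dx_mult dx_y)
  finally show ?thesis by simp
qed

lemma dx_euler_E1:
  assumes p: "(x, y) \<in> D"
  shows "(\<Sum>k\<in>UNIV. y $ k * dx j (dy k (dy r E)) x y) = dx j (dy r E) x y"
proof -
  have "dx j (dy r E) x y = dx j (\<lambda>x y. \<Sum>k\<in>UNIV. y $ k * dy k (dy r E) x y) x y"
    by (rule dx_cong) (use p in \<open>auto simp: euler_E1 dy_commute[of E _ _ _ r]\<close>)
  also have "\<dots> = (\<Sum>k\<in>UNIV. y $ k * dx j (dy k (dy r E)) x y)"
    using p by (simp add: dx_sum dx_mult dx_y)
  finally show ?thesis by simp
qed

lemma dy3_commute: "(x, y) \<in> D \<Longrightarrow> tsmooth D P \<Longrightarrow> dy i (dy j (dy k P)) x y = dy i (dy k (dy j P)) x y"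
  by (rule dy_cong) (auto simp: dy_commute)

lemma dy_spray_lower:
  assumes p: "(x, y) \<in> D"
  shows "2 * (\<Sum>h\<in>UNIV. dy k (dy r (dy h E)) x y * G h x y) + 2 * (\<Sum>h\<in>UNIV. dy r (dy h E) x y * N h k x y)
       = dx k (dy r E) x y + (\<Sum>j\<in>UNIV. y $ j * dx j (dy k (dy r E)) x y) - dx r (dy k E) x y"
proof -
  have "2 * (\<Sum>h\<in>UNIV. dy k (dy r (dy h E)) x y * G h x y) + 2 * (\<Sum>h\<in>UNIV. dy r (dy h E) x y * N h k x y)
      = dy k (\<lambda>x y. 2 * (\<Sum>h\<in>UNIV. dy r (dy h E) x y * G h x y)) x y"
    using p by (simp add: dy_mult dy_sum dy_const sum.distrib nonlinear_G_def)
  also have "\<dots> = dy k (\<lambda>x y. (\<Sum>j\<in>UNIV. y $ j * dx j (dy r E) x y) - dx r E x y) x y"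
    by (rule dy_cong) (use p in \<open>auto simp: spray_lower\<close>)
  also have "\<dots> = dx k (dy r E) x y + (\<Sum>j\<in>UNIV. y $ j * dx j (dy k (dy r E)) x y) - dx r (dy k E) x y"
    using p by (simp add: dy_diff dy_sum dy_mult dy_y sum.distrib dy_dx_commute)
  finally show ?thesis .
qed

text \<open>Instead of showing that G is homogeneous of degree two, contract
  \<open>dy_spray_lower\<close> with y^k. The Euler relations for E remove the third derivatives and
  leave the linear system that \<open>spray_lower\<close> gives for G.\<close>

lemma euler_N:
  assumes p: "(x, y) \<in> D"
  shows "(\<Sum>k\<in>UNIV. N i k x y * y $ k) = 2 * G i x y"
proof (rule metric_cancel[OF p])
  fix r
  let ?S = "\<lambda>P. \<Sum>k\<in>UNIV. y $ k * P k"
  have 1: "?S (\<lambda>k. \<Sum>h\<in>UNIV. dy k (dy r (dy h E)) x y * G h x y) = 0"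
  proof -
    have "?S (\<lambda>k. \<Sum>h\<in>UNIV. dy k (dy r (dy h E)) x y * G h x y)
      = (\<Sum>h\<in>UNIV. (\<Sum>k\<in>UNIV. y $ k * dy r (dy h (dy k E)) x y) * G h x y)"
      unfolding sum_distrib_left sum_distrib_right
      by (subst sum.swap) (simp add: dy_commute[of "dy _ E" _ _ _ r] dy3_commute[OF p smooth_E, of r] p mult_ac)
    then show ?thesis by (simp add: euler_E2 p)
  qed
  have 2: "?S (\<lambda>k. \<Sum>j\<in>UNIV. y $ j * dx j (dy k (dy r E)) x y) = (\<Sum>j\<in>UNIV. y $ j * dx j (dy r E) x y)"
  proof -
    have "?S (\<lambda>k. \<Sum>j\<in>UNIV. y $ j * dx j (dy k (dy r E)) x y)
      = (\<Sum>j\<in>UNIV. y $ j * (\<Sum>k\<in>UNIV. y $ k * dx j (dy k (dy r E)) x y))"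
      unfolding sum_distrib_left by (subst sum.swap) (simp add: mult_ac)
    then show ?thesis by (simp add: dx_euler_E1 p)
  qed
  have "2 * ?S (\<lambda>k. \<Sum>h\<in>UNIV. dy k (dy r (dy h E)) x y * G h x y) + 2 * ?S (\<lambda>k. \<Sum>h\<in>UNIV. dy r (dy h E) x y * N h k x y)
      = ?S (\<lambda>k. 2 * (\<Sum>h\<in>UNIV. dy k (dy r (dy h E)) x y * G h x y) + 2 * (\<Sum>h\<in>UNIV. dy r (dy h E) x y * N h k x y))"
    by (simp add: algebra_simps sum.distrib sum_distrib_left)
  also have "\<dots> = ?S (\<lambda>k. dx k (dy r E) x y) + ?S (\<lambda>k. \<Sum>j\<in>UNIV. y $ j * dx j (dy k (dy r E)) x y)
      - ?S (\<lambda>k. dx r (dy k E) x y)"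
    unfolding dy_spray_lower[OF p] distrib_left right_diff_distrib sum.distrib sum_subtractf ..
  finally have "?S (\<lambda>k. \<Sum>h\<in>UNIV. dy r (dy h E) x y * N h k x y) = 2 * (\<Sum>h\<in>UNIV. dy r (dy h E) x y * G h x y)"
    unfolding 1 2 dx_euler_E[OF p] using spray_lower[OF p, of r] by simp
  moreover have "?S (\<lambda>k. \<Sum>h\<in>UNIV. dy r (dy h E) x y * N h k x y) = (\<Sum>h\<in>UNIV. dy r (dy h E) x y * (\<Sum>k\<in>UNIV. N h k x y * y $ k))"
    unfolding sum_distrib_left by (subst sum.swap) (simp add: mult_ac)
  ultimately show "(\<Sum>j\<in>UNIV. g r j x y * (\<Sum>k\<in>UNIV. N j k x y * y $ k)) = (\<Sum>j\<in>UNIV. g r j x y * (2 * G j x y))"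
    by (simp add: metric_E sum_divide_distrib[symmetric] sum_distrib_left mult_ac)
qed

section \<open>The Cartan connection coefficients\<close>

lemma cartan_F_lower:
  assumes p: "(x, y) \<in> D"
  shows "(\<Sum>i\<in>UNIV. g s i x y * F i j k x y)
    = 1/2 * (delta L k (g s j) x y + delta L j (g s k) x y - delta L s (g j k) x y)"
proof -
  define R where "R r = 1/2 * (delta L k (g r j) x y + delta L j (g r k) x y - delta L r (g j k) x y)" for r
  have "F i j k x y = (\<Sum>r\<in>UNIV. metric_inv L i r x y * R r)" for i
    by (simp add: cartan_F_def R_def sum_divide_distrib)
  then show ?thesis by (simp only: metric_metric_inv[OF p]) (simp add: R_def)
qed

lemma delta_metric_commute: "(x, y) \<in> D \<Longrightarrow> delta L k (g i j) x y = delta L k (g j i) x y"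
  by (rule delta_cong) (auto simp: metric_commute)

lemma cartan_F_commute: "(x, y) \<in> D \<Longrightarrow> F i j k x y = F i k j x y"
  by (simp add: cartan_F_def delta_metric_commute[of x y _ j k] add.commute[of "delta L k (g _ j) x y"])

text \<open>Metric compatibility, g_ij|k = 0: in the sum of the two lowered coefficients all terms
  but delta_k g_ij cancel by symmetry of g.\<close>

lemma delta_metric:
  assumes p: "(x, y) \<in> D"
  shows "delta L k (g i j) x y = (\<Sum>r\<in>UNIV. F r i k x y * g r j x y) + (\<Sum>r\<in>UNIV. F r j k x y * g i r x y)"
proof -
  have "(\<Sum>r\<in>UNIV. F r i k x y * g r j x y) = (\<Sum>r\<in>UNIV. g j r x y * F r i k x y)"
    by (simp add: metric_commute[OF p, of _ j] mult.commute)
  then show ?thesis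
    using cartan_F_lower[OF p, of j i k] cartan_F_lower[OF p, of i j k]
    by (simp add: mult.commute[of "F _ j k x y"] delta_metric_commute[OF p, of _ j i]
        delta_metric_commute[OF p, of _ k i] delta_metric_commute[OF p, of _ k j])
qed

text \<open>Apply delta_k to g_ij y^j = (1/2) dy_i E. The terms with N on the two sides, one from
  y^j and one from dy_i E, are equal.\<close>

lemma delta_metric_y:
  assumes p: "(x, y) \<in> D"
  shows "(\<Sum>j\<in>UNIV. delta L k (g i j) x y * y $ j) = 1/2 * dx k (dy i E) x y"
proof -
  have "(\<Sum>j\<in>UNIV. delta L k (g i j) x y * y $ j) - (\<Sum>j\<in>UNIV. g i j x y * N j k x y)
      = delta L k (\<lambda>x y. \<Sum>j\<in>UNIV. g i j x y * y $ j) x y"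
    using p by (simp add: delta_sum delta_mult delta_y sum_subtractf)
  also have "\<dots> = delta L k (\<lambda>x y. 1/2 * dy i E x y) x y"
    by (rule delta_cong) (use p in \<open>auto simp: metric_y\<close>)
  also have "\<dots> = 1/2 * delta L k (dy i E) x y"
    using p by (subst delta_mult) (auto simp: delta_const)
  also have "\<dots> = 1/2 * dx k (dy i E) x y - (\<Sum>j\<in>UNIV. g i j x y * N j k x y)"
    by (simp add: delta_def algebra_simps metric_E dy_commute[of E, OF _ p, of i] sum_distrib_left sum_divide_distrib)
  finally show ?thesis by simp
qed

text \<open>Here y is contracted with the index of the derivation, so \<open>euler_N\<close> turns
  the nonlinear connection into the spray.\<close>

lemma y_delta_metric:
  assumes p: "(x, y) \<in> D"
  shows "(\<Sum>j\<in>UNIV. delta L j (g s k) x y * y $ j)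
    = 1/2 * (\<Sum>j\<in>UNIV. y $ j * dx j (dy k (dy s E)) x y) - (\<Sum>h\<in>UNIV. dy k (dy s (dy h E)) x y * G h x y)"
proof -
  have "(\<Sum>j\<in>UNIV. delta L j (g s k) x y * y $ j)
      = (\<Sum>j\<in>UNIV. dx j (g s k) x y * y $ j) - (\<Sum>h\<in>UNIV. dy h (g s k) x y * (\<Sum>j\<in>UNIV. N h j x y * y $ j))"
    unfolding sum_distrib_left delta_def left_diff_distrib sum_subtractf sum_distrib_right
    by (subst (2) sum.swap) (simp add: mult_ac)
  moreover have "dx j (g s k) x y = 1/2 * dx j (dy k (dy s E)) x y" for j
    unfolding dx_metric[OF p] using p by (auto intro!: dx_cong simp: dy_commute[of E])
  moreover have "dy h (g s k) x y = 1/2 * dy k (dy s (dy h E)) x y" for h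
    unfolding dy_metric[OF p] dy3_commute[OF p smooth_E, of h s k] dy3_commute[OF p smooth_E, of k s h]
    using p by (simp add: dy_commute[of "dy s E" _ _ h k])
  ultimately show ?thesis
    unfolding euler_N[OF p] by (simp add: sum_distrib_left sum_divide_distrib mult_ac)
qed

text \<open>The deflection tensor of the Cartan connection vanishes. After lowering the index, the
  three contracted derivatives of g add up to \<open>dy_spray_lower\<close>.\<close>

lemma cartan_F_y:
  assumes p: "(x, y) \<in> D"
  shows "(\<Sum>j\<in>UNIV. F i j k x y * y $ j) = N i k x y"
proof (rule metric_cancel[OF p, where v="\<lambda>i. \<Sum>j\<in>UNIV. F i j k x y * y $ j" and w="\<lambda>i. N i k x y"])
  fix s
  have "(\<Sum>i\<in>UNIV. g s i x y * (\<Sum>j\<in>UNIV. F i j k x y * y $ j))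
      = (\<Sum>j\<in>UNIV. (\<Sum>i\<in>UNIV. g s i x y * F i j k x y) * y $ j)"
    unfolding sum_distrib_left sum_distrib_right by (subst sum.swap) (simp add: mult_ac)
  also have "\<dots> = 1/2 * ((\<Sum>j\<in>UNIV. delta L k (g s j) x y * y $ j) + (\<Sum>j\<in>UNIV. delta L j (g s k) x y * y $ j)
       - (\<Sum>j\<in>UNIV. delta L s (g k j) x y * y $ j))"
    by (simp add: cartan_F_lower[OF p] delta_metric_commute[OF p, of _ k] sum_distrib_left sum.distrib
        sum_subtractf algebra_simps sum_divide_distrib add_divide_distrib diff_divide_distrib)
  also have "\<dots> = 1/2 * (\<Sum>h\<in>UNIV. dy s (dy h E) x y * N h k x y)"
    unfolding delta_metric_y[OF p] y_delta_metric[OF p] using dy_spray_lower[OF p, of k s] by simp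
  also have "\<dots> = (\<Sum>i\<in>UNIV. g s i x y * N i k x y)"
    by (simp add: metric_E sum_divide_distrib)
  finally show "(\<Sum>i\<in>UNIV. g s i x y * (\<Sum>j\<in>UNIV. F i j k x y * y $ j)) = (\<Sum>i\<in>UNIV. g s i x y * N i k x y)" .
qed

text \<open>Contract metric compatibility with y^j; the covector (1/2) dy_i E is y with its index
  lowered.\<close>

lemma cartan_F_dy_E:
  assumes p: "(x, y) \<in> D"
  shows "delta L k (dy i E) x y = (\<Sum>r\<in>UNIV. F r i k x y * dy r E x y)"
proof -
  have "1/2 * dx k (dy i E) x y = (\<Sum>j\<in>UNIV. ((\<Sum>r\<in>UNIV. F r i k x y * g r j x y) + (\<Sum>r\<in>UNIV. F r j k x y * g i r x y)) * y $ j)"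
    unfolding delta_metric_y[OF p, symmetric] delta_metric[OF p] ..
  also have "\<dots> = (\<Sum>r\<in>UNIV. F r i k x y * (\<Sum>j\<in>UNIV. g r j x y * y $ j)) + (\<Sum>r\<in>UNIV. g i r x y * (\<Sum>j\<in>UNIV. F r j k x y * y $ j))"
    unfolding sum_distrib_left sum_distrib_right distrib_right sum.distrib
    by (subst (1 2) sum.swap) (simp add: mult_ac)
  also have "\<dots> = 1/2 * (\<Sum>r\<in>UNIV. F r i k x y * dy r E x y) + 1/2 * (\<Sum>h\<in>UNIV. N h k x y * dy h (dy i E) x y)"
    unfolding metric_y[OF p] cartan_F_y[OF p]
    by (simp add: metric_E dy_commute[of E, OF _ p, of i] sum_divide_distrib sum_distrib_left mult_ac)
  finally show ?thesis by (simp add: delta_def)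
qed

text \<open>Apply delta_k to Euler's relation for E. The contribution of dy_i E and that of y^i
  cancel because the deflection vanishes.\<close>

lemma delta_E:
  assumes p: "(x, y) \<in> D"
  shows "delta L k E x y = 0"
proof -
  have "2 * delta L k E x y = delta L k (\<lambda>x y. 2 * E x y) x y"
    using p by (simp add: delta_mult delta_const)
  also have "\<dots> = delta L k (\<lambda>x y. \<Sum>i\<in>UNIV. dy i E x y * y $ i) x y"
    by (rule delta_cong) (use p euler_E in \<open>auto simp: mult.commute\<close>)
  also have "\<dots> = (\<Sum>i\<in>UNIV. (\<Sum>r\<in>UNIV. F r i k x y * dy r E x y) * y $ i) - (\<Sum>i\<in>UNIV. dy i E x y * N i k x y)"
    using p by (simp add: delta_sum delta_mult delta_y cartan_F_dy_E sum_subtractf)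
  also have "(\<Sum>i\<in>UNIV. (\<Sum>r\<in>UNIV. F r i k x y * dy r E x y) * y $ i) = (\<Sum>r\<in>UNIV. dy r E x y * (\<Sum>i\<in>UNIV. F r i k x y * y $ i))"
    unfolding sum_distrib_left sum_distrib_right by (subst sum.swap) (simp add: mult_ac)
  finally show ?thesis by (simp add: cartan_F_y[OF p])
qed

lemma delta_L:
  assumes p: "(x, y) \<in> D"
  shows "delta L k L x y = 0"
proof -
  have "2 * L x y * delta L k L x y = delta L k E x y"
    unfolding energy_fun[symmetric] using p by (simp add: delta_power2)
  then show ?thesis using delta_E[OF p] L_nonzero[OF p] by simp
qed

lemma delta_dy_L:
  assumes p: "(x, y) \<in> D"
  shows "delta L k (dy i L) x y = (\<Sum>r\<in>UNIV. F r i k x y * dy r L x y)"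
proof -
  have "delta L k (dy i E) x y = delta L k (\<lambda>x y. 2 * L x y * dy i L x y) x y"
    by (rule delta_cong) (use p dy_E in auto)
  also have "\<dots> = 2 * L x y * delta L k (dy i L) x y"
    using p by (simp add: delta_mult delta_const delta_L)
  finally have "2 * L x y * delta L k (dy i L) x y = 2 * L x y * (\<Sum>r\<in>UNIV. F r i k x y * dy r L x y)"
    by (simp add: cartan_F_dy_E p dy_E sum_distrib_left mult_ac)
  then show ?thesis using L_nonzero[OF p] by simp
qed

lemma metric_split:
  assumes p: "(x, y) \<in> D"
  shows "g i j x y = dy i L x y * dy j L x y + L x y * dy i (dy j L) x y"
proof -
  have "dy i (dy j E) x y = dy i (\<lambda>x y. 2 * L x y * dy j L x y) x y"
    by (rule dy_cong) (use p dy_E in auto)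
  then show ?thesis using p by (simp add: metric_E dy_mult dy_const)
qed

text \<open>This is the uniqueness of the Barthel connection.\<close>

lemma spray_unique:
  assumes P: "\<And>i. tsmooth D (P i)"
    and horizontal: "\<And>x y k. (x, y) \<in> D \<Longrightarrow> dx k E x y = (\<Sum>h\<in>UNIV. dy k (P h) x y * dy h E x y)"
    and euler: "\<And>x y i. (x, y) \<in> D \<Longrightarrow> (\<Sum>k\<in>UNIV. dy k (P i) x y * y $ k) = 2 * P i x y"
    and p: "(x, y) \<in> D"
  shows "G i x y = P i x y"
proof (rule metric_cancel[OF p])
  fix r
  have 1: "(\<Sum>j\<in>UNIV. y $ j * dx j E x y) = (\<Sum>h\<in>UNIV. 2 * P h x y * dy h E x y)" if "(x, y) \<in> D" for x y
  proof -
    have "(\<Sum>j\<in>UNIV. y $ j * dx j E x y) = (\<Sum>h\<in>UNIV. (\<Sum>j\<in>UNIV. dy j (P h) x y * y $ j) * dy h E x y)"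
      unfolding horizontal[OF that] sum_distrib_left sum_distrib_right
      by (subst sum.swap) (simp add: mult_ac)
    then show ?thesis unfolding euler[OF that] .
  qed
  \<comment> \<open>Differentiate \<open>1\<close> in y^r. The terms in which P is differentiated
    recombine to 2 dx r E by \<open>horizontal\<close>, and what remains is the system that
    \<open>spray_lower\<close> gives for G.\<close>
  have "dx r E x y + (\<Sum>j\<in>UNIV. y $ j * dx j (dy r E) x y) = dy r (\<lambda>x y. \<Sum>j\<in>UNIV. y $ j * dx j E x y) x y"
    using p by (simp add: dy_sum dy_mult dy_y dy_dx_commute sum.distrib)
  also have "\<dots> = dy r (\<lambda>x y. \<Sum>h\<in>UNIV. 2 * P h x y * dy h E x y) x y"
    by (rule dy_cong) (use p 1 in auto)
  also have "\<dots> = 2 * dx r E x y + (\<Sum>h\<in>UNIV. 2 * P h x y * dy r (dy h E) x y)"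
    using p P by (simp add: dy_sum dy_mult dy_const sum.distrib horizontal sum_distrib_left mult.assoc)
  finally have "(\<Sum>h\<in>UNIV. dy r (dy h E) x y * G h x y) = (\<Sum>h\<in>UNIV. dy r (dy h E) x y * P h x y)"
    using spray_lower[OF p, of r] by (simp add: sum_distrib_left[symmetric] mult_ac)
  then show "(\<Sum>j\<in>UNIV. g r j x y * G j x y) = (\<Sum>j\<in>UNIV. g r j x y * P j x y)"
    by (simp add: metric_E sum_divide_distrib[symmetric])
qed

text \<open>Christoffel's argument: a symmetric Q for which g is parallel is determined by the
  combination in \<open>cartan_F_lower\<close>. It is a statement at one point, since the nonlinear
  connection in \<open>delta\<close> is already fixed.\<close>

lemma cartan_F_unique:
  assumes p: "(x, y) \<in> D" and sym: "\<And>i j k. Q i j k = Q i k j"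
    and parallel: "\<And>i j k. delta L k (g i j) x y = (\<Sum>r\<in>UNIV. Q r i k * g r j x y) + (\<Sum>r\<in>UNIV. Q r j k * g i r x y)"
  shows "F i j k x y = Q i j k"
proof (rule metric_cancel[OF p, where v="\<lambda>i. F i j k x y" and w="\<lambda>i. Q i j k"])
  fix s
  have c: "(\<Sum>r\<in>UNIV. Q r a c * g r d x y) = (\<Sum>r\<in>UNIV. g d r x y * Q r a c)" for a c d
    by (simp add: metric_commute[OF p, of _ d] mult.commute)
  have d: "(\<Sum>r\<in>UNIV. Q r a c * g d r x y) = (\<Sum>r\<in>UNIV. g d r x y * Q r a c)" for a c d
    by (simp add: mult.commute)
  show "(\<Sum>i\<in>UNIV. g s i x y * F i j k x y) = (\<Sum>i\<in>UNIV. g s i x y * Q i j k)"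
    unfolding cartan_F_lower[OF p] parallel c d sym[of _ s] sym[of _ k j] by simp
qed

end

section \<open>Parallel h-vectors\<close>

text \<open>This dimension count is the source of the hypothesis n \<ge> 3 in the results on
  \<rho>.\<close>

lemma exists_orthogonal_to_two:
  fixes r s :: "real ^ 'n::finite"
  assumes "CARD('n) \<ge> 3"
  obtains w where "w \<noteq> 0" "r \<bullet> w = 0" "s \<bullet> w = 0"
proof -
  have "dim {r, s} \<le> 2"
    by (rule order_trans[OF dim_le_card'])  (auto simp: card_insert_if)
  then have "dim {r, s} < DIM(real ^ 'n)" using assms by simp
  from orthogonal_to_subspace_exists[OF this] obtain w where
    "w \<noteq> 0" "\<And>z. z \<in> span {r, s} \<Longrightarrow> orthogonal w z" by blast
  then show ?thesis
    by (intro that[of w]) (auto simp: orthogonal_def inner_commute span_base)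
qed

text \<open>The function \<open>beta\<close> with the chart fixed.\<close>

definition pairing :: "(real ^ 'n \<Rightarrow> real ^ 'n \<Rightarrow> real ^ 'n) \<Rightarrow> 'n::finite tfun" where
  "pairing b x y = (\<Sum>i\<in>UNIV. b x y $ i * y $ i)"

text \<open>On the kernel of l_i the metric reduces to L times the Hessian of L, which is therefore
  definite there.\<close>

lemma (in finsler_chart) metric_orthogonal:
  assumes p: "(x, y) \<in> D" and w: "w \<noteq> 0" "(\<Sum>i\<in>UNIV. dy i L x y * w $ i) = 0"
  shows "(\<Sum>i\<in>UNIV. \<Sum>j\<in>UNIV. dy i (dy j L) x y * w $ i * w $ j) \<noteq> 0"
proof
  assume z: "(\<Sum>i\<in>UNIV. \<Sum>j\<in>UNIV. dy i (dy j L) x y * w $ i * w $ j) = 0"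
  have "(\<Sum>i\<in>UNIV. \<Sum>j\<in>UNIV. g i j x y * w $ i * w $ j)
      = (\<Sum>i\<in>UNIV. dy i L x y * w $ i) * (\<Sum>j\<in>UNIV. dy j L x y * w $ j)
        + L x y * (\<Sum>i\<in>UNIV. \<Sum>j\<in>UNIV. dy i (dy j L) x y * w $ i * w $ j)"
    unfolding metric_split[OF p] sum_product unfolding sum_distrib_left sum.distrib[symmetric]
    by (intro sum.cong refl) (simp add: algebra_simps)
  then show False using metric_pos[OF p w(1)] z w(2) by simp
qed

text \<open>A nonzero r would force the Hessian of L to have rank at most one. To exclude this,
  contract twice with a vector w killed by r and by l_i: the Hessian is nonzero on w.\<close>

lemma (in finsler_chart) hessian_rank:
  assumes n: "CARD('n) \<ge> 3" and p: "(x, y) \<in> D"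
    and r: "\<And>i j k. r k * dy i (dy j L) x y = r j * dy i (dy k L) x y"
  shows "r i = 0"
proof -
  obtain w where w: "w \<noteq> 0" "(\<chi> i. r i) \<bullet> w = 0" "(\<chi> i. dy i L x y) \<bullet> w = 0"
    using exists_orthogonal_to_two[OF n] by blast
  have "(\<Sum>k\<in>UNIV. dy i (dy k L) x y * w $ k) * r j = (\<Sum>k\<in>UNIV. r k * w $ k) * dy i (dy j L) x y" for i j
    unfolding sum_distrib_right by (rule sum.cong) (use r[of _ i j] in \<open>auto simp: mult_ac\<close>)
  then have z: "(\<Sum>k\<in>UNIV. dy i (dy k L) x y * w $ k) * r j = 0" for i j
    using w(2) by (simp add: inner_vec_def)
  have "(\<Sum>i\<in>UNIV. \<Sum>k\<in>UNIV. dy i (dy k L) x y * w $ i * w $ k) * r j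
      = (\<Sum>i\<in>UNIV. w $ i * ((\<Sum>k\<in>UNIV. dy i (dy k L) x y * w $ k) * r j))" for j
    by (simp add: sum_distrib_right sum_distrib_left mult_ac)
  then show ?thesis
    using metric_orthogonal[OF p w(1)] w(3) by (simp add: z inner_vec_def)
qed

lemma (in finsler_chart) hessian_nonzero:
  assumes n: "CARD('n) \<ge> 2" and p: "(x, y) \<in> D"
  obtains i j where "dy i (dy j L) x y \<noteq> 0"
proof -
  have "dim {\<chi> i. dy i L x y} < DIM(real ^ 'n)"
    using n dim_le_card'[of "{\<chi> i. dy i L x y}"] by simp
  from orthogonal_to_subspace_exists[OF this] obtain w where
    w: "w \<noteq> 0" "\<And>z. z \<in> span {\<chi> i. dy i L x y} \<Longrightarrow> orthogonal w z" by blast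
  have "(\<Sum>i\<in>UNIV. dy i L x y * w $ i) = 0"
    using w(2)[of "\<chi> i. dy i L x y"] by (simp add: span_base orthogonal_def inner_vec_def mult.commute)
  from metric_orthogonal[OF p w(1) this] show ?thesis
    using that by (metis (no_types, lifting) mult_zero_left sum.neutral)
qed

text \<open>Nothing is assumed about the regularity of \<rho>; \<open>smooth_\<rho>\<close> derives
  it.\<close>

locale parallel_h_vector = finsler_chart D L
  for D :: "((real ^ 'n::finite) \<times> (real ^ 'n)) set" and L +
  fixes b :: "real ^ 'n \<Rightarrow> real ^ 'n \<Rightarrow> real ^ 'n" and \<rho> :: "'n tfun"
  assumes smooth_b [simp]: "tsmooth D (\<lambda>x y. b x y $ i)"
    and v_parallel: "(x, y) \<in> D \<Longrightarrow> v_cov L b i k x y = 0"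
    and \<rho>_nonzero: "(x, y) \<in> D \<Longrightarrow> \<rho> x y \<noteq> 0"
    and h_vector: "(x, y) \<in> D \<Longrightarrow>
      L x y * (\<Sum>h\<in>UNIV. cartan_C_up L h i j x y * b x y $ h) = \<rho> x y * angular_metric L i j x y"
    and h_parallel: "(x, y) \<in> D \<Longrightarrow> h_cov L b i j x y = 0"
begin

abbreviation "\<beta> \<equiv> pairing b"

lemma smooth_\<beta> [simp]: "tsmooth D \<beta>"
  unfolding pairing_def by simp

lemma C_up_b: "(x, y) \<in> D \<Longrightarrow> (\<Sum>h\<in>UNIV. cartan_C_up L h i j x y * b x y $ h) = \<rho> x y * dy i (dy j L) x y"
  using h_vector[of x y i j] L_nonzero[of x y] by (simp add: angular_metric_def)

lemma dy_b: "(x, y) \<in> D \<Longrightarrow> dy j (\<lambda>x y. b x y $ i) x y = \<rho> x y * dy i (dy j L) x y"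
  using v_parallel[of x y i j] by (simp add: v_cov_def C_up_b)

lemma delta_b: "(x, y) \<in> D \<Longrightarrow> delta L j (\<lambda>x y. b x y $ i) x y = (\<Sum>r\<in>UNIV. F r i j x y * b x y $ r)"
  using h_parallel[of x y i j] by (simp add: h_cov_def delta_def mult.commute)

text \<open>The y-derivative of b is \<rho> times the Hessian of L, which y annihilates, so only the
  derivative of y^i contributes.\<close>

lemma dy_\<beta>:
  assumes p: "(x, y) \<in> D"
  shows "dy i \<beta> x y = b x y $ i"
proof -
  have "dy i \<beta> x y = dy i (\<lambda>x y. \<Sum>j\<in>UNIV. b x y $ j * y $ j) x y"
    by (simp add: pairing_def[abs_def])
  also have "\<dots> = (\<Sum>j\<in>UNIV. \<rho> x y * dy j (dy i L) x y * y $ j) + b x y $ i"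
    using p by (simp add: dy_sum dy_mult dy_y dy_b sum.distrib)
  also have "(\<Sum>j\<in>UNIV. \<rho> x y * dy j (dy i L) x y * y $ j) = \<rho> x y * (\<Sum>j\<in>UNIV. y $ j * dy i (dy j L) x y)"
    using p by (simp add: sum_distrib_left dy_commute[of L x y i] mult_ac)
  finally show ?thesis by (simp add: euler_L1 p)
qed

lemma delta_\<beta>:
  assumes p: "(x, y) \<in> D"
  shows "delta L k \<beta> x y = 0"
proof -
  have "delta L k \<beta> x y = delta L k (\<lambda>x y. \<Sum>j\<in>UNIV. b x y $ j * y $ j) x y"
    by (simp add: pairing_def[abs_def])
  also have "\<dots> = (\<Sum>j\<in>UNIV. (\<Sum>r\<in>UNIV. F r j k x y * b x y $ r) * y $ j) - (\<Sum>j\<in>UNIV. b x y $ j * N j k x y)"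
    using p by (simp add: delta_sum delta_mult delta_y delta_b sum_subtractf)
  also have "(\<Sum>j\<in>UNIV. (\<Sum>r\<in>UNIV. F r j k x y * b x y $ r) * y $ j)
      = (\<Sum>r\<in>UNIV. b x y $ r * (\<Sum>j\<in>UNIV. F r j k x y * y $ j))"
    unfolding sum_distrib_left sum_distrib_right by (subst sum.swap) (simp add: mult_ac)
  finally show ?thesis by (simp add: cartan_F_y[OF p])
qed

lemma b_nonzero:
  assumes n: "CARD('n) \<ge> 2" and p: "(x, y) \<in> D"
  shows "b x y \<noteq> 0"
proof
  assume "b x y = 0"
  then have "\<rho> x y * dy i (dy j L) x y = 0" for i j
    using C_up_b[OF p, of i j] by simp
  then show False using hessian_nonzero[OF n p] \<rho>_nonzero[OF p] by (metis mult_eq_0_iff)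
qed

text \<open>Contracting \<open>dy_b\<close> with the Hessian of L recovers \<rho> as a quotient
  whose denominator is the sum of the squared entries of the Hessian, nonzero for n \<ge> 2.\<close>

lemma smooth_\<rho>:
  assumes n: "CARD('n) \<ge> 2"
  shows "tsmooth D \<rho>"
proof -
  let ?S = "\<lambda>x y. \<Sum>i\<in>UNIV. \<Sum>j\<in>UNIV. (dy i (dy j L) x y)\<^sup>2"
  have nz: "?S x y \<noteq> 0" if "(x, y) \<in> D" for x y
  proof -
    obtain i j where "dy i (dy j L) x y \<noteq> 0" using hessian_nonzero[OF n \<open>(x, y) \<in> D\<close>] .
    then show ?thesis by (auto simp: sum_nonneg_eq_0_iff sum_nonneg)
  qed
  have "tsmooth D (\<lambda>x y. (\<Sum>i\<in>UNIV. \<Sum>j\<in>UNIV. dy j (\<lambda>x y. b x y $ i) x y * dy i (dy j L) x y) / ?S x y)"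
    using nz by (intro tsmooth_divide) simp_all
  then show ?thesis
  proof (rule tsmooth_cong)
    fix x y assume p: "(x, y) \<in> D"
    have "(\<Sum>i\<in>UNIV. \<Sum>j\<in>UNIV. dy j (\<lambda>x y. b x y $ i) x y * dy i (dy j L) x y) = \<rho> x y * ?S x y"
      by (simp add: dy_b p sum_distrib_left power2_eq_square mult_ac)
    then show "(\<Sum>i\<in>UNIV. \<Sum>j\<in>UNIV. dy j (\<lambda>x y. b x y $ i) x y * dy i (dy j L) x y) / ?S x y = \<rho> x y"
      using nz[OF p] by simp
  qed
qed

section \<open>Vanishing derivatives of \<rho> for n \<ge> 3\<close>

context
  assumes n: "CARD('n) \<ge> 3"
begin

lemma smooth_\<rho>' [simp]: "tsmooth D \<rho>"
  using smooth_\<rho> n by simp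

text \<open>Second y-derivatives of b_i commute and third y-derivatives of L are symmetric. What is
  left of \<open>dy_b\<close> differentiated once more is the hypothesis of
  \<open>hessian_rank\<close> for the gradient of \<rho>.\<close>

lemma dy_\<rho>:
  assumes p: "(x, y) \<in> D"
  shows "dy k \<rho> x y = 0"
proof (rule hessian_rank[OF n p])
  fix i j k
  have 1: "dy k (dy j (\<lambda>x y. b x y $ i)) x y = dy k \<rho> x y * dy i (dy j L) x y + \<rho> x y * dy k (dy i (dy j L)) x y" for j k
  proof -
    have "dy k (dy j (\<lambda>x y. b x y $ i)) x y = dy k (\<lambda>x y. \<rho> x y * dy i (dy j L) x y) x y"
      by (rule dy_cong) (use p dy_b in auto)
    then show ?thesis using p by (simp add: dy_mult)
  qed
  have "dy k (dy i (dy j L)) x y = dy j (dy i (dy k L)) x y"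
    unfolding dy3_commute[OF p smooth_L, of k i j] dy3_commute[OF p smooth_L, of j i k]
    using p by (simp add: dy_commute[of "dy i L"])
  moreover have "dy k (dy j (\<lambda>x y. b x y $ i)) x y = dy j (dy k (\<lambda>x y. b x y $ i)) x y"
    using p by (simp add: dy_commute)
  ultimately show "dy k \<rho> x y * dy i (dy j L) x y = dy j \<rho> x y * dy i (dy k L) x y"
    unfolding 1 by simp
qed

text \<open>Since \<open>\<rho>\<close> does not depend on \<open>y\<close>, neither does \<open>a\<^sub>i = b\<^sub>i - \<rho> l\<^sub>i\<close>. As \<open>b\<close> is parallel, the
  exterior derivative of \<open>a\<close> is \<open>\<rho>\<^sub>i l\<^sub>j - \<rho>\<^sub>j l\<^sub>i\<close>, and differentiating this in \<open>y\<close> gives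
  \<open>\<rho>\<^sub>i h\<^sub>k\<^sub>j = \<rho>\<^sub>j h\<^sub>k\<^sub>i\<close>.\<close>

lemma dx_\<rho>:
  assumes p: "(x, y) \<in> D"
  shows "dx k \<rho> x y = 0"
proof (rule hessian_rank[OF n p])
  fix k i j
  define a where "a i = (\<lambda>x y. b x y $ i - \<rho> x y * dy i L x y)" for i
  have a_smooth: "tsmooth D (a i)" for i unfolding a_def by simp
  have a_y: "dy k (a i) x y = 0" if "(x, y) \<in> D" for i k x y
    unfolding a_def using that
    by (simp add: dy_diff dy_mult dy_b dy_\<rho> dy_commute[of L x y i])
  have a_x: "dx j (a i) x y - dx i (a j) x y = dx i \<rho> x y * dy j L x y - dx j \<rho> x y * dy i L x y"
    if "(x, y) \<in> D" for i j x y
  proof -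
    have "dx j (a i) x y = (\<Sum>r\<in>UNIV. F r i j x y * a r x y) - dx j \<rho> x y * dy i L x y" for i j
    proof -
      have "dx j (a i) x y = delta L j (a i) x y"
        using that by (simp add: delta_def a_y)
      also have "\<dots> = delta L j (\<lambda>x y. b x y $ i) x y - (delta L j \<rho> x y * dy i L x y + \<rho> x y * delta L j (dy i L) x y)"
        unfolding a_def using that by (simp add: delta_diff delta_mult)
      also have "\<dots> = (\<Sum>r\<in>UNIV. F r i j x y * a r x y) - dx j \<rho> x y * dy i L x y"
        unfolding delta_b[OF that] delta_dy_L[OF that]
        by (simp add: a_def delta_def[of _ _ \<rho>] dy_\<rho> that right_diff_distrib sum_subtractf sum_distrib_left mult_ac)
      finally show ?thesis .
    qed
    \<comment> \<open>Antisymmetrizing removes the connection term, because F is symmetric in its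
      lower indices.\<close>
    then show ?thesis by (simp add: cartan_F_commute[OF that, of _ i])
  qed
  have dy_dx_0: "dy k (dx j P) x y = 0" if P: "tsmooth D P" and z: "\<And>x y. (x, y) \<in> D \<Longrightarrow> dy k P x y = 0" for P k j
  proof -
    have "dy k (dx j P) x y = dx j (\<lambda>x y. 0) x y"
      unfolding dy_dx_commute[OF P p] by (rule dx_cong) (use P z p in auto)
    then show ?thesis by (simp add: dx_const)
  qed
  have "dy i (\<lambda>x y. dx k (a j) x y - dx j (a k) x y) x y = dy i (\<lambda>x y. dx j \<rho> x y * dy k L x y - dx k \<rho> x y * dy j L x y) x y"
    by (rule dy_cong) (use a_smooth a_x p in auto)
  then have "0 = dx j \<rho> x y * dy i (dy k L) x y - dx k \<rho> x y * dy i (dy j L) x y"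
    using p a_smooth by (simp add: dy_diff dy_mult dy_dx_0 a_y dy_\<rho>)
  then show "dx k \<rho> x y * dy i (dy j L) x y = dx j \<rho> x y * dy i (dy k L) x y" by simp
qed

lemma delta_\<rho>: "(x, y) \<in> D \<Longrightarrow> delta L k \<rho> x y = 0"
  by (simp add: delta_def dx_\<rho> dy_\<rho>)

end

end

lemma tsmooth_subset: "tsmooth S P \<Longrightarrow> T \<subseteq> S \<Longrightarrow> tsmooth T P"
  by (simp add: tsmooth_def smooth_on_subset)

context tangent_domain begin

lemma dd_power_zero:
  assumes "tsmooth D P" "(x, y) \<in> D" "dd w P x y = 0"
  shows "dd w (\<lambda>x y. P x y ^ k) x y = 0"
  using assms by (induction k) (simp_all add: dd_const dd_mult)

lemma dd_divide_zero:
  assumes "tsmooth D P" "tsmooth D Q" "(x, y) \<in> D" "\<And>x y. (x, y) \<in> D \<Longrightarrow> Q x y \<noteq> 0"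
    and "dd w P x y = 0" "dd w Q x y = 0"
  shows "dd w (\<lambda>x y. P x y / Q x y) x y = 0"
  using assms by (simp add: dd_divide)

lemma dd_vertical:
  assumes "tsmooth D P" "(x, y) \<in> D"
  shows "dd (0, n) P x y = (\<Sum>k\<in>UNIV. dy k P x y * n $ k)"
proof -
  have n: "(0 :: real ^ 'n, n) = (\<Sum>k\<in>UNIV. (n $ k) *\<^sub>R (0, axis k 1))"
    using basis_expansion[of n] by (simp add: prod_eq_iff fst_sum snd_sum scalar_mult_eq_scaleR)
  show ?thesis
    unfolding n linear_sum[OF linear_dd[OF assms]] linear_cmul[OF linear_dd[OF assms]]
    using assms by (simp add: dy_dd mult.commute)
qed

end

section \<open>The Kropina change\<close>

text \<open>Both spaces are instances of the same locale; facts about the changed one carry the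
  prefix \<open>K\<close>. D' and L' are parameters tied down by equations so that this second
  instance can be imported.\<close>

locale kropina_chart = parallel_h_vector D L b \<rho> + K: finsler_chart D' L'
  for D :: "((real ^ 'n::finite) \<times> (real ^ 'n)) set" and L b \<rho>
    and D' :: "((real ^ 'n) \<times> (real ^ 'n)) set" and L' +
  assumes D'_def: "D' = {(x, y) \<in> D. pairing b x y \<noteq> 0}"
    and L'_def: "L' = (\<lambda>x y. (L x y)\<^sup>2 / pairing b x y)"
begin

lemma D'_subset: "D' \<subseteq> D"
  by (auto simp: D'_def)

lemma in_D [simp]: "(x, y) \<in> D' \<Longrightarrow> (x, y) \<in> D"
  using D'_subset by blast

lemma \<beta>_nonzero [simp]: "(x, y) \<in> D' \<Longrightarrow> \<beta> x y \<noteq> 0"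
  by (auto simp: D'_def simp del: in_D)

lemma smooth_D' [simp]:
  "tsmooth D' L" "tsmooth D' \<beta>" "tsmooth D' (dy i L)" "tsmooth D' (dy i (dy j L))"
  "tsmooth D' (\<lambda>x y. b x y $ i)" "tsmooth D' (g i j)"
  by (simp_all add: tsmooth_subset[OF _ D'_subset])

lemma dy_L':
  assumes p: "(x, y) \<in> D'"
  shows "dy i L' x y = 2 * L x y * dy i L x y / \<beta> x y - (L x y)\<^sup>2 * b x y $ i / (\<beta> x y)\<^sup>2"
proof -
  have "dy i L' x y = (2 * L x y * dy i L x y * \<beta> x y - (L x y)\<^sup>2 * b x y $ i) / (\<beta> x y)\<^sup>2"
    unfolding L'_def using p by (simp add: K.dy_divide K.dy_power2 dy_\<beta>)
  then show ?thesis using \<beta>_nonzero[OF p] by (simp add: field_simps power2_eq_square)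
qed

text \<open>The coefficients of g_ij, l_i l_j, l_i b_j + b_i l_j and b_i b_j in the new metric.
  Rewriting the Hessian of L through g moves the \<rho> term into the first two, with opposite
  signs.\<close>

definition metric_coeff :: "'n tfun" where
  "metric_coeff x y = 2 * (L x y)^2 / (\<beta> x y)^2 - \<rho> x y * (L x y)^3 / (\<beta> x y)^3"

definition ll_coeff :: "'n tfun" where
  "ll_coeff x y = 4 * (L x y)^2 / (\<beta> x y)^2 + \<rho> x y * (L x y)^3 / (\<beta> x y)^3"

definition lb_coeff :: "'n tfun" where
  "lb_coeff x y = -4 * (L x y)^3 / (\<beta> x y)^3"

definition bb_coeff :: "'n tfun" where
  "bb_coeff x y = 3 * (L x y)^4 / (\<beta> x y)^4"

lemma metric_L':
  assumes p: "(x, y) \<in> D'"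
  shows "metric L' i j x y = metric_coeff x y * g i j x y + ll_coeff x y * (dy i L x y * dy j L x y)
    + lb_coeff x y * (dy i L x y * b x y $ j + b x y $ i * dy j L x y) + bb_coeff x y * (b x y $ i * b x y $ j)"
proof -
  let ?\<beta> = "\<beta> x y" and ?L = "L x y" and ?a = "dy i L x y" and ?c = "dy j L x y" and ?h = "dy i (dy j L) x y"
    and ?p = "b x y $ i" and ?q = "b x y $ j" and ?r = "\<rho> x y"
  have nz: "?\<beta> \<noteq> 0" using p by simp
  have "dy i (dy j L') x y = dy i (\<lambda>x y. 2 * L x y * dy j L x y / \<beta> x y - (L x y)\<^sup>2 * b x y $ j / (\<beta> x y)\<^sup>2) x y"
    by (rule K.dy_cong) (use p dy_L' in auto)
  also have "\<dots> = ((2 * ?a * ?c + 2 * ?L * ?h) * ?\<beta> - 2 * ?L * ?c * ?p) / ?\<beta>^2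
      - ((2 * ?L * ?a * ?q + ?L^2 * (?r * ?h)) * ?\<beta>^2 - ?L^2 * ?q * (2 * ?\<beta> * ?p)) / (?\<beta>^2)^2"
    using p by (simp add: K.dy_diff K.dy_divide K.dy_mult K.dy_power2 K.dy_const dy_\<beta> dy_b dy_commute[of L _ _ j i])
  also have "\<dots> = (2 * ?a * ?c + 2 * ?L * ?h) / ?\<beta> - 2 * ?L * (?a * ?q + ?c * ?p) / ?\<beta>^2
      - ?L^2 * ?r * ?h / ?\<beta>^2 + 2 * ?L^2 * ?p * ?q / ?\<beta>^3"
    using nz by (simp add: field_simps power2_eq_square power3_eq_cube)
  finally have h: "dy i (dy j L') x y = \<dots>" .
  \<comment> \<open>In terms of t = 1/\<beta> the identity becomes polynomial.\<close>
  define t where "t = inverse ?\<beta>"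
  have "metric L' i j x y = (2 * ?L * ?a * t - ?L^2 * ?p * t^2) * (2 * ?L * ?c * t - ?L^2 * ?q * t^2)
    + ?L^2 * t * ((2 * ?a * ?c + 2 * ?L * ?h) * t - 2 * ?L * (?a * ?q + ?c * ?p) * t^2
      - ?L^2 * ?r * ?h * t^2 + 2 * ?L^2 * ?p * ?q * t^3)"
    unfolding K.metric_split[OF p] h dy_L'[OF p] by (simp add: L'_def t_def divide_inverse power_inverse)
  also have "\<dots> = (2 * ?L^2 * t^2 - ?r * ?L^3 * t^3) * (?a * ?c + ?L * ?h) + (4 * ?L^2 * t^2 + ?r * ?L^3 * t^3) * (?a * ?c)
    + (-4 * ?L^3 * t^3) * (?a * ?q + ?p * ?c) + (3 * ?L^4 * t^4) * (?p * ?q)"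
    by (simp add: algebra_simps power2_eq_square power3_eq_cube power4_eq_xxxx)
  finally show ?thesis
    unfolding metric_split[OF in_D[OF p]] metric_coeff_def ll_coeff_def lb_coeff_def bb_coeff_def
    by (simp add: t_def divide_inverse power_inverse)
qed

text \<open>On vectors killed by l and b only the conformal term of \<open>metric_L'\<close>
  survives, so the two normal directions agree.\<close>

lemma metric_L'_normal:
  assumes p: "(x, y) \<in> D'" and n: "(\<Sum>j\<in>UNIV. dy j L x y * n j) = 0" "(\<Sum>j\<in>UNIV. b x y $ j * n j) = 0"
  shows "(\<Sum>j\<in>UNIV. metric L' i j x y * n j) = metric_coeff x y * (\<Sum>j\<in>UNIV. g i j x y * n j)"
proof -
  have "(\<Sum>j\<in>UNIV. metric L' i j x y * n j) = metric_coeff x y * (\<Sum>j\<in>UNIV. g i j x y * n j)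
    + (ll_coeff x y * dy i L x y + lb_coeff x y * b x y $ i) * (\<Sum>j\<in>UNIV. dy j L x y * n j)
    + (lb_coeff x y * dy i L x y + bb_coeff x y * b x y $ i) * (\<Sum>j\<in>UNIV. b x y $ j * n j)"
    unfolding metric_L'[OF p] sum_distrib_left sum.distrib[symmetric]
    by (rule sum.cong) (simp_all add: algebra_simps)
  then show ?thesis by (simp add: n)
qed

section \<open>Connection and Cartan tensor of the changed metric\<close>

context
  assumes n: "CARD('n) \<ge> 3"
begin

lemma smooth_\<rho>_D' [simp]: "tsmooth D' \<rho>"
  by (rule tsmooth_subset[OF smooth_\<rho>'[OF n] D'_subset])

lemma smooth_coeff [simp]:
  "tsmooth D' metric_coeff" "tsmooth D' ll_coeff" "tsmooth D' lb_coeff" "tsmooth D' bb_coeff"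
  unfolding metric_coeff_def ll_coeff_def lb_coeff_def bb_coeff_def by simp_all

lemma dd_coeff:
  assumes p: "(x, y) \<in> D'" and w: "dd w L x y = 0" "dd w \<beta> x y = 0" "dd w \<rho> x y = 0"
  shows "dd w metric_coeff x y = 0" "dd w ll_coeff x y = 0" "dd w lb_coeff x y = 0" "dd w bb_coeff x y = 0"
  unfolding metric_coeff_def ll_coeff_def lb_coeff_def bb_coeff_def using p w
  by (simp_all add: K.dd_add K.dd_diff K.dd_mult K.dd_divide_zero K.dd_power_zero K.dd_const K.dd_minus)

text \<open>The direction w is left general for two uses: horizontal directions give the connection,
  vertical normal directions give the Cartan tensor.\<close>

lemma dd_metric_L':
  assumes p: "(x, y) \<in> D'" and w: "dd w L x y = 0" "dd w \<beta> x y = 0" "dd w \<rho> x y = 0"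
  shows "dd w (metric L' i j) x y = metric_coeff x y * dd w (g i j) x y
    + ll_coeff x y * (dd w (dy i L) x y * dy j L x y + dy i L x y * dd w (dy j L) x y)
    + lb_coeff x y * (dd w (dy i L) x y * b x y $ j + dy i L x y * dd w (\<lambda>x y. b x y $ j) x y
        + dd w (\<lambda>x y. b x y $ i) x y * dy j L x y + b x y $ i * dd w (dy j L) x y)
    + bb_coeff x y * (dd w (\<lambda>x y. b x y $ i) x y * b x y $ j + b x y $ i * dd w (\<lambda>x y. b x y $ j) x y)"
proof -
  have "dd w (metric L' i j) x y = dd w (\<lambda>x y. metric_coeff x y * g i j x y + ll_coeff x y * (dy i L x y * dy j L x y)
    + lb_coeff x y * (dy i L x y * b x y $ j + b x y $ i * dy j L x y) + bb_coeff x y * (b x y $ i * b x y $ j)) x y"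
    by (rule K.dd_cong) (use p metric_L' in auto)
  also have "\<dots> = metric_coeff x y * dd w (g i j) x y
    + ll_coeff x y * (dd w (dy i L) x y * dy j L x y + dy i L x y * dd w (dy j L) x y)
    + lb_coeff x y * (dd w (dy i L) x y * b x y $ j + dy i L x y * dd w (\<lambda>x y. b x y $ j) x y
        + (dd w (\<lambda>x y. b x y $ i) x y * dy j L x y + b x y $ i * dd w (dy j L) x y))
    + bb_coeff x y * (dd w (\<lambda>x y. b x y $ i) x y * b x y $ j + b x y $ i * dd w (\<lambda>x y. b x y $ j) x y)"
    using p by (simp add: K.dd_add K.dd_mult dd_coeff[OF p w])
  finally show ?thesis by simp
qed

lemma delta_metric_L':
  assumes p: "(x, y) \<in> D'"
  shows "delta L k (metric L' i j) x y
    = (\<Sum>r\<in>UNIV. F r i k x y * metric L' r j x y) + (\<Sum>r\<in>UNIV. F r j k x y * metric L' i r x y)"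
proof -
  let ?w = "(axis k 1, - (\<chi> h. N h k x y)) :: (real ^ 'n) \<times> (real ^ 'n)"
  have d: "dd ?w P x y = delta L k P x y" if "tsmooth D' P" for P
    using K.delta_dd[OF that p, of L k] by simp
  have "delta L k (metric L' i j) x y = metric_coeff x y * delta L k (g i j) x y
    + ll_coeff x y * (delta L k (dy i L) x y * dy j L x y + dy i L x y * delta L k (dy j L) x y)
    + lb_coeff x y * (delta L k (dy i L) x y * b x y $ j + dy i L x y * delta L k (\<lambda>x y. b x y $ j) x y
        + delta L k (\<lambda>x y. b x y $ i) x y * dy j L x y + b x y $ i * delta L k (dy j L) x y)
    + bb_coeff x y * (delta L k (\<lambda>x y. b x y $ i) x y * b x y $ j + b x y $ i * delta L k (\<lambda>x y. b x y $ j) x y)"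
    using dd_metric_L'[OF p, of ?w i j] p by (simp add: d delta_L delta_\<beta> delta_\<rho>[OF n])
  also have "\<dots> = (\<Sum>r\<in>UNIV. F r i k x y * metric L' r j x y) + (\<Sum>r\<in>UNIV. F r j k x y * metric L' i r x y)"
    unfolding delta_metric[OF in_D[OF p]] delta_dy_L[OF in_D[OF p]] delta_b[OF in_D[OF p]] metric_L'[OF p]
      sum_distrib_left sum_distrib_right distrib_left sum.distrib
    by (simp add: mult_ac)
  finally show ?thesis .
qed

lemma delta_E':
  assumes p: "(x, y) \<in> D'"
  shows "delta L k (energy L') x y = 0"
proof -
  have "delta L k L' x y = 0"
    unfolding L'_def using p by (simp add: K.delta_divide K.delta_power2 delta_L delta_\<beta>)
  then show ?thesis
    unfolding energy_fun[symmetric] using p by (simp add: K.delta_power2)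
qed

text \<open>The old spray meets the hypotheses of \<open>spray_unique\<close> for the new energy:
  \<open>delta_E'\<close> is the horizontality and \<open>euler_N\<close> the homogeneity.\<close>

lemma spray_L':
  assumes "(x, y) \<in> D'"
  shows "spray_G L' i x y = G i x y"
proof (rule K.spray_unique[OF _ _ _ assms])
  show "tsmooth D' (G i)" for i
    by (rule tsmooth_subset[OF smooth_G D'_subset])
  show "dx k (energy L') x y = (\<Sum>h\<in>UNIV. dy k (G h) x y * dy h (energy L') x y)" if "(x, y) \<in> D'" for x y k
    using delta_E'[OF that, of k] by (simp add: delta_def nonlinear_G_def)
  show "(\<Sum>k\<in>UNIV. dy k (G i) x y * y $ k) = 2 * G i x y" if "(x, y) \<in> D'" for x y i
    using euler_N[of x y i] that by (simp add: nonlinear_G_def)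
qed

lemma nonlinear_L':
  assumes "(x, y) \<in> D'"
  shows "nonlinear_G L' i j x y = N i j x y"
  unfolding nonlinear_G_def by (rule K.dy_cong) (use assms spray_L' in auto)

text \<open>Since the nonlinear connections agree, \<open>delta_metric_L'\<close> says that the old
  F is compatible with the new metric.\<close>

lemma cartan_F_L':
  assumes p: "(x, y) \<in> D'"
  shows "cartan_F L' i j k x y = F i j k x y"
proof (rule K.cartan_F_unique[OF p, where Q="\<lambda>i j k. F i j k x y"])
  show "F i j k x y = F i k j x y" for i j k
    using p by (simp add: cartan_F_commute)
  show "delta L' k (metric L' i j) x y
      = (\<Sum>r\<in>UNIV. F r i k x y * metric L' r j x y) + (\<Sum>r\<in>UNIV. F r j k x y * metric L' i r x y)" for i j k
    using delta_metric_L'[OF p, of k i j] by (simp add: delta_def nonlinear_L'[OF p])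
qed

text \<open>The change of \<open>C\<^sub>i\<^sub>j\<^sub>k\<close> in a normal direction is conformal: the functions \<open>L\<close>, \<open>\<beta>\<close>, \<open>\<rho>\<close> are
  stationary in that direction, and the derivatives of \<open>l\<^sub>i\<close> and \<open>b\<^sub>i\<close> are normal covectors.\<close>

lemma cartan_C_L'_normal:
  assumes p: "(x, y) \<in> D'"
    and m: "(\<Sum>j\<in>UNIV. dy j L x y * m $ j) = 0" "(\<Sum>j\<in>UNIV. b x y $ j * m $ j) = 0"
    and X: "(\<Sum>i\<in>UNIV. X i * (\<Sum>j\<in>UNIV. g i j x y * m $ j)) = 0"
    and Y: "(\<Sum>i\<in>UNIV. Y i * (\<Sum>j\<in>UNIV. g i j x y * m $ j)) = 0"
  shows "(\<Sum>i\<in>UNIV. \<Sum>j\<in>UNIV. \<Sum>k\<in>UNIV. cartan_C L' i j k x y * X i * Y j * m $ k)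
    = metric_coeff x y * (\<Sum>i\<in>UNIV. \<Sum>j\<in>UNIV. \<Sum>k\<in>UNIV. cartan_C L i j k x y * X i * Y j * m $ k)"
proof -
  \<comment> \<open>The derivative of l_i in direction m. As l vanishes on m, L \<nu> is m with its
    index lowered.\<close>
  define \<nu> where "\<nu> i = (\<Sum>j\<in>UNIV. dy j (dy i L) x y * m $ j)" for i
  note q = in_D[OF p]
  have \<nu>: "L x y * \<nu> i = (\<Sum>j\<in>UNIV. g i j x y * m $ j)" for i
  proof -
    have "(\<Sum>j\<in>UNIV. g i j x y * m $ j) = dy i L x y * (\<Sum>j\<in>UNIV. dy j L x y * m $ j) + L x y * \<nu> i"
      unfolding metric_split[OF q] \<nu>_def sum_distrib_left sum.distrib[symmetric]
      by (rule sum.cong) (simp_all add: algebra_simps dy_commute[OF smooth_L q, of i])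
    then show ?thesis by (simp add: m)
  qed
  have X\<nu>: "(\<Sum>i\<in>UNIV. X i * \<nu> i) = 0" and Y\<nu>: "(\<Sum>i\<in>UNIV. Y i * \<nu> i) = 0"
    using X Y L_nonzero[OF q] unfolding \<nu>[symmetric]
    by (simp_all add: mult.left_commute[of _ "L x y"] sum_distrib_left[symmetric])
  have d: "dd (0, m) P x y = (\<Sum>k\<in>UNIV. dy k P x y * m $ k)" if "tsmooth D' P" for P
    using K.dd_vertical[OF that p] .
  have b: "dd (0, m) (\<lambda>x y. b x y $ i) x y = \<rho> x y * \<nu> i" for i
    using q by (simp add: d dy_b \<nu>_def sum_distrib_left dy_commute[OF smooth_L q, of i] mult_ac)
  have l: "dd (0, m) (dy i L) x y = \<nu> i" for i
    by (simp add: d \<nu>_def)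
  have 0: "dd (0, m) L x y = 0" "dd (0, m) \<beta> x y = 0" "dd (0, m) \<rho> x y = 0"
    using q m by (simp_all add: d dy_\<beta> dy_\<rho>[OF n])
  \<comment> \<open>R collects what exceeds the conformal change. Each term has a factor \<nu>,
    which vanishes on X and Y because these are g-orthogonal to m.\<close>
  define R where "R i j = ll_coeff x y * (\<nu> i * dy j L x y + dy i L x y * \<nu> j)
    + lb_coeff x y * (\<nu> i * b x y $ j + dy i L x y * (\<rho> x y * \<nu> j) + (\<rho> x y * \<nu> i) * dy j L x y + b x y $ i * \<nu> j)
    + bb_coeff x y * ((\<rho> x y * \<nu> i) * b x y $ j + b x y $ i * (\<rho> x y * \<nu> j))" for i j
  have key: "dd (0, m) (metric L' i j) x y = metric_coeff x y * dd (0, m) (g i j) x y + R i j" for i j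
    unfolding dd_metric_L'[OF p 0] b l R_def by simp
  have "(\<Sum>i\<in>UNIV. \<Sum>j\<in>UNIV. R i j * X i * Y j)
      = (\<Sum>i\<in>UNIV. X i * \<nu> i) * (\<Sum>j\<in>UNIV. Y j * (ll_coeff x y * dy j L x y + lb_coeff x y * b x y $ j
          + lb_coeff x y * \<rho> x y * dy j L x y + bb_coeff x y * \<rho> x y * b x y $ j))
      + (\<Sum>i\<in>UNIV. X i * (ll_coeff x y * dy i L x y + lb_coeff x y * \<rho> x y * dy i L x y
          + lb_coeff x y * b x y $ i + bb_coeff x y * \<rho> x y * b x y $ i)) * (\<Sum>j\<in>UNIV. Y j * \<nu> j)"
    unfolding sum_product sum.distrib[symmetric] R_def
    by (intro sum.cong refl) (simp add: algebra_simps)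
  then have R: "(\<Sum>i\<in>UNIV. \<Sum>j\<in>UNIV. R i j * X i * Y j) = 0" by (simp add: X\<nu> Y\<nu>)
  have C: "(\<Sum>i\<in>UNIV. \<Sum>j\<in>UNIV. \<Sum>k\<in>UNIV. cartan_C M i j k x y * X i * Y j * m $ k)
      = 1/2 * (\<Sum>i\<in>UNIV. \<Sum>j\<in>UNIV. dd (0, m) (metric M i j) x y * X i * Y j)"
    if "\<And>i j. tsmooth D' (metric M i j)" for M
    by (simp add: cartan_C_def d[OF that] sum_distrib_left sum_distrib_right mult_ac)
  have "(\<Sum>i\<in>UNIV. \<Sum>j\<in>UNIV. dd (0, m) (metric L' i j) x y * X i * Y j)
      = metric_coeff x y * (\<Sum>i\<in>UNIV. \<Sum>j\<in>UNIV. dd (0, m) (g i j) x y * X i * Y j)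
        + (\<Sum>i\<in>UNIV. \<Sum>j\<in>UNIV. R i j * X i * Y j)"
    unfolding key sum_distrib_left sum.distrib[symmetric]
    by (intro sum.cong refl) (simp add: algebra_simps)
  then show ?thesis unfolding R by (simp add: C)
qed

end

end

section \<open>Hypersurfaces\<close>

text \<open>Conormals of the hypersurface. Unlike unit normals they depend neither on the metric nor
  on v, so they serve both spaces at once.\<close>

definition annihilates :: "('n::finite \<Rightarrow> real) \<Rightarrow> (real ^ 'm::finite \<Rightarrow> real ^ 'n) \<Rightarrow> real ^ 'm \<Rightarrow> bool" where
  "annihilates p X u \<longleftrightarrow> (\<forall>\<alpha>. (\<Sum>i\<in>UNIV. p i * Bcoef X i \<alpha> u) = 0)"

text \<open>\<open>H_tensor\<close> without the product of \<open>M_vec\<close> and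
  \<open>H_vec\<close>, and with an arbitrary covector in place of the unit conormal.\<close>

definition second_form ::
    "'n::finite tfun \<Rightarrow> (real ^ 'm::finite \<Rightarrow> real ^ 'n) \<Rightarrow> real ^ 'm \<Rightarrow> ('n \<Rightarrow> real) \<Rightarrow> 'm \<Rightarrow> 'm \<Rightarrow> 'n tfun" where
  "second_form L X u p \<alpha> \<beta> x y = (\<Sum>i\<in>UNIV. p i * (B2coef X i \<alpha> \<beta> u +
     (\<Sum>j\<in>UNIV. \<Sum>k\<in>UNIV. cartan_F L i j k x y * Bcoef X j \<alpha> u * Bcoef X k \<beta> u)))"

text \<open>\<open>M_tensor\<close> with the normal replaced by the covector p with its index
  raised.\<close>

definition cartan_form ::
    "'n::finite tfun \<Rightarrow> (real ^ 'm::finite \<Rightarrow> real ^ 'n) \<Rightarrow> real ^ 'm \<Rightarrow> ('n \<Rightarrow> real) \<Rightarrow> 'm \<Rightarrow> 'm \<Rightarrow> 'n tfun" where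
  "cartan_form L X u p \<alpha> \<beta> x y = (\<Sum>i\<in>UNIV. \<Sum>j\<in>UNIV. \<Sum>k\<in>UNIV.
     cartan_C L i j k x y * Bcoef X i \<alpha> u * Bcoef X j \<beta> u * (\<Sum>r\<in>UNIV. metric_inv L k r x y * p r))"

lemma second_form_scale: "second_form L X u (\<lambda>i. s * p i) \<alpha> \<beta> x y = s * second_form L X u p \<alpha> \<beta> x y"
  by (simp add: second_form_def sum_distrib_left mult_ac)

lemma cartan_form_scale: "cartan_form L X u (\<lambda>i. s * p i) \<alpha> \<beta> x y = s * cartan_form L X u p \<alpha> \<beta> x y"
proof -
  have "(\<Sum>r\<in>UNIV. metric_inv L k r x y * (s * p r)) = s * (\<Sum>r\<in>UNIV. metric_inv L k r x y * p r)" for k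
    by (simp add: sum_distrib_left mult_ac)
  then show ?thesis by (simp add: cartan_form_def sum_distrib_left mult.left_commute)
qed

lemma annihilates_support:
  assumes "annihilates p X u"
  shows "(\<Sum>i\<in>UNIV. p i * support X u v $ i) = 0"
proof -
  have "(\<Sum>i\<in>UNIV. p i * support X u v $ i) = (\<Sum>\<alpha>\<in>UNIV. (\<Sum>i\<in>UNIV. p i * Bcoef X i \<alpha> u) * v $ \<alpha>)"
    unfolding support_def vec_lambda_beta sum_distrib_left sum_distrib_right
    by (subst sum.swap) (simp add: mult_ac)
  then show ?thesis using assms by (simp add: annihilates_def)
qed

lemma support_contract:
  "(\<Sum>\<alpha>\<in>UNIV. v $ \<alpha> * (\<Sum>j\<in>UNIV. P j * Bcoef X j \<alpha> u)) = (\<Sum>j\<in>UNIV. P j * support X u v $ j)"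
  unfolding support_def vec_lambda_beta sum_distrib_left
  by (subst sum.swap) (simp add: mult_ac)

context finsler_chart begin

lemma smooth_second_form [simp]: "tsmooth D (second_form L X u p \<alpha> \<beta>)"
  unfolding second_form_def by simp

lemma smooth_cartan_form [simp]: "tsmooth D (cartan_form L X u p \<alpha> \<beta>)"
  unfolding cartan_form_def cartan_C_def by simp

lemma raise_pos:
  assumes q: "(x, y) \<in> D" and p: "p i \<noteq> 0"
  shows "(\<Sum>i\<in>UNIV. p i * (\<Sum>j\<in>UNIV. metric_inv L i j x y * p j)) > 0"
proof -
  define m where "m i = (\<Sum>j\<in>UNIV. metric_inv L i j x y * p j)" for i
  have gm: "(\<Sum>j\<in>UNIV. g i j x y * m j) = p i" for i
    unfolding m_def by (rule metric_metric_inv[OF q])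
  have "\<exists>i. m i \<noteq> 0" using gm[of i] p by (metis (no_types, lifting) mult_zero_right sum.neutral)
  then have "(\<chi> i. m i) \<noteq> 0" by (simp add: vec_eq_iff)
  from metric_pos[OF q this] have "(\<Sum>i\<in>UNIV. m i * (\<Sum>j\<in>UNIV. g i j x y * m j)) > 0"
    by (simp add: sum_distrib_left mult_ac)
  then show ?thesis unfolding gm m_def[symmetric] by (simp add: mult.commute)
qed

text \<open>Use L l_i = g_ij y^j. For a conormal p the right-hand side vanishes, so l is zero on
  normals.\<close>

lemma dy_L_raise:
  assumes q: "(x, y) \<in> D"
  shows "(\<Sum>i\<in>UNIV. dy i L x y * (\<Sum>j\<in>UNIV. metric_inv L i j x y * p j)) = (\<Sum>j\<in>UNIV. p j * y $ j) / L x y"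
proof -
  define m where "m i = (\<Sum>j\<in>UNIV. metric_inv L i j x y * p j)" for i
  have gm: "(\<Sum>j\<in>UNIV. g i j x y * m j) = p i" for i
    unfolding m_def by (rule metric_metric_inv[OF q])
  have "L x y * dy i L x y = (\<Sum>j\<in>UNIV. g i j x y * y $ j)" for i
    by (simp add: metric_y[OF q] dy_E[OF q])
  then have "L x y * (\<Sum>i\<in>UNIV. dy i L x y * m i) = (\<Sum>i\<in>UNIV. (\<Sum>j\<in>UNIV. g i j x y * y $ j) * m i)"
    by (simp add: sum_distrib_left mult.assoc[symmetric])
  also have "\<dots> = (\<Sum>j\<in>UNIV. (\<Sum>i\<in>UNIV. g j i x y * m i) * y $ j)"
    unfolding sum_distrib_right by (subst sum.swap) (simp add: mult_ac metric_commute[OF q])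
  finally show ?thesis unfolding gm using L_nonzero[OF q] by (simp add: m_def field_simps)
qed

lemma normal_cov_annihilates:
  assumes "unit_normal L X u v m"
  shows "annihilates (normal_cov L X u v m) X u"
  using assms by (simp add: unit_normal_def annihilates_def normal_cov_def sum_distrib_right sum_distrib_left mult_ac)

lemma raise_normal_cov:
  assumes "(X u, support X u v) \<in> D"
  shows "(\<Sum>j\<in>UNIV. metric_inv L i j (X u) (support X u v) * normal_cov L X u v m j) = m $ i"
  unfolding normal_cov_def by (rule metric_inv_metric[OF assms])

text \<open>Raise the index of p and normalize; s is the inverse length of p in the dual
  metric.\<close>

lemma unit_normal_of_covector:
  assumes q: "(X u, support X u v) \<in> D" and a: "annihilates p X u" and p: "p i \<noteq> 0"
  obtains m s where "s \<noteq> 0" "unit_normal L X u v m" "normal_cov L X u v m = (\<lambda>i. s * p i)"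
proof -
  let ?x = "X u" and ?y = "support X u v"
  define m where "m i = (\<Sum>j\<in>UNIV. metric_inv L i j ?x ?y * p j)" for i
  have gm: "(\<Sum>j\<in>UNIV. g i j ?x ?y * m j) = p i" for i
    unfolding m_def by (rule metric_metric_inv[OF q])
  define t where "t = (\<Sum>i\<in>UNIV. p i * m i)"
  have t: "t > 0" using raise_pos[where i=i and p=p, OF q] p by (simp add: t_def m_def)
  define s where "s = 1 / sqrt t"
  have s: "s \<noteq> 0" "s * s * t = 1" using t by (auto simp: s_def field_simps)
  let ?m = "\<chi> i. s * m i"
  have cov: "(\<Sum>j\<in>UNIV. g i j ?x ?y * ?m $ j) = s * p i" for i
    unfolding gm[symmetric] by (simp add: sum_distrib_left mult_ac)
  have "(\<Sum>i\<in>UNIV. \<Sum>j\<in>UNIV. g i j ?x ?y * Bcoef X i \<alpha> u * ?m $ j) = 0" for \<alpha>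
  proof -
    have "(\<Sum>i\<in>UNIV. \<Sum>j\<in>UNIV. g i j ?x ?y * Bcoef X i \<alpha> u * ?m $ j)
        = (\<Sum>i\<in>UNIV. (\<Sum>j\<in>UNIV. g i j ?x ?y * ?m $ j) * Bcoef X i \<alpha> u)"
      unfolding sum_distrib_right by (simp add: mult_ac)
    also have "\<dots> = s * (\<Sum>i\<in>UNIV. p i * Bcoef X i \<alpha> u)"
      unfolding cov by (simp add: sum_distrib_left mult_ac)
    finally show ?thesis using a by (simp add: annihilates_def)
  qed
  moreover have "(\<Sum>i\<in>UNIV. \<Sum>j\<in>UNIV. g i j ?x ?y * ?m $ i * ?m $ j) = 1"
  proof -
    have "(\<Sum>i\<in>UNIV. \<Sum>j\<in>UNIV. g i j ?x ?y * ?m $ i * ?m $ j)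
        = (\<Sum>i\<in>UNIV. (\<Sum>j\<in>UNIV. g i j ?x ?y * ?m $ j) * ?m $ i)"
      unfolding sum_distrib_right by (simp add: mult_ac)
    also have "\<dots> = s * s * t"
      unfolding cov t_def by (simp add: sum_distrib_left mult_ac)
    finally show ?thesis using s by simp
  qed
  ultimately have "unit_normal L X u v ?m" by (simp only: unit_normal_def) blast
  moreover have "normal_cov L X u v ?m = (\<lambda>i. s * p i)"
    by (rule ext) (simp only: normal_cov_def cov)
  ultimately show ?thesis using that s by blast
qed

lemma M_tensor_cartan_form:
  assumes "(X u, support X u v) \<in> D"
  shows "M_tensor L X u v m \<alpha> \<beta> = cartan_form L X u (normal_cov L X u v m) \<alpha> \<beta> (X u) (support X u v)"
  by (simp add: M_tensor_def cartan_form_def raise_normal_cov[where u=u and X=X, OF assms])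

text \<open>Contraction with the supporting element turns \<open>second_form\<close> into the normal curvature vector
  and annihilates \<open>M_vec\<close>, so the term \<open>M\<^sub>\<alpha> H\<^sub>\<beta>\<close> does not affect the vanishing of \<open>H_tensor\<close>.\<close>

lemma H_tensor_zero_iff:
  assumes q: "(X u, support X u v) \<in> D"
  shows "(\<forall>\<alpha> \<beta>. H_tensor L X u v m \<alpha> \<beta> = 0) \<longleftrightarrow>
    (\<forall>\<alpha> \<beta>. second_form L X u (normal_cov L X u v m) \<alpha> \<beta> (X u) (support X u v) = 0)"
proof -
  let ?x = "X u" and ?y = "support X u v"
  let ?T = "\<lambda>\<alpha> \<beta>. second_form L X u (normal_cov L X u v m) \<alpha> \<beta> ?x ?y"
  have H: "H_tensor L X u v m \<alpha> \<beta> = ?T \<alpha> \<beta> + M_vec L X u v m \<alpha> * H_vec L X u v m \<beta>" for \<alpha> \<beta>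
    by (simp add: H_tensor_def second_form_def)
  have vT: "(\<Sum>\<alpha>\<in>UNIV. v $ \<alpha> * ?T \<alpha> \<beta>) = H_vec L X u v m \<beta>" for \<beta>
  proof -
    have F: "(\<Sum>\<alpha>\<in>UNIV. v $ \<alpha> * (\<Sum>j\<in>UNIV. \<Sum>k\<in>UNIV. F i j k ?x ?y * Bcoef X j \<alpha> u * Bcoef X k \<beta> u))
        = (\<Sum>k\<in>UNIV. N i k ?x ?y * Bcoef X k \<beta> u)" for i
    proof -
      have "(\<Sum>j\<in>UNIV. \<Sum>k\<in>UNIV. F i j k ?x ?y * Bcoef X j \<alpha> u * Bcoef X k \<beta> u)
          = (\<Sum>j\<in>UNIV. (\<Sum>k\<in>UNIV. F i j k ?x ?y * Bcoef X k \<beta> u) * Bcoef X j \<alpha> u)" for \<alpha>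
        unfolding sum_distrib_right by (simp add: mult_ac)
      then have "(\<Sum>\<alpha>\<in>UNIV. v $ \<alpha> * (\<Sum>j\<in>UNIV. \<Sum>k\<in>UNIV. F i j k ?x ?y * Bcoef X j \<alpha> u * Bcoef X k \<beta> u))
          = (\<Sum>j\<in>UNIV. (\<Sum>k\<in>UNIV. F i j k ?x ?y * Bcoef X k \<beta> u) * ?y $ j)"
        by (simp only: support_contract)
      also have "\<dots> = (\<Sum>k\<in>UNIV. (\<Sum>j\<in>UNIV. F i j k ?x ?y * ?y $ j) * Bcoef X k \<beta> u)"
        unfolding sum_distrib_right by (subst sum.swap) (simp add: mult_ac)
      finally show ?thesis unfolding cartan_F_y[OF q] .
    qed
    have "(\<Sum>\<alpha>\<in>UNIV. v $ \<alpha> * ?T \<alpha> \<beta>) = (\<Sum>i\<in>UNIV. normal_cov L X u v m i * ((\<Sum>\<alpha>\<in>UNIV. B2coef X i \<alpha> \<beta> u * v $ \<alpha>)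
        + (\<Sum>\<alpha>\<in>UNIV. v $ \<alpha> * (\<Sum>j\<in>UNIV. \<Sum>k\<in>UNIV. F i j k ?x ?y * Bcoef X j \<alpha> u * Bcoef X k \<beta> u))))"
      unfolding second_form_def sum.distrib[symmetric]
      unfolding sum_distrib_left[of "v $ _"] sum_distrib_left[of "normal_cov _ _ _ _ _ _"]
      by (subst sum.swap) (simp add: algebra_simps sum_distrib_left)
    then show ?thesis unfolding F H_vec_def .
  qed
  have vM: "(\<Sum>\<alpha>\<in>UNIV. v $ \<alpha> * M_vec L X u v m \<alpha>) = 0"
  proof -
    \<comment> \<open>Symmetry of the third y-derivatives of E moves the contracted index to the
      position in \<open>euler_E2\<close>.\<close>
    have Cy: "(\<Sum>i\<in>UNIV. ?y $ i * cartan_C L i j k ?x ?y) = 0" for j k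
    proof -
      have C: "cartan_C L i j k ?x ?y = 1/4 * dy k (dy j (dy i E)) ?x ?y" for i
        by (simp add: cartan_C_def dy_metric[OF q] dy3_commute[OF q smooth_E, of k i j])
      have "(\<Sum>i\<in>UNIV. ?y $ i * cartan_C L i j k ?x ?y) = 1/4 * (\<Sum>i\<in>UNIV. ?y $ i * dy k (dy j (dy i E)) ?x ?y)"
        unfolding C sum_distrib_left by (simp add: mult_ac)
      then show ?thesis by (simp only: euler_E2[OF q])
    qed
    have "M_vec L X u v m \<alpha> = (\<Sum>i\<in>UNIV. (\<Sum>j\<in>UNIV. \<Sum>k\<in>UNIV. cartan_C L i j k ?x ?y * m $ j * m $ k) * Bcoef X i \<alpha> u)" for \<alpha>
      unfolding M_vec_def sum_distrib_right by (simp add: mult_ac)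
    then have "(\<Sum>\<alpha>\<in>UNIV. v $ \<alpha> * M_vec L X u v m \<alpha>)
        = (\<Sum>i\<in>UNIV. (\<Sum>j\<in>UNIV. \<Sum>k\<in>UNIV. cartan_C L i j k ?x ?y * m $ j * m $ k) * ?y $ i)"
      by (simp only: support_contract)
    also have "\<dots> = (\<Sum>j\<in>UNIV. \<Sum>k\<in>UNIV. (\<Sum>i\<in>UNIV. ?y $ i * cartan_C L i j k ?x ?y) * m $ j * m $ k)"
    proof -
      have "(\<Sum>i\<in>UNIV. (\<Sum>j\<in>UNIV. \<Sum>k\<in>UNIV. cartan_C L i j k ?x ?y * m $ j * m $ k) * ?y $ i)
          = (\<Sum>j\<in>UNIV. \<Sum>i\<in>UNIV. \<Sum>k\<in>UNIV. cartan_C L i j k ?x ?y * m $ j * m $ k * ?y $ i)"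
        unfolding sum_distrib_right by (rule sum.swap)
      also have "\<dots> = (\<Sum>j\<in>UNIV. \<Sum>k\<in>UNIV. \<Sum>i\<in>UNIV. cartan_C L i j k ?x ?y * m $ j * m $ k * ?y $ i)"
        by (intro sum.cong refl sum.swap)
      finally show ?thesis unfolding sum_distrib_right by (simp add: mult_ac)
    qed
    finally show ?thesis by (simp only: Cy) simp
  qed
  show ?thesis
  proof
    assume z: "\<forall>\<alpha> \<beta>. H_tensor L X u v m \<alpha> \<beta> = 0"
    have "H_vec L X u v m \<beta> = 0" for \<beta>
    proof -
      have "0 = (\<Sum>\<alpha>\<in>UNIV. v $ \<alpha> * H_tensor L X u v m \<alpha> \<beta>)" using z by simp
      also have "\<dots> = (\<Sum>\<alpha>\<in>UNIV. v $ \<alpha> * ?T \<alpha> \<beta>) + (\<Sum>\<alpha>\<in>UNIV. v $ \<alpha> * M_vec L X u v m \<alpha>) * H_vec L X u v m \<beta>"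
        unfolding H distrib_left sum.distrib sum_distrib_right by (simp add: mult_ac)
      finally show ?thesis by (simp only: vT vM)
    qed
    then show "\<forall>\<alpha> \<beta>. ?T \<alpha> \<beta> = 0" using z H by simp
  next
    assume z: "\<forall>\<alpha> \<beta>. ?T \<alpha> \<beta> = 0"
    then have "H_vec L X u v m \<beta> = 0" for \<beta> using vT[of \<beta>] by simp
    then show "\<forall>\<alpha> \<beta>. H_tensor L X u v m \<alpha> \<beta> = 0" using z H by simp
  qed
qed

text \<open>Every nonzero conormal is a multiple of a unit one, so a scale-invariant property may be
  tested on either. The case s = 0 of \<open>scale\<close> makes Q hold for the zero
  covector.\<close>

lemma normal_covector_iff:
  assumes q: "(X u, support X u v) \<in> D"
    and scale: "\<And>s p. Q (\<lambda>i. s * p i) = (s = 0 \<or> Q p)"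
  shows "(\<forall>m. unit_normal L X u v m \<longrightarrow> Q (normal_cov L X u v m)) \<longleftrightarrow> (\<forall>p. annihilates p X u \<longrightarrow> Q p)"
proof
  assume a: "\<forall>m. unit_normal L X u v m \<longrightarrow> Q (normal_cov L X u v m)"
  show "\<forall>p. annihilates p X u \<longrightarrow> Q p"
  proof (intro allI impI)
    fix p assume p: "annihilates p X u"
    show "Q p"
    proof (cases "\<exists>i. p i \<noteq> 0")
      case True
      then obtain m s where "s \<noteq> 0" "unit_normal L X u v m" "normal_cov L X u v m = (\<lambda>i. s * p i)"
        using unit_normal_of_covector[where u=u and X=X and v=v, OF q p] by metis
      then show ?thesis using a scale by metis
    next
      case False
      then have "p = (\<lambda>i. 0 * p i)" by auto
      then show ?thesis using scale[of 0 p] by simp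
    qed
  qed
qed (use normal_cov_annihilates in blast)

lemma second_kind_iff:
  assumes q: "(X u, support X u v) \<in> D"
  shows "(\<forall>m. unit_normal L X u v m \<longrightarrow> (\<forall>\<alpha> \<beta>. H_tensor L X u v m \<alpha> \<beta> = 0)) \<longleftrightarrow>
    (\<forall>p. annihilates p X u \<longrightarrow> (\<forall>\<alpha> \<beta>. second_form L X u p \<alpha> \<beta> (X u) (support X u v) = 0))"
  unfolding H_tensor_zero_iff[where u=u and X=X, OF q]
  by (rule normal_covector_iff[where u=u and X=X, OF q]) (auto simp: second_form_scale)

lemma third_kind_iff:
  assumes q: "(X u, support X u v) \<in> D"
  shows "(\<forall>m. unit_normal L X u v m \<longrightarrow> (\<forall>\<alpha> \<beta>. H_tensor L X u v m \<alpha> \<beta> = 0 \<and> M_tensor L X u v m \<alpha> \<beta> = 0)) \<longleftrightarrow>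
    (\<forall>p. annihilates p X u \<longrightarrow> (\<forall>\<alpha> \<beta>. second_form L X u p \<alpha> \<beta> (X u) (support X u v) = 0 \<and>
       cartan_form L X u p \<alpha> \<beta> (X u) (support X u v) = 0))"
  unfolding all_conj_distrib H_tensor_zero_iff[where u=u and X=X, OF q] M_tensor_cartan_form[where u=u and X=X, OF q]
  unfolding all_conj_distrib[symmetric] imp_conjR[symmetric]
  by (rule normal_covector_iff[where u=u and X=X, OF q]) (auto simp: second_form_scale cartan_form_scale)

lemma tangent_covector:
  assumes q: "(X u, support X u v) \<in> D"
    and t: "\<And>m. unit_normal L X u v m \<Longrightarrow> (\<Sum>i\<in>UNIV. c i * m $ i) = 0" and a: "annihilates p X u"
  shows "(\<Sum>i\<in>UNIV. c i * (\<Sum>j\<in>UNIV. metric_inv L i j (X u) (support X u v) * p j)) = 0"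
proof -
  let ?Q = "\<lambda>p. (\<Sum>i\<in>UNIV. c i * (\<Sum>j\<in>UNIV. metric_inv L i j (X u) (support X u v) * p j)) = 0"
  have "?Q (\<lambda>i. s * p i) = (s = 0 \<or> ?Q p)" for s p
  proof -
    have "(\<Sum>i\<in>UNIV. c i * (\<Sum>j\<in>UNIV. metric_inv L i j (X u) (support X u v) * (s * p j)))
      = s * (\<Sum>i\<in>UNIV. c i * (\<Sum>j\<in>UNIV. metric_inv L i j (X u) (support X u v) * p j))"
      by (simp add: sum_distrib_left mult_ac)
    then show ?thesis by simp
  qed
  note iff = normal_covector_iff[where u=u and X=X and v=v and Q="?Q", OF q this]
  have "\<forall>m. unit_normal L X u v m \<longrightarrow> ?Q (normal_cov L X u v m)"
    using t by (simp only: raise_normal_cov[where u=u and X=X, OF q]) simp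
  then show ?thesis using iff a by blast
qed

end

text \<open>The tangent line is spanned by y, so p = b - (\<beta>/L) l is a conormal. Both b and l
  vanish on its raised vector, hence p = 0 and b is a multiple of l. Then C^h_ij b_h is a multiple
  of C_ijk y^k = 0, against \<rho> \<noteq> 0.\<close>

lemma (in parallel_h_vector) no_tangent_line:
  fixes X :: "real ^ 'm::finite \<Rightarrow> real ^ 'n"
  assumes q: "(X u, support X u v) \<in> D" and m: "CARD('m) = 1" and n: "CARD('n) \<ge> 2"
    and t: "\<And>m. unit_normal L X u v m \<Longrightarrow> (\<Sum>i\<in>UNIV. b (X u) (support X u v) $ i * m $ i) = 0"
  shows False
proof -
  let ?x = "X u" and ?y = "support X u v"
  obtain \<alpha> :: 'm where \<alpha>: "UNIV = {\<alpha>}" using m by (metis card_1_singletonE)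
  define k where "k = \<beta> ?x ?y / L ?x ?y"
  define p where "p i = b ?x ?y $ i - k * dy i L ?x ?y" for i
  have py: "(\<Sum>i\<in>UNIV. p i * ?y $ i) = 0"
  proof -
    have "(\<Sum>i\<in>UNIV. p i * ?y $ i) = \<beta> ?x ?y - k * (\<Sum>i\<in>UNIV. ?y $ i * dy i L ?x ?y)"
      by (simp add: p_def pairing_def sum_subtractf sum_distrib_left algebra_simps)
    then show ?thesis using L_nonzero[OF q] by (simp add: euler_L[OF q] k_def)
  qed
  have "(\<Sum>i\<in>UNIV. p i * ?y $ i) = (\<Sum>i\<in>UNIV. p i * Bcoef X i \<alpha> u) * v $ \<alpha>"
    unfolding support_def vec_lambda_beta sum_distrib_right by (simp add: \<alpha> mult_ac)
  moreover have "v $ \<alpha> \<noteq> 0"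
  proof
    assume "v $ \<alpha> = 0"
    then have "?y = 0" by (simp add: support_def \<alpha> vec_eq_iff)
    then show False using y_nonzero[OF q] by simp
  qed
  ultimately have "(\<Sum>i\<in>UNIV. p i * Bcoef X i \<alpha> u) = 0" using py by simp
  moreover have "\<gamma> = \<alpha>" for \<gamma> using \<alpha> by auto
  ultimately have a: "annihilates p X u" unfolding annihilates_def by metis
  define m where "m i = (\<Sum>j\<in>UNIV. metric_inv L i j ?x ?y * p j)" for i
  have "(\<Sum>i\<in>UNIV. b ?x ?y $ i * m i) = 0"
    unfolding m_def by (rule tangent_covector[where u=u and X=X, OF q t a])
  moreover have "(\<Sum>i\<in>UNIV. dy i L ?x ?y * m i) = 0"
    unfolding m_def dy_L_raise[OF q] py by simp
  moreover have "(\<Sum>i\<in>UNIV. p i * m i) = (\<Sum>i\<in>UNIV. b ?x ?y $ i * m i) - k * (\<Sum>i\<in>UNIV. dy i L ?x ?y * m i)"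
    unfolding sum_distrib_left sum_subtractf[symmetric]
    by (intro sum.cong refl) (simp add: p_def algebra_simps)
  ultimately have "(\<Sum>i\<in>UNIV. p i * (\<Sum>j\<in>UNIV. metric_inv L i j ?x ?y * p j)) = 0"
    by (simp add: m_def)
  then have "p i = 0" for i using raise_pos[OF q, of p i] by auto
  then have b: "b ?x ?y $ i = k * dy i L ?x ?y" for i by (simp add: p_def)
  have "\<rho> ?x ?y * dy i (dy j L) ?x ?y = 0" for i j
  proof -
    have "\<rho> ?x ?y * dy i (dy j L) ?x ?y
        = k * (\<Sum>h\<in>UNIV. dy h L ?x ?y * (\<Sum>l\<in>UNIV. metric_inv L h l ?x ?y * cartan_C L i j l ?x ?y))"
      by (simp add: C_up_b[OF q, symmetric] cartan_C_up_def b sum_distrib_left mult_ac)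
    also have "\<dots> = k * ((\<Sum>l\<in>UNIV. cartan_C L i j l ?x ?y * ?y $ l) / L ?x ?y)"
      by (simp only: dy_L_raise[OF q])
    also have "(\<Sum>l\<in>UNIV. cartan_C L i j l ?x ?y * ?y $ l) = 1/4 * (\<Sum>l\<in>UNIV. ?y $ l * dy i (dy j (dy l E)) ?x ?y)"
    proof -
      have "dy l (dy i (dy j E)) ?x ?y = dy i (dy j (dy l E)) ?x ?y" for l
        using dy_commute[of "dy j E", OF _ q, of l i] dy3_commute[OF q smooth_E, of i l j] by simp
      then show ?thesis by (simp add: cartan_C_def dy_metric[OF q] sum_distrib_left mult_ac)
    qed
    finally show ?thesis by (simp add: euler_E2[OF q])
  qed
  then show False using hessian_nonzero[OF n q] \<rho>_nonzero[OF q] by (metis mult_eq_0_iff)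
qed

context kropina_chart begin

text \<open>At a point with \<open>\<beta> = 0\<close> the form \<open>\<beta>\<close> is nonzero on a punctured neighbourhood along every line
  that is not in the kernel of its derivative \<open>b\<close>.\<close>

lemma zero_by_continuity:
  assumes P: "tsmooth D P" and q: "(x, y) \<in> D" and e: "(\<Sum>i\<in>UNIV. b x y $ i * e $ i) \<noteq> 0"
    and z: "\<And>t. (x, y + t *\<^sub>R e) \<in> D' \<Longrightarrow> P x (y + t *\<^sub>R e) = 0"
  shows "P x y = 0"
proof (rule ccontr)
  assume nz: "P x y \<noteq> 0"
  \<comment> \<open>The point itself corresponds to t = 0; if it were in D', then z would already
    give P = 0.\<close>
  then have \<beta>0: "\<beta> x y = 0" using z[of 0] q by (auto simp: D'_def simp del: in_D \<beta>_nonzero)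
  have line: "((\<lambda>t. (x, y + t *\<^sub>R e)) \<longlongrightarrow> (x, y)) (at 0)"
    by (auto intro!: tendsto_eq_intros)
  have "continuous_on D (\<lambda>p. P (fst p) (snd p))"
    using P by (simp add: tsmooth_def smooth_on_imp_continuous)
  then have "isCont (\<lambda>p. P (fst p) (snd p)) (x, y)"
    using open_D q continuous_on_eq_continuous_at by blast
  from isCont_tendsto_compose[OF this line] have "((\<lambda>t. P x (y + t *\<^sub>R e)) \<longlongrightarrow> P x y) (at 0)" by simp
  then have 1: "\<forall>\<^sub>F t in at 0. P x (y + t *\<^sub>R e) \<noteq> 0"
    using nz by (rule tendsto_imp_eventually_ne)
  have 2: "\<forall>\<^sub>F t in at 0. (x, y + t *\<^sub>R e) \<in> D"
    by (rule topological_tendstoD[OF line open_D q])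
  have "((\<lambda>t. (x, y + t *\<^sub>R e)) has_derivative (\<lambda>t. (0, t *\<^sub>R e))) (at 0)"
    by (auto intro!: derivative_eq_intros)
  from has_derivative_compose[OF this, of "\<lambda>p. \<beta> (fst p) (snd p)"] tsmooth_has_derivative[OF smooth_\<beta> q]
  have "((\<lambda>t. \<beta> x (y + t *\<^sub>R e)) has_derivative (\<lambda>t. dd (0, t *\<^sub>R e) \<beta> x y)) (at 0)" by simp
  moreover have "dd (0, t *\<^sub>R e) \<beta> x y = t * (\<Sum>i\<in>UNIV. b x y $ i * e $ i)" for t
    using q by (simp add: dd_vertical dy_\<beta> sum_distrib_left mult_ac)
  ultimately have "((\<lambda>t. \<beta> x (y + t *\<^sub>R e)) has_real_derivative (\<Sum>i\<in>UNIV. b x y $ i * e $ i)) (at 0)"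
    by (simp add: has_field_derivative_def mult_commute_abs)
  \<comment> \<open>Since \<beta> vanishes at the point, this is its difference quotient; the
    nonzero limit keeps \<beta> away from zero for small t \<noteq> 0.\<close>
  then have "((\<lambda>t. \<beta> x (y + t *\<^sub>R e) / t) \<longlongrightarrow> (\<Sum>i\<in>UNIV. b x y $ i * e $ i)) (at 0)"
    by (simp add: DERIV_def \<beta>0)
  then have 3: "\<forall>\<^sub>F t in at 0. \<beta> x (y + t *\<^sub>R e) / t \<noteq> 0"
    using e by (rule tendsto_imp_eventually_ne)
  have "\<forall>\<^sub>F t in at (0 :: real). False"
    using 1 2 3 by eventually_elim (use z in \<open>auto simp: D'_def simp del: in_D \<beta>_nonzero\<close>)
  then show False by simp
qed

section \<open>Comparison of the two hypersurfaces over one parameter point u\<close>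

context
  fixes X :: "real ^ 'm::finite \<Rightarrow> real ^ 'n" and u :: "real ^ 'm"
  assumes dim: "CARD('n) = CARD('m) + 1"
    and tangent: "\<And>v m. (X u, support X u v) \<in> D \<Longrightarrow> unit_normal L X u v m \<Longrightarrow>
      (\<Sum>i\<in>UNIV. b (X u) (support X u v) $ i * m $ i) = 0"
begin

lemma dim_ge_3:
  assumes "(X u, support X u v) \<in> D"
  shows "CARD('n) \<ge> 3"
proof (rule ccontr)
  assume "\<not> CARD('n) \<ge> 3"
  moreover have "CARD('m) > 0" by simp
  ultimately have "CARD('m) = 1" "CARD('n) \<ge> 2" using dim by linarith+
  then show False using no_tangent_line[where u=u and X=X, OF assms] tangent[OF assms] by blast
qed

lemma tangent_annihilates:
  assumes "(X u, support X u v) \<in> D" "annihilates p X u"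
  shows "(\<Sum>i\<in>UNIV. b (X u) (support X u v) $ i * (\<Sum>j\<in>UNIV. metric_inv L i j (X u) (support X u v) * p j)) = 0"
  using tangent_covector[where u=u and X=X and c="\<lambda>i. b (X u) (support X u v) $ i", OF assms(1) tangent assms(2)] assms(1)
  by blast

lemma second_form_L':
  assumes "(X u, support X u v) \<in> D'"
  shows "second_form L' X u p \<alpha> \<gamma> (X u) (support X u v) = second_form L X u p \<alpha> \<gamma> (X u) (support X u v)"
  using cartan_F_L'[OF dim_ge_3[OF in_D[OF assms]] assms] by (simp add: second_form_def)

text \<open>The raised vectors of p satisfy m = \<open>metric_coeff\<close> m', and the Cartan
  tensor changes by the same factor, which cancels.\<close>

lemma cartan_form_L':
  assumes q: "(X u, support X u v) \<in> D'" and a: "annihilates p X u"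
  shows "cartan_form L' X u p \<alpha> \<gamma> (X u) (support X u v) = cartan_form L X u p \<alpha> \<gamma> (X u) (support X u v)"
proof -
  let ?x = "X u" and ?y = "support X u v"
  note q' = in_D[OF q]
  define m where "m = (\<chi> i. \<Sum>j\<in>UNIV. metric_inv L i j ?x ?y * p j)"
  define m' where "m' = (\<chi> i. \<Sum>j\<in>UNIV. metric_inv L' i j ?x ?y * p j)"
  have gm: "(\<Sum>j\<in>UNIV. g i j ?x ?y * m $ j) = p i" for i
    unfolding m_def vec_lambda_beta by (rule metric_metric_inv[OF q'])
  have gm': "(\<Sum>j\<in>UNIV. metric L' i j ?x ?y * m' $ j) = p i" for i
    unfolding m'_def vec_lambda_beta by (rule K.metric_metric_inv[OF q])
  have lm: "(\<Sum>j\<in>UNIV. dy j L ?x ?y * m $ j) = 0"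
    unfolding m_def vec_lambda_beta dy_L_raise[OF q'] annihilates_support[OF a] by simp
  have bm: "(\<Sum>j\<in>UNIV. b ?x ?y $ j * m $ j) = 0"
    unfolding m_def vec_lambda_beta by (rule tangent_annihilates[OF q' a])
  have mm': "m $ j = metric_coeff ?x ?y * m' $ j" for j
  proof (rule K.metric_cancel[OF q])
    fix i
    show "(\<Sum>j\<in>UNIV. metric L' i j ?x ?y * m $ j) = (\<Sum>j\<in>UNIV. metric L' i j ?x ?y * (metric_coeff ?x ?y * m' $ j))"
      using gm'[of i] by (simp add: metric_L'_normal[OF q lm bm] gm mult.left_commute[of _ "metric_coeff _ _"]
          sum_distrib_left[symmetric])
  qed
  have tang: "(\<Sum>i\<in>UNIV. Bcoef X i \<alpha> u * (\<Sum>j\<in>UNIV. g i j ?x ?y * m $ j)) = 0" for \<alpha>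
    unfolding gm using a by (simp add: annihilates_def mult.commute)
  define S where "S M m = (\<Sum>i\<in>UNIV. \<Sum>j\<in>UNIV. \<Sum>k\<in>UNIV.
      cartan_C M i j k ?x ?y * Bcoef X i \<alpha> u * Bcoef X j \<gamma> u * m $ k)" for M and m :: "real ^ 'n"
  have "S L' m = metric_coeff ?x ?y * S L m"
    unfolding S_def by (rule cartan_C_L'_normal[OF dim_ge_3[OF q'] q lm bm tang tang])
  moreover have "S L' m = metric_coeff ?x ?y * S L' m'"
    by (simp add: S_def mm' sum_distrib_left mult_ac)
  moreover have "S L m = cartan_form L X u p \<alpha> \<gamma> ?x ?y" "S L' m' = cartan_form L' X u p \<alpha> \<gamma> ?x ?y"
    by (simp_all add: S_def cartan_form_def m_def m'_def)
  \<comment> \<open>If the conformal factor were zero, then m = 0 and p = 0, and both forms vanish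
    anyway.\<close>
  moreover have "p = (\<lambda>i. 0)" if "metric_coeff ?x ?y = 0"
    using gm by (simp add: fun_eq_iff mm' that)
  ultimately show ?thesis by (cases "metric_coeff ?x ?y = 0") (auto simp: cartan_form_def)
qed

text \<open>As b is nonzero and tangent, it is not a conormal: some B_\<alpha> has b(B_\<alpha>)
  \<noteq> 0. Varying v along the \<alpha>-axis moves y along B_\<alpha> and keeps u fixed, so
  \<open>zero_by_continuity\<close> applies.\<close>

lemma forms_extend:
  assumes P: "tsmooth D P" and q: "(X u, support X u v) \<in> D"
    and z: "\<And>v. (X u, support X u v) \<in> D' \<Longrightarrow> P (X u) (support X u v) = 0"
  shows "P (X u) (support X u v) = 0"
proof -
  let ?b = "b (X u) (support X u v)"
  have n2: "CARD('n) \<ge> 2" using dim_ge_3[OF q] by simp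
  have "\<not> annihilates (\<lambda>i. ?b $ i) X u"
  proof
    assume a: "annihilates (\<lambda>i. ?b $ i) X u"
    obtain i where "?b $ i \<noteq> 0" using b_nonzero[OF n2 q] by (auto simp: vec_eq_iff)
    from raise_pos[OF q, of "\<lambda>i. ?b $ i", OF this] tangent_annihilates[OF q a] show False by simp
  qed
  then obtain \<alpha> where \<alpha>: "(\<Sum>i\<in>UNIV. ?b $ i * (\<chi> i. Bcoef X i \<alpha> u) $ i) \<noteq> 0"
    by (auto simp: annihilates_def)
  have s: "support X u (v + t *\<^sub>R axis \<alpha> 1) = support X u v + t *\<^sub>R (\<chi> i. Bcoef X i \<alpha> u)" for t
  proof -
    have "(\<Sum>\<gamma>\<in>UNIV. Bcoef X i \<gamma> u * (v + t *\<^sub>R axis \<alpha> 1) $ \<gamma>)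
        = (\<Sum>\<gamma>\<in>UNIV. Bcoef X i \<gamma> u * v $ \<gamma>) + (\<Sum>\<gamma>\<in>UNIV. if \<gamma> = \<alpha> then t * Bcoef X i \<alpha> u else 0)" for i
      unfolding sum.distrib[symmetric] by (intro sum.cong refl) (auto simp: axis_def algebra_simps)
    then show ?thesis by (simp add: support_def vec_eq_iff)
  qed
  show ?thesis
    by (rule zero_by_continuity[OF P q \<alpha>]) (use z[of "v + t *\<^sub>R axis \<alpha> 1" for t] in \<open>simp add: s\<close>)
qed

text \<open>The quantifier over v stands inside each side, because vanishing at a v with \<beta> = 0
  is obtained from other v over the same u.\<close>

lemma second_kind_L'_iff:
  "(\<forall>v. (X u, support X u v) \<in> D' \<longrightarrow> (\<forall>m. unit_normal L' X u v m \<longrightarrow> (\<forall>\<alpha> \<gamma>. H_tensor L' X u v m \<alpha> \<gamma> = 0))) \<longleftrightarrow>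
   (\<forall>v. (X u, support X u v) \<in> D \<longrightarrow> (\<forall>m. unit_normal L X u v m \<longrightarrow> (\<forall>\<alpha> \<gamma>. H_tensor L X u v m \<alpha> \<gamma> = 0)))"
proof -
  have "(\<forall>v. (X u, support X u v) \<in> D' \<longrightarrow> (\<forall>p. annihilates p X u \<longrightarrow> (\<forall>\<alpha> \<gamma>. second_form L' X u p \<alpha> \<gamma> (X u) (support X u v) = 0))) \<longleftrightarrow>
    (\<forall>v. (X u, support X u v) \<in> D \<longrightarrow> (\<forall>p. annihilates p X u \<longrightarrow> (\<forall>\<alpha> \<gamma>. second_form L X u p \<alpha> \<gamma> (X u) (support X u v) = 0)))"
    using second_form_L' by (auto intro: forms_extend[OF smooth_second_form])
  then show ?thesis
    by (simp add: second_kind_iff[where X=X and u=u] K.second_kind_iff[where X=X and u=u] cong: imp_cong)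
qed

lemma third_kind_L'_iff:
  "(\<forall>v. (X u, support X u v) \<in> D' \<longrightarrow> (\<forall>m. unit_normal L' X u v m \<longrightarrow>
      (\<forall>\<alpha> \<gamma>. H_tensor L' X u v m \<alpha> \<gamma> = 0 \<and> M_tensor L' X u v m \<alpha> \<gamma> = 0))) \<longleftrightarrow>
   (\<forall>v. (X u, support X u v) \<in> D \<longrightarrow> (\<forall>m. unit_normal L X u v m \<longrightarrow>
      (\<forall>\<alpha> \<gamma>. H_tensor L X u v m \<alpha> \<gamma> = 0 \<and> M_tensor L X u v m \<alpha> \<gamma> = 0)))"
proof -
  have "(\<forall>v. (X u, support X u v) \<in> D' \<longrightarrow> (\<forall>p. annihilates p X u \<longrightarrow> (\<forall>\<alpha> \<gamma>.
        second_form L' X u p \<alpha> \<gamma> (X u) (support X u v) = 0 \<and> cartan_form L' X u p \<alpha> \<gamma> (X u) (support X u v) = 0))) \<longleftrightarrow>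
    (\<forall>v. (X u, support X u v) \<in> D \<longrightarrow> (\<forall>p. annihilates p X u \<longrightarrow> (\<forall>\<alpha> \<gamma>.
        second_form L X u p \<alpha> \<gamma> (X u) (support X u v) = 0 \<and> cartan_form L X u p \<alpha> \<gamma> (X u) (support X u v) = 0)))"
    using second_form_L' cartan_form_L'
    by (auto intro: forms_extend[OF smooth_second_form] forms_extend[OF smooth_cartan_form])
  then show ?thesis
    by (simp add: third_kind_iff[where X=X and u=u] K.third_kind_iff[where X=X and u=u] cong: imp_cong)
qed

end

end

section \<open>From charts to the manifold\<close>

lemma finsler_space_chart:
  assumes "finsler_space \<A> D L" "c \<in> \<A>"
  shows "finsler_chart (D c) (L c)"
proof
  have *: "\<forall>(x, y)\<in>D c. (\<forall>t>0. L c x (t *\<^sub>R y) = t * L c x y) \<and>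
      (\<forall>w. w \<noteq> 0 \<longrightarrow> (\<Sum>i\<in>UNIV. \<Sum>j\<in>UNIV. metric (L c) i j x y * w $ i * w $ j) > 0)"
    using assms by (simp add: finsler_space_def)
  show "L c x (t *\<^sub>R y) = t * L c x y" if "(x, y) \<in> D c" "t > 0" for x y t
    using * that by auto
  show "(\<Sum>i\<in>UNIV. \<Sum>j\<in>UNIV. metric (L c) i j x y * w $ i * w $ j) > 0" if "(x, y) \<in> D c" "w \<noteq> 0" for x y w
    using * that by auto
  show "open (D c)" using assms by (auto simp: finsler_space_def conic_domain_def)
  show "tsmooth (D c) (L c)"
    using assms by (simp add: finsler_space_def tsmooth_def split_beta')
qed (use assms in \<open>auto simp: finsler_space_def conic_domain_def\<close>)

lemma kropina_chart_exists:
  assumes L: "finsler_space \<A> D L" and b: "h_vector \<A> D L b"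
    and K: "finsler_space \<A> (kropina_domain D b) (kropina L b)"
    and par: "h_parallel \<A> D L b" and c: "c \<in> \<A>"
  obtains \<rho> where "kropina_chart (D c) (L c) (b c) \<rho> (kropina_domain D b c) (kropina L b c)"
proof -
  interpret finsler_chart "D c" "L c" by (rule finsler_space_chart[OF L c])
  obtain \<rho> where \<rho>: "\<forall>c\<in>\<A>. \<forall>(x, y)\<in>D c. \<rho> c x y \<noteq> 0 \<and>
      (\<forall>i j. L c x y * (\<Sum>h\<in>UNIV. cartan_C_up (L c) h i j x y * b c x y $ h) = \<rho> c x y * angular_metric (L c) i j x y)"
    using b unfolding h_vector_def by blast
  from \<rho> c have \<rho>c: "\<forall>(x, y)\<in>D c. \<rho> c x y \<noteq> 0 \<and>
      (\<forall>i j. L c x y * (\<Sum>h\<in>UNIV. cartan_C_up (L c) h i j x y * b c x y $ h) = \<rho> c x y * angular_metric (L c) i j x y)"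
    by (rule bspec)
  have sb: "smooth_on (D c) (\<lambda>p. b c (fst p) (snd p))"
    using b c by (simp add: h_vector_def covector_field_def split_beta')
  have "parallel_h_vector (D c) (L c) (b c) (\<rho> c)"
  proof
    show "tsmooth (D c) (\<lambda>x y. b c x y $ i)" for i
      unfolding tsmooth_def by (rule smooth_on_compose_linear[OF open_D bounded_linear_vec_nth sb])
    show "v_cov (L c) (b c) i k x y = 0" if "(x, y) \<in> D c" for x y i k
    proof -
      have "\<forall>(x, y)\<in>D c. \<forall>i k. v_cov (L c) (b c) i k x y = 0"
        using b c by (simp add: h_vector_def)
      then show ?thesis using that by auto
    qed
    show "h_cov (L c) (b c) i j x y = 0" if "(x, y) \<in> D c" for x y i j
    proof -
      have "\<forall>(x, y)\<in>D c. \<forall>i j. h_cov (L c) (b c) i j x y = 0"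
        using par c by (simp add: h_parallel_def)
      then show ?thesis using that by auto
    qed
  qed (use \<rho>c in auto)
  then have "kropina_chart (D c) (L c) (b c) (\<rho> c) (kropina_domain D b c) (kropina L b c)"
    using finsler_space_chart[OF K c]
    by (auto simp: kropina_chart_def kropina_chart_axioms_def kropina_domain_def kropina_def beta_def pairing_def fun_eq_iff)
  then show ?thesis by (rule that)
qed

theorem theorem4p5:
  fixes \<A> :: "('a::{t2_space,second_countable_topology}, 'n::finite) chart set"
    and \<B> :: "('b::{t2_space,second_countable_topology}, 'm::finite) chart set"
    and D :: "('a, 'n) chart \<Rightarrow> ((real ^ 'n) \<times> (real ^ 'n)) set"
    and L :: "('a, 'n) chart \<Rightarrow> real ^ 'n \<Rightarrow> real ^ 'n \<Rightarrow> real"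
    and b :: "('a, 'n) chart \<Rightarrow> real ^ 'n \<Rightarrow> real ^ 'n \<Rightarrow> real ^ 'n"
    and f :: "'b \<Rightarrow> 'a"
  assumes "smooth_atlas \<A>" and "finsler_space \<A> D L"
    and "h_vector \<A> D L b"
    and "finsler_space \<A> (kropina_domain D b) (kropina L b)"
    and "smooth_atlas \<B>" and "hypersurface \<A> \<B> f"
    and "h_parallel \<A> D L b"
    and "tangent_to_hypersurface \<A> \<B> f D L b"
  shows "(hyperplane_second_kind \<A> \<B> f (kropina_domain D b) (kropina L b)
            \<longleftrightarrow> hyperplane_second_kind \<A> \<B> f D L) \<and>
         (hyperplane_third_kind \<A> \<B> f (kropina_domain D b) (kropina L b)
            \<longleftrightarrow> hyperplane_third_kind \<A> \<B> f D L)"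
proof -
  have n: "CARD('n) = CARD('m) + 1" using assms(6) by (simp add: hypersurface_def)
  have tangent: "(\<Sum>i\<in>UNIV. b c (param c d f u) (support (param c d f) u v) $ i * N $ i) = 0"
    if "c \<in> \<A>" "d \<in> \<B>" "u \<in> param_domain c d f" "(param c d f u, support (param c d f) u v) \<in> D c"
      "unit_normal (L c) (param c d f) u v N" for c d u v N
    using assms(8) that by (auto simp: tangent_to_hypersurface_def hyp_domain_def)
  note chart = kropina_chart_exists[OF assms(2-4,7)]
  have second: "(\<forall>v. (param c d f u, support (param c d f) u v) \<in> kropina_domain D b c \<longrightarrow>
        (\<forall>N. unit_normal (kropina L b c) (param c d f) u v N \<longrightarrow> (\<forall>\<alpha> \<beta>. H_tensor (kropina L b c) (param c d f) u v N \<alpha> \<beta> = 0))) \<longleftrightarrow>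
      (\<forall>v. (param c d f u, support (param c d f) u v) \<in> D c \<longrightarrow>
        (\<forall>N. unit_normal (L c) (param c d f) u v N \<longrightarrow> (\<forall>\<alpha> \<beta>. H_tensor (L c) (param c d f) u v N \<alpha> \<beta> = 0)))"
    if cd: "c \<in> \<A>" "d \<in> \<B>" "u \<in> param_domain c d f" for c d u
  proof -
    obtain \<rho> where k: "kropina_chart (D c) (L c) (b c) \<rho> (kropina_domain D b c) (kropina L b c)"
      using chart[OF cd(1)] .
    show ?thesis
      by (rule kropina_chart.second_kind_L'_iff[OF k n]) (rule tangent[OF cd])
  qed
  have third: "(\<forall>v. (param c d f u, support (param c d f) u v) \<in> kropina_domain D b c \<longrightarrow>
        (\<forall>N. unit_normal (kropina L b c) (param c d f) u v N \<longrightarrow> (\<forall>\<alpha> \<beta>. H_tensor (kropina L b c) (param c d f) u v N \<alpha> \<beta> = 0 \<and>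
          M_tensor (kropina L b c) (param c d f) u v N \<alpha> \<beta> = 0))) \<longleftrightarrow>
      (\<forall>v. (param c d f u, support (param c d f) u v) \<in> D c \<longrightarrow>
        (\<forall>N. unit_normal (L c) (param c d f) u v N \<longrightarrow> (\<forall>\<alpha> \<beta>. H_tensor (L c) (param c d f) u v N \<alpha> \<beta> = 0 \<and>
          M_tensor (L c) (param c d f) u v N \<alpha> \<beta> = 0)))"
    if cd: "c \<in> \<A>" "d \<in> \<B>" "u \<in> param_domain c d f" for c d u
  proof -
    obtain \<rho> where k: "kropina_chart (D c) (L c) (b c) \<rho> (kropina_domain D b c) (kropina L b c)"
      using chart[OF cd(1)] .
    show ?thesis
      by (rule kropina_chart.third_kind_L'_iff[OF k n]) (rule tangent[OF cd])
  qed
  \<comment> \<open>Separates u from v, so that the equivalences over a fixed u can be used under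
    the remaining quantifiers.\<close>
  have split: "(\<forall>(u, v)\<in>hyp_domain D c d f. Q u v) \<longleftrightarrow>
      (\<forall>u\<in>param_domain c d f. \<forall>v. (param c d f u, support (param c d f) u v) \<in> D c \<longrightarrow> Q u v)"
    for D :: "('a, 'n) chart \<Rightarrow> ((real ^ 'n) \<times> (real ^ 'n)) set" and c and d :: "('b, 'm) chart" and Q
    by (auto simp: hyp_domain_def)
  show ?thesis
    unfolding hyperplane_second_kind_def hyperplane_third_kind_def split
    by (intro conjI ball_cong refl; (rule second | rule third); assumption)
qed

end
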